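(* Let $\mathfrak g$ be a finite-dimensional real Lie algebra, $A=S(\mathfrak g^{\mathbb C})$, $R>0$, and let $M$ be a Hausdorff locally convex topological vector space over $\mathbb C$ which is pre-Hilbert (i.e. equipped with a hermitian scalar product). Suppose that $\mathcal M=M[[\nu]]$ is a topologically free weakly convergent $\mathcal A$-module of radius $\ge R$, with representation $\pi_\nu$, and for $\nu_0\in D(0,R)$ let $\pi_{\nu_0}$ be the associated representation of $(A,*_{\nu_0})$ in $M$ ($\pi_{\nu_0}(a)m$ is the weak sum of the series $\pi_\nu(a)m$ at $\nu=\nu_0$). Then: 1) For every $\hbar\in D(0,R)$ the equality $\rho_\hbar(X)=-i\,\pi_{i\hbar}(X)$ defines a representation $\rho_\hbar$ of the Lie algebra $\mathfrak g_\hbar$ in $M$. 2) The following two statements are equivalent: a) for every $\hbar\in\,]-R,R[$ the representation $\rho_\hbar$ is unitary; b) the topologically free module $\mathcal M=M[[\nu]]$, equipped with the $\mathbb C[[\nu]]$-valued scalar product naturally extending that of $M$, is strongly unitary.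
   Context: $D(0,R)$ is the open disc of radius $R$ in $\mathbb C$. $\mathcal A=A[[\nu]]$ with $A=S(\mathfrak g^{\mathbb C})$ (polynomials on the complexified dual of $\mathfrak g$) carries the product $f*g=\tau^{-1}(\tau f\cdot\tau g)$, where $\tau:\mathcal A\to\mathcal U_\nu(\mathfrak g^{\mathbb C})=T(\mathfrak g^{\mathbb C})[[\nu]]/\langle x\otimes y-y\otimes x-\nu[x,y]\rangle$ is the Duflo isomorphism $\tau=\sigma\circ J(D)^{1/2}$: $\sigma$ is symmetrization and $J(D)^{1/2}$ is the constant-coefficient infinite-order differential operator with symbol $J(x)^{1/2}=\det\Big(\frac{\sinh(\mathrm{ad}\frac\nu2x)}{\mathrm{ad}\frac\nu2x}\Big)^{1/2}$. For $a,b\in A$, $a*b$ is polynomial in $\nu$; its value at $\nu=\nu_0\in\mathbb C$ is $a*_{\nu_0}b$. $\mathcal A_0=A[\nu]\subset\mathcal A$. $\mathfrak g_\hbar$ is the Lie algebra with underlying space $\mathfrak g$ and bracket $[X,Y]_\hbar=\hbar[X,Y]$ (for non-real $\hbar$: underlying space $\mathfrak g^{\mathbb C}$). A topologically free $\mathcal A$-module is here $\mathcal M=M[[\nu]]$ with a $\mathbb C[[\nu]]$-bilinear action $(a,m)\mapsto\pi_\nu(a)m$ making it a left $\mathcal A$-module. It is weakly convergent of radius $\ge R$ if for all $a\in\mathcal A_0$, $m\in M$ the series $\pi_\nu(a)m$ converges weakly (after pairing with every element of the topological dual of $M$), at every $\nu=\nu_0\in D(0,R)$, to a vector of $M$. A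 representation $\rho$ of a real Lie algebra in a pre-Hilbert space is unitary if all $\rho(X)$ are antihermitian: $\langle\rho(X)u,v\rangle=-\langle u,\rho(X)v\rangle$. Conjugation is extended to $\mathbb C[[\nu]]$ by $\overline\nu=-\nu$ (write $\nu=i\hbar$, $\overline\hbar=\hbar$). The involution on $\mathcal A$ is $(\sum\nu^kf_k)^*=\sum(-\nu)^kf_k^*$, $f_k^*(\xi)=\overline{f_k(\overline\xi)}$, an anti-automorphism of $(\mathcal A,* )$ with $X^*=X$ for $X\in\mathfrak g$. The scalar product of $M$ is extended to $M[[\nu]]$ sesquilinearly (with $\overline\nu=-\nu$) and $\nu$-adically continuously, with values in $\mathbb C[[\nu]]$. A module $\mathcal M$ with a hermitian non-degenerate $\mathbb C[[\nu]]$-valued form is unitary if $\langle\pi_\nu(f)u,v\rangle_\nu=\langle u,\pi_\nu(f^* )v\rangle_\nu$ for all $f\in\mathcal A$, $u,v\in\mathcal M$, and the form is positive definite ($\langle x,x\rangle_\nu>0$ for $x\ne0$, for the lexicographic order on $\mathbb R[[\hbar]]$, $\hbar=-i\nu$); it is strongly unitary if moreover the induced form on $\mathcal M/\nu\mathcal M$ is non-degenerate.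
   Formalization: The scalar product of M is assumed compatible with the topology (u ↦ ⟨u,v⟩ is continuous for each v), and that each π_{ν0} is a representation of (A,*_{ν0}) is taken as a hypothesis; without these the claims can fail. *)

theory Defs
  imports
    "HOL-Analysis.Analysis"
    "HOL-Algebra.QuotRing"
    "HOL-Combinatorics.Permutations"
    "HOL-Computational_Algebra.Formal_Power_Series"
begin

unbundle no vec_syntax
unbundle fps_syntax

section \<open>Lie algebras and complexification\<close>

definition lie_algebra :: "('g::real_vector \<Rightarrow> 'g \<Rightarrow> 'g) \<Rightarrow> bool" where
  "lie_algebra br \<longleftrightarrow> bilinear br \<and> (\<forall>x. br x x = 0) \<and>
     (\<forall>x y z. br x (br y z) + br y (br z x) + br z (br x y) = 0)"

definition finite_dimensional :: "'g::real_vector itself \<Rightarrow> bool" where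
  "finite_dimensional _ \<longleftrightarrow> (\<exists>B :: 'g set. finite B \<and> span B = UNIV)"

text \<open>The complexification of \<open>'g\<close> is \<open>'g \<times> 'g\<close>, where \<open>(x, y)\<close> stands for \<open>x + \<i> y\<close>.\<close>

definition cx_scale :: "complex \<Rightarrow> 'g::real_vector \<times> 'g \<Rightarrow> 'g \<times> 'g" where
  "cx_scale c z = (Re c *\<^sub>R fst z - Im c *\<^sub>R snd z, Re c *\<^sub>R snd z + Im c *\<^sub>R fst z)"

definition cx_bracket :: "('g::real_vector \<Rightarrow> 'g \<Rightarrow> 'g) \<Rightarrow> 'g \<times> 'g \<Rightarrow> 'g \<times> 'g \<Rightarrow> 'g \<times> 'g" where
  "cx_bracket br z w =
     (br (fst z) (fst w) - br (snd z) (snd w), br (fst z) (snd w) + br (snd z) (fst w))"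

text \<open>The complexified dual of \<open>'g\<close>, realised as the real-linear maps from \<open>'g\<close> to the complex
  numbers.\<close>

typedef (overloaded) 'g cdual = "{\<xi> :: 'g::real_vector \<Rightarrow> complex. linear \<xi>}"
  morphisms ev Abs_cdual
proof
  show "(\<lambda>_. 0) \<in> {\<xi> :: 'g \<Rightarrow> complex. linear \<xi>}"
    by (simp add: linear_iff)
qed

setup_lifting type_definition_cdual

lift_definition cdual_line :: "'g::real_vector cdual \<Rightarrow> 'g cdual \<Rightarrow> complex \<Rightarrow> 'g cdual"
  is "\<lambda>\<xi> \<eta> t x. \<xi> x + t * \<eta> x"
  by (auto simp: linear_iff algebra_simps)

lift_definition cdual_cnj :: "'g::real_vector cdual \<Rightarrow> 'g cdual"
  is "\<lambda>\<xi> x. cnj (\<xi> x)"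
  by (auto simp: linear_iff)

definition ev_cx :: "'g::real_vector cdual \<Rightarrow> 'g \<times> 'g \<Rightarrow> complex" where
  "ev_cx \<xi> z = ev \<xi> (fst z) + \<i> * ev \<xi> (snd z)"


section \<open>The symmetric algebra\<close>

text \<open>\<open>S(\<gg>\<^sup>C)\<close> is the algebra of polynomial functions on the complexified dual.\<close>

inductive_set poly_fun :: "('g::real_vector cdual \<Rightarrow> complex) set" where
  poly_fun_const: "(\<lambda>_. c) \<in> poly_fun"
| poly_fun_lin: "(\<lambda>\<xi>. ev_cx \<xi> z) \<in> poly_fun"
| poly_fun_add: "f \<in> poly_fun \<Longrightarrow> g \<in> poly_fun \<Longrightarrow> (\<lambda>\<xi>. f \<xi> + g \<xi>) \<in> poly_fun"
| poly_fun_mult: "f \<in> poly_fun \<Longrightarrow> g \<in> poly_fun \<Longrightarrow> (\<lambda>\<xi>. f \<xi> * g \<xi>) \<in> poly_fun"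

typedef (overloaded) 'g sym = "poly_fun :: ('g::real_vector cdual \<Rightarrow> complex) set"
  morphisms sym_eval Abs_sym
  using poly_fun_const by blast

setup_lifting type_definition_sym

lift_definition sym_const :: "complex \<Rightarrow> 'g::real_vector sym" is "\<lambda>c _. c"
  by (rule poly_fun_const)

lift_definition sym_lin :: "'g::real_vector \<times> 'g \<Rightarrow> 'g sym" is "\<lambda>z \<xi>. ev_cx \<xi> z"
  by (rule poly_fun_lin)

lemma poly_fun_uminus: "f \<in> poly_fun \<Longrightarrow> (\<lambda>\<xi>. - f \<xi>) \<in> poly_fun"
  using poly_fun_mult[OF poly_fun_const[of "-1"]] by simp

lemma poly_fun_diff: "f \<in> poly_fun \<Longrightarrow> g \<in> poly_fun \<Longrightarrow> (\<lambda>\<xi>. f \<xi> - g \<xi>) \<in> poly_fun"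
  using poly_fun_add[OF _ poly_fun_uminus] by fastforce

instantiation sym :: (real_vector) comm_ring_1
begin

lift_definition zero_sym :: "'a sym" is "\<lambda>_. 0" by (rule poly_fun_const)
lift_definition one_sym :: "'a sym" is "\<lambda>_. 1" by (rule poly_fun_const)
lift_definition plus_sym :: "'a sym \<Rightarrow> 'a sym \<Rightarrow> 'a sym" is "\<lambda>f g \<xi>. f \<xi> + g \<xi>"
  by (rule poly_fun_add)
lift_definition times_sym :: "'a sym \<Rightarrow> 'a sym \<Rightarrow> 'a sym" is "\<lambda>f g \<xi>. f \<xi> * g \<xi>"
  by (rule poly_fun_mult)
lift_definition uminus_sym :: "'a sym \<Rightarrow> 'a sym" is "\<lambda>f \<xi>. - f \<xi>"
  by (rule poly_fun_uminus)
lift_definition minus_sym :: "'a sym \<Rightarrow> 'a sym \<Rightarrow> 'a sym" is "\<lambda>f g \<xi>. f \<xi> - g \<xi>"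
  by (rule poly_fun_diff)

instance
  by standard (transfer; auto simp: fun_eq_iff algebra_simps)+

end

lemma cdual_line_ev_cx: "ev_cx (cdual_line \<xi> \<eta> t) z = ev_cx \<xi> z + t * ev_cx \<eta> z"
  by (simp add: ev_cx_def cdual_line.rep_eq algebra_simps)

lemma poly_fun_deriv:
  assumes "f \<in> poly_fun"
  shows "\<exists>g \<in> poly_fun. \<forall>\<xi>. ((\<lambda>t. f (cdual_line \<xi> \<eta> t)) has_field_derivative g \<xi>) (at 0)"
  using assms
proof (induction rule: poly_fun.induct)
  case (poly_fun_const c)
  show ?case by (intro bexI[OF _ poly_fun.poly_fun_const[of 0]]) auto
next
  case (poly_fun_lin z)
  show ?case
    by (intro bexI[OF _ poly_fun.poly_fun_const[of "ev_cx \<eta> z"]])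
      (auto simp: cdual_line_ev_cx intro!: derivative_eq_intros)
next
  case (poly_fun_add f g)
  then obtain f' g' where "f' \<in> poly_fun" "g' \<in> poly_fun"
    "\<And>\<xi>. ((\<lambda>t. f (cdual_line \<xi> \<eta> t)) has_field_derivative f' \<xi>) (at 0)"
    "\<And>\<xi>. ((\<lambda>t. g (cdual_line \<xi> \<eta> t)) has_field_derivative g' \<xi>) (at 0)" by blast
  then show ?case
    by (intro bexI[OF _ poly_fun.poly_fun_add[of f' g']]) (auto intro!: derivative_intros)
next
  case (poly_fun_mult f g)
  then obtain f' g' where *: "f' \<in> poly_fun" "g' \<in> poly_fun"
    "\<And>\<xi>. ((\<lambda>t. f (cdual_line \<xi> \<eta> t)) has_field_derivative f' \<xi>) (at 0)"
    "\<And>\<xi>. ((\<lambda>t. g (cdual_line \<xi> \<eta> t)) has_field_derivative g' \<xi>) (at 0)" by blast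
  have line0: "cdual_line \<xi> \<eta> 0 = \<xi>" for \<xi>
    by (transfer) simp
  have "(\<lambda>\<xi>. f' \<xi> * g \<xi> + g' \<xi> * f \<xi>) \<in> poly_fun"
    using * poly_fun_mult(1,2)
    by (intro poly_fun.poly_fun_add poly_fun.poly_fun_mult) auto
  moreover have "((\<lambda>t. f (cdual_line \<xi> \<eta> t) * g (cdual_line \<xi> \<eta> t)) has_field_derivative
      (f' \<xi> * g \<xi> + g' \<xi> * f \<xi>)) (at 0)" for \<xi>
    using DERIV_mult[OF *(3,4)[of \<xi>]] by (simp add: line0)
  ultimately show ?case by (intro bexI allI)
qed

lift_definition sym_deriv :: "'g::real_vector cdual \<Rightarrow> 'g sym \<Rightarrow> 'g sym"
  is "\<lambda>\<eta> f \<xi>. deriv (\<lambda>t. f (cdual_line \<xi> \<eta> t)) 0"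
proof -
  fix \<eta> :: "'g cdual" and f :: "'g cdual \<Rightarrow> complex"
  assume "f \<in> poly_fun"
  from poly_fun_deriv[OF this, of \<eta>] obtain g where g: "g \<in> poly_fun"
    "\<forall>\<xi>. ((\<lambda>t. f (cdual_line \<xi> \<eta> t)) has_field_derivative g \<xi>) (at 0)" by blast
  then have "(\<lambda>\<xi>. deriv (\<lambda>t. f (cdual_line \<xi> \<eta> t)) 0) = g"
    by (auto simp: fun_eq_iff intro: DERIV_imp_deriv)
  with g show "(\<lambda>\<xi>. deriv (\<lambda>t. f (cdual_line \<xi> \<eta> t)) 0) \<in> poly_fun" by simp
qed

lift_definition sym_cnj :: "'g::real_vector sym \<Rightarrow> 'g sym"
  is "\<lambda>f \<xi>. cnj (f (cdual_cnj \<xi>))"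
proof -
  fix f :: "'g cdual \<Rightarrow> complex"
  assume "f \<in> poly_fun"
  then show "(\<lambda>\<xi>. cnj (f (cdual_cnj \<xi>))) \<in> poly_fun"
  proof (induction rule: poly_fun.induct)
    case (poly_fun_lin z)
    have "linear (ev \<xi>)" for \<xi> :: "'g cdual" using ev[of \<xi>] by simp
    then have "ev \<xi> (- x) = - ev \<xi> x" for \<xi> :: "'g cdual" and x
      by (rule linear_neg)
    then have "(\<lambda>\<xi>. cnj (ev_cx (cdual_cnj \<xi>) z)) = (\<lambda>\<xi>. ev_cx \<xi> (fst z, - snd z))"
      by (simp add: fun_eq_iff ev_cx_def cdual_cnj.rep_eq)
    then show ?case using poly_fun.poly_fun_lin[of "(fst z, - snd z)"] by simp
  qed (auto intro: poly_fun.intros)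
qed

text \<open>Series in \<open>\<nu>\<close> are of type \<open>fps\<close>, with \<open>fps_X\<close> as \<open>\<nu>\<close>.\<close>

definition sym_series_scale :: "complex fps \<Rightarrow> 'g::real_vector sym fps \<Rightarrow> 'g sym fps" where
  "sym_series_scale c F = Abs_fps (\<lambda>n. sym_const (c $ n)) * F"

definition sym_series_star :: "'g::real_vector sym fps \<Rightarrow> 'g sym fps" where
  "sym_series_star F = Abs_fps (\<lambda>k. sym_const ((-1) ^ k) * sym_cnj (F $ k))"

definition sym_polys :: "'g::real_vector sym fps set" where
  "sym_polys = {F. finite {n. F $ n \<noteq> 0}}"


section \<open>The tensor algebra\<close>

text \<open>A tensor is represented by its pairings with all finite sequences of elements of the
  complexified dual: \<open>x\<^sub>1 \<otimes> \<dots> \<otimes> x\<^sub>n\<close> is the function that sends a list \<open>[\<xi>\<^sub>1, \<dots>, \<xi>\<^sub>n]\<close> of length \<open>n\<close> to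
  \<open>\<xi>\<^sub>1(x\<^sub>1) \<dots> \<xi>\<^sub>n(x\<^sub>n)\<close> and lists of any other length to \<open>0\<close>. The tensor algebra is the algebra
  generated by the elements of \<open>\<gg>\<^sup>C\<close>.\<close>

definition conc_mult :: "('a list \<Rightarrow> complex) \<Rightarrow> ('a list \<Rightarrow> complex) \<Rightarrow> 'a list \<Rightarrow> complex" where
  "conc_mult s t xs = (\<Sum>k\<le>length xs. s (take k xs) * t (drop k xs))"

inductive_set tens_fun :: "('g::real_vector cdual list \<Rightarrow> complex) set" where
  tens_fun_const: "(\<lambda>\<xi>s. if \<xi>s = [] then c else 0) \<in> tens_fun"
| tens_fun_lin: "(\<lambda>\<xi>s. case \<xi>s of [\<xi>] \<Rightarrow> ev_cx \<xi> z | _ \<Rightarrow> 0) \<in> tens_fun"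
| tens_fun_add: "s \<in> tens_fun \<Longrightarrow> t \<in> tens_fun \<Longrightarrow> (\<lambda>\<xi>s. s \<xi>s + t \<xi>s) \<in> tens_fun"
| tens_fun_mult: "s \<in> tens_fun \<Longrightarrow> t \<in> tens_fun \<Longrightarrow> conc_mult s t \<in> tens_fun"

typedef (overloaded) 'g tens = "tens_fun :: ('g::real_vector cdual list \<Rightarrow> complex) set"
  using tens_fun_const by blast

setup_lifting type_definition_tens

lift_definition tens_const :: "complex \<Rightarrow> 'g::real_vector tens"
  is "\<lambda>c \<xi>s. if \<xi>s = [] then c else 0"
  by (rule tens_fun_const)

lift_definition tens_lin :: "'g::real_vector \<times> 'g \<Rightarrow> 'g tens"
  is "\<lambda>z \<xi>s. case \<xi>s of [\<xi>] \<Rightarrow> ev_cx \<xi> z | _ \<Rightarrow> 0"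
  by (rule tens_fun_lin)

lemma conc_mult_const_left: "conc_mult (\<lambda>\<xi>s. if \<xi>s = [] then c else 0) t = (\<lambda>\<xi>s. c * t \<xi>s)"
proof
  fix xs
  have "conc_mult (\<lambda>\<xi>s. if \<xi>s = [] then c else 0) t xs =
      (\<Sum>k\<le>length xs. if k = 0 then c * t xs else 0)"
    unfolding conc_mult_def by (intro sum.cong) auto
  then show "conc_mult (\<lambda>\<xi>s. if \<xi>s = [] then c else 0) t xs = c * t xs" by simp
qed

lemma conc_mult_const_right: "conc_mult t (\<lambda>\<xi>s. if \<xi>s = [] then c else 0) = (\<lambda>\<xi>s. t \<xi>s * c)"
proof
  fix xs
  have "conc_mult t (\<lambda>\<xi>s. if \<xi>s = [] then c else 0) xs =
      (\<Sum>k\<le>length xs. if k = length xs then t xs * c else 0)"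
    unfolding conc_mult_def by (intro sum.cong) auto
  then show "conc_mult t (\<lambda>\<xi>s. if \<xi>s = [] then c else 0) xs = t xs * c" by simp
qed

lemma tens_fun_uminus: "s \<in> tens_fun \<Longrightarrow> (\<lambda>\<xi>s. - s \<xi>s) \<in> tens_fun"
  using tens_fun_mult[OF tens_fun_const[of "-1"]] by (simp add: conc_mult_const_left)

lemma tens_fun_diff: "s \<in> tens_fun \<Longrightarrow> t \<in> tens_fun \<Longrightarrow> (\<lambda>\<xi>s. s \<xi>s - t \<xi>s) \<in> tens_fun"
  using tens_fun_add[OF _ tens_fun_uminus] by fastforce

lemma conc_mult_assoc: "conc_mult (conc_mult r s) t = conc_mult r (conc_mult s t)"
proof
  fix xs :: "'a list"
  let ?n = "length xs"
  let ?h = "\<lambda>i k. r (take i xs) * s (drop i (take k xs)) * t (drop k xs)"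
  have "conc_mult (conc_mult r s) t xs = (\<Sum>k\<le>?n. \<Sum>i\<le>k. ?h i k)"
    unfolding conc_mult_def
    by (intro sum.cong refl) (auto simp: sum_distrib_right min_absorb1 min_absorb2 intro!: sum.cong)
  also have "\<dots> = (\<Sum>i\<le>?n. \<Sum>k\<in>{i..?n}. ?h i k)"
    unfolding sum.Sigma[OF finite_atMost ballI[OF finite_atMost]]
      sum.Sigma[OF finite_atMost ballI[OF finite_atLeastAtMost]]
    by (rule sum.reindex_bij_witness[of _ "\<lambda>(i, k). (k, i)" "\<lambda>(i, k). (k, i)"]) auto
  also have "\<dots> = (\<Sum>i\<le>?n. \<Sum>j\<le>?n - i. ?h i (i + j))"
  proof (rule sum.cong[OF refl])
    fix i assume "i \<in> {..?n}"
    then show "(\<Sum>k\<in>{i..?n}. ?h i k) = (\<Sum>j\<le>?n - i. ?h i (i + j))"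
      by (intro sum.reindex_bij_witness[of _ "\<lambda>j. i + j" "\<lambda>k. k - i"]) auto
  qed
  also have "\<dots> = conc_mult r (conc_mult s t) xs"
    unfolding conc_mult_def
    by (intro sum.cong refl)
      (auto simp: sum_distrib_left take_drop add.commute mult.assoc intro!: sum.cong)
  finally show "conc_mult (conc_mult r s) t xs = conc_mult r (conc_mult s t) xs" .
qed

instantiation tens :: (real_vector) ring_1
begin

lift_definition zero_tens :: "'a tens" is "\<lambda>_. 0" using tens_fun_const[of 0] by simp
lift_definition one_tens :: "'a tens" is "\<lambda>\<xi>s. if \<xi>s = [] then 1 else 0" by (rule tens_fun_const)
lift_definition plus_tens :: "'a tens \<Rightarrow> 'a tens \<Rightarrow> 'a tens" is "\<lambda>s t \<xi>s. s \<xi>s + t \<xi>s"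
  by (rule tens_fun_add)
lift_definition times_tens :: "'a tens \<Rightarrow> 'a tens \<Rightarrow> 'a tens" is conc_mult
  by (rule tens_fun_mult)
lift_definition uminus_tens :: "'a tens \<Rightarrow> 'a tens" is "\<lambda>s \<xi>s. - s \<xi>s"
  by (rule tens_fun_uminus)
lift_definition minus_tens :: "'a tens \<Rightarrow> 'a tens \<Rightarrow> 'a tens" is "\<lambda>s t \<xi>s. s \<xi>s - t \<xi>s"
  by (rule tens_fun_diff)

instance
proof
  fix a b c :: "'a tens"
  show "a * b * c = a * (b * c)" by transfer (rule conc_mult_assoc)
  show "1 * a = a" by transfer (simp add: conc_mult_const_left)
  show "a * 1 = a" by transfer (simp add: conc_mult_const_right)
  show "(a + b) * c = a * c + b * c"
    by transfer (simp add: conc_mult_def fun_eq_iff algebra_simps sum.distrib)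
  show "a * (b + c) = a * b + a * c"
    by transfer (simp add: conc_mult_def fun_eq_iff algebra_simps sum.distrib)
  show "(0 :: 'a tens) \<noteq> 1" by transfer (auto simp: fun_eq_iff)
qed (transfer; simp add: fun_eq_iff)+

end


section \<open>The quantized enveloping algebra and the Duflo isomorphism\<close>

definition tens_series_ring :: "'g::real_vector tens fps ring" where
  "tens_series_ring = \<lparr>carrier = UNIV, mult = (*), one = 1, zero = 0, add = (+)\<rparr>"

definition env_relations :: "('g::real_vector \<Rightarrow> 'g \<Rightarrow> 'g) \<Rightarrow> 'g tens fps set" where
  "env_relations br = {fps_const (tens_lin x * tens_lin y - tens_lin y * tens_lin x)
     - fps_X * fps_const (tens_lin (cx_bracket br x y)) | x y. True}"

text \<open>The quotient is by the \<open>\<nu>\<close>-adically closed ideal (the topology of \<open>fps\<close> is the \<open>\<nu>\<close>-adic one);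
  the ideal generated algebraically need not be closed, and modulo that ideal the Duflo map is not
  onto.\<close>

definition env_ideal :: "('g::real_vector \<Rightarrow> 'g \<Rightarrow> 'g) \<Rightarrow> 'g tens fps set" where
  "env_ideal br = closure (genideal tens_series_ring (env_relations br))"

definition env_alg :: "('g::real_vector \<Rightarrow> 'g \<Rightarrow> 'g) \<Rightarrow> 'g tens fps set ring" where
  "env_alg br = FactRing tens_series_ring (env_ideal br)"

text \<open>Symmetrization with values in the tensor algebra; symmetrization proper is its composition
  with the projection to the enveloping algebra.\<close>

definition sym_tens :: "'g::real_vector sym \<Rightarrow> 'g tens" where
  "sym_tens = (THE s. (\<forall>f g. s (f + g) = s f + s g) \<and>
     (\<forall>c f. s (sym_const c * f) = tens_const c * s f) \<and>
     (\<forall>xs. s (prod_list (map sym_lin xs)) =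
        tens_const (1 / fact (length xs)) *
        (\<Sum>p | p permutes {..<length xs}. prod_list (map tens_lin (permute_list p xs)))))"

definition symmetrization ::
    "('g::real_vector \<Rightarrow> 'g \<Rightarrow> 'g) \<Rightarrow> 'g sym fps \<Rightarrow> 'g tens fps set" where
  "symmetrization br F =
     a_r_coset tens_series_ring (env_ideal br) (Abs_fps (\<lambda>n. sym_tens (F $ n)))"

text \<open>\<open>diff_op_symbol p P\<close>: \<open>P\<close> is obtained from the polynomial \<open>p\<close> on \<open>\<gg>\<close> by replacing each linear
  form \<open>\<eta>\<close> with the derivative in direction \<open>\<eta>\<close>.\<close>

inductive diff_op_symbol ::
    "('g::real_vector \<Rightarrow> complex) \<Rightarrow> ('g sym \<Rightarrow> 'g sym) \<Rightarrow> bool" where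
  "diff_op_symbol (\<lambda>_. c) (\<lambda>f. sym_const c * f)"
| "diff_op_symbol (ev \<eta>) (sym_deriv \<eta>)"
| "diff_op_symbol p P \<Longrightarrow> diff_op_symbol q Q \<Longrightarrow>
     diff_op_symbol (\<lambda>x. p x + q x) (\<lambda>f. P f + Q f)"
| "diff_op_symbol p P \<Longrightarrow> diff_op_symbol q Q \<Longrightarrow>
     diff_op_symbol (\<lambda>x. p x * q x) (\<lambda>f. P (Q f))"

definition diff_op :: "('g::real_vector \<Rightarrow> complex) \<Rightarrow> 'g sym \<Rightarrow> 'g sym" where
  "diff_op p = (THE P. diff_op_symbol p P)"

text \<open>Entries, in some basis of \<open>\<gg>\<close>, of
  \<open>sinh (ad (\<nu>/2) x) / (ad (\<nu>/2) x) = \<Sum>\<^sub>k (\<nu>/2)\<^bsup>2k\<^esup> (ad x)\<^bsup>2k\<^esup> / (2k+1)!\<close>.\<close>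

definition duflo_matrix ::
    "('g::real_vector \<Rightarrow> 'g \<Rightarrow> 'g) \<Rightarrow> 'g \<Rightarrow> 'g \<Rightarrow> 'g \<Rightarrow> real fps" where
  "duflo_matrix br x i j = Abs_fps (\<lambda>n. if even n
     then representation (extend_basis {}) ((br x ^^ n) j) i / (2 ^ n * fact (n + 1)) else 0)"

definition duflo_J :: "('g::real_vector \<Rightarrow> 'g \<Rightarrow> 'g) \<Rightarrow> 'g \<Rightarrow> real fps" where
  "duflo_J br x = (\<Sum>p | p permutes (extend_basis {} :: 'g set).
     of_int (sign p) * (\<Prod>i\<in>extend_basis {}. duflo_matrix br x i (p i)))"

text \<open>The square root is the one with constant term \<open>1\<close>. The coefficient of \<open>\<nu>\<^sup>k\<close> is a homogeneous
  polynomial of degree \<open>k\<close> in \<open>x\<close>.\<close>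

definition duflo_J_sqrt :: "('g::real_vector \<Rightarrow> 'g \<Rightarrow> 'g) \<Rightarrow> 'g \<Rightarrow> real fps" where
  "duflo_J_sqrt br x = fps_radical root 2 (duflo_J br x)"

definition duflo_op :: "('g::real_vector \<Rightarrow> 'g \<Rightarrow> 'g) \<Rightarrow> 'g sym fps \<Rightarrow> 'g sym fps" where
  "duflo_op br F = Abs_fps (\<lambda>n. \<Sum>k\<le>n.
     diff_op (\<lambda>x. complex_of_real (duflo_J_sqrt br x $ k)) (F $ (n - k)))"

definition duflo :: "('g::real_vector \<Rightarrow> 'g \<Rightarrow> 'g) \<Rightarrow> 'g sym fps \<Rightarrow> 'g tens fps set" where
  "duflo br = symmetrization br \<circ> duflo_op br"

definition star_prod ::
    "('g::real_vector \<Rightarrow> 'g \<Rightarrow> 'g) \<Rightarrow> 'g sym fps \<Rightarrow> 'g sym fps \<Rightarrow> 'g sym fps" where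
  "star_prod br F G = inv_into UNIV (duflo br) (duflo br F \<otimes>\<^bsub>env_alg br\<^esub> duflo br G)"

text \<open>The sum is finite, since \<open>star_prod br (fps_const a) (fps_const b)\<close> is polynomial in \<open>\<nu>\<close>.\<close>

definition star_at ::
    "('g::real_vector \<Rightarrow> 'g \<Rightarrow> 'g) \<Rightarrow> complex \<Rightarrow> 'g sym \<Rightarrow> 'g sym \<Rightarrow> 'g sym" where
  "star_at br \<nu>\<^sub>0 a b = (let F = star_prod br (fps_const a) (fps_const b) in
     \<Sum>k | F $ k \<noteq> 0. sym_const (\<nu>\<^sub>0 ^ k) * F $ k)"


section \<open>Complex topological vector spaces\<close>

definition locally_convex_space ::
    "(complex \<Rightarrow> 'm::topological_ab_group_add \<Rightarrow> 'm) \<Rightarrow> bool" where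
  "locally_convex_space smul \<longleftrightarrow> vector_space smul \<and>
     continuous_on UNIV (\<lambda>(c, x). smul c x) \<and>
     (\<forall>U. open U \<and> 0 \<in> U \<longrightarrow> (\<exists>V. open V \<and> 0 \<in> V \<and> V \<subseteq> U \<and>
        (\<forall>x\<in>V. \<forall>y\<in>V. \<forall>t\<in>{0..1::real}.
           smul (of_real (1 - t)) x + smul (of_real t) y \<in> V)))"

definition top_dual ::
    "(complex \<Rightarrow> 'm::topological_ab_group_add \<Rightarrow> 'm) \<Rightarrow> ('m \<Rightarrow> complex) set" where
  "top_dual smul = {\<phi>. Vector_Spaces.linear smul (*) \<phi> \<and> continuous_on UNIV \<phi>}"

definition has_weak_sum ::
    "(complex \<Rightarrow> 'm::topological_ab_group_add \<Rightarrow> 'm) \<Rightarrow> (nat \<Rightarrow> 'm) \<Rightarrow> 'm \<Rightarrow> bool" where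
  "has_weak_sum smul f s \<longleftrightarrow> (\<forall>\<phi>\<in>top_dual smul. (\<lambda>k. \<phi> (f k)) sums \<phi> s)"

text \<open>The last clause is the compatibility of the scalar product with the topology: the linear
  forms \<open>u \<mapsto> ip u v\<close> belong to the topological dual. It holds in particular if the topology
  is that of the norm of the scalar product. Scalar products are linear in the first argument.\<close>

definition pre_hilbert ::
    "(complex \<Rightarrow> 'm::topological_ab_group_add \<Rightarrow> 'm) \<Rightarrow> ('m \<Rightarrow> 'm \<Rightarrow> complex) \<Rightarrow> bool" where
  "pre_hilbert smul ip \<longleftrightarrow>
     (\<forall>u v w. ip (u + v) w = ip u w + ip v w) \<and>
     (\<forall>c u v. ip (smul c u) v = c * ip u v) \<and>
     (\<forall>u v. ip v u = cnj (ip u v)) \<and>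
     (\<forall>u. u \<noteq> 0 \<longrightarrow> Re (ip u u) > 0) \<and>
     (\<forall>v. continuous_on UNIV (\<lambda>u. ip u v))"


section \<open>Topologically free modules and representations\<close>

definition series_scale ::
    "(complex \<Rightarrow> 'm::ab_group_add \<Rightarrow> 'm) \<Rightarrow> complex fps \<Rightarrow> 'm fps \<Rightarrow> 'm fps" where
  "series_scale smul c u = Abs_fps (\<lambda>n. \<Sum>i\<le>n. smul (c $ i) (u $ (n - i)))"

definition top_free_module ::
    "('g::real_vector \<Rightarrow> 'g \<Rightarrow> 'g) \<Rightarrow> (complex \<Rightarrow> 'm::ab_group_add \<Rightarrow> 'm) \<Rightarrow>
     ('g sym fps \<Rightarrow> 'm fps \<Rightarrow> 'm fps) \<Rightarrow> bool" where
  "top_free_module br smul \<pi> \<longleftrightarrow>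
     (\<forall>F G u. \<pi> (F + G) u = \<pi> F u + \<pi> G u) \<and>
     (\<forall>F u v. \<pi> F (u + v) = \<pi> F u + \<pi> F v) \<and>
     (\<forall>c F u. \<pi> (sym_series_scale c F) u = series_scale smul c (\<pi> F u)) \<and>
     (\<forall>c F u. \<pi> F (series_scale smul c u) = series_scale smul c (\<pi> F u)) \<and>
     (\<forall>u. \<pi> 1 u = u) \<and>
     (\<forall>F G u. \<pi> (star_prod br F G) u = \<pi> F (\<pi> G u))"

definition weakly_convergent ::
    "(complex \<Rightarrow> 'm::topological_ab_group_add \<Rightarrow> 'm) \<Rightarrow>
     ('g::real_vector sym fps \<Rightarrow> 'm fps \<Rightarrow> 'm fps) \<Rightarrow> real \<Rightarrow> bool" where
  "weakly_convergent smul \<pi> R \<longleftrightarrow>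
     (\<forall>F\<in>sym_polys. \<forall>m. \<forall>\<nu>\<^sub>0\<in>ball 0 R.
        \<exists>s. has_weak_sum smul (\<lambda>k. smul (\<nu>\<^sub>0 ^ k) (\<pi> F (fps_const m) $ k)) s)"

definition rep_at ::
    "(complex \<Rightarrow> 'm::topological_ab_group_add \<Rightarrow> 'm) \<Rightarrow>
     ('g::real_vector sym fps \<Rightarrow> 'm fps \<Rightarrow> 'm fps) \<Rightarrow> complex \<Rightarrow> 'g sym \<Rightarrow> 'm \<Rightarrow> 'm" where
  "rep_at smul \<pi> \<nu>\<^sub>0 a m = (THE s.
     has_weak_sum smul (\<lambda>k. smul (\<nu>\<^sub>0 ^ k) (\<pi> (fps_const a) (fps_const m) $ k)) s)"

text \<open>If \<open>\<pi>\<close> is a weakly convergent module, then \<open>rep_at smul \<pi> \<nu>\<^sub>0\<close> is linear and unital, but for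
  discontinuous coefficients of \<open>\<pi>\<close> it can fail to be multiplicative; that it is a representation
  of the algebra with the product \<open>star_at br \<nu>\<^sub>0\<close> is therefore stated by \<open>algebra_rep\<close>.\<close>

definition algebra_rep ::
    "('g::real_vector sym \<Rightarrow> 'g sym \<Rightarrow> 'g sym) \<Rightarrow> (complex \<Rightarrow> 'm::ab_group_add \<Rightarrow> 'm) \<Rightarrow>
     ('g sym \<Rightarrow> 'm \<Rightarrow> 'm) \<Rightarrow> bool" where
  "algebra_rep prd smul \<rho> \<longleftrightarrow>
     (\<forall>a. Vector_Spaces.linear smul smul (\<rho> a)) \<and>
     (\<forall>a b u. \<rho> (a + b) u = \<rho> a u + \<rho> b u) \<and>
     (\<forall>c a u. \<rho> (sym_const c * a) u = smul c (\<rho> a u)) \<and>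
     (\<forall>u. \<rho> 1 u = u) \<and>
     (\<forall>a b u. \<rho> (prd a b) u = \<rho> a (\<rho> b u))"

text \<open>Representation, in a complex vector space with scalar multiplication \<open>smul\<close>, of a Lie algebra
  over a field \<open>'k\<close> (in the uses below, the reals or the complex numbers) that \<open>j\<close> embeds into
  the complex numbers; \<open>scaleL\<close> and \<open>br\<close> are the scalar multiplication and the bracket of
  the Lie algebra.\<close>

definition lie_rep ::
    "('k \<Rightarrow> complex) \<Rightarrow> ('k \<Rightarrow> 'l::ab_group_add \<Rightarrow> 'l) \<Rightarrow> ('l \<Rightarrow> 'l \<Rightarrow> 'l) \<Rightarrow>
     (complex \<Rightarrow> 'm::ab_group_add \<Rightarrow> 'm) \<Rightarrow> ('l \<Rightarrow> 'm \<Rightarrow> 'm) \<Rightarrow> bool" where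
  "lie_rep j scaleL br smul \<rho> \<longleftrightarrow>
     (\<forall>X. Vector_Spaces.linear smul smul (\<rho> X)) \<and>
     (\<forall>X Y u. \<rho> (X + Y) u = \<rho> X u + \<rho> Y u) \<and>
     (\<forall>c X u. \<rho> (scaleL c X) u = smul (j c) (\<rho> X u)) \<and>
     (\<forall>X Y u. \<rho> (br X Y) u = \<rho> X (\<rho> Y u) - \<rho> Y (\<rho> X u))"

definition unitary_rep :: "('m \<Rightarrow> 'm \<Rightarrow> complex) \<Rightarrow> ('l \<Rightarrow> 'm \<Rightarrow> 'm) \<Rightarrow> bool" where
  "unitary_rep ip \<rho> \<longleftrightarrow> (\<forall>X u v. ip (\<rho> X u) v = - ip u (\<rho> X v))"

definition rho ::
    "(complex \<Rightarrow> 'm::topological_ab_group_add \<Rightarrow> 'm) \<Rightarrow>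
     ('g::real_vector sym fps \<Rightarrow> 'm fps \<Rightarrow> 'm fps) \<Rightarrow> complex \<Rightarrow> 'g \<times> 'g \<Rightarrow> 'm \<Rightarrow> 'm" where
  "rho smul \<pi> h X m = smul (- \<i>) (rep_at smul \<pi> (\<i> * h) (sym_lin X) m)"


section \<open>Unitary modules\<close>

definition fps_cnj :: "complex fps \<Rightarrow> complex fps" where
  "fps_cnj c = Abs_fps (\<lambda>k. (-1) ^ k * cnj (c $ k))"

text \<open>\<open>\<Sum> c\<^sub>k \<nu>\<^sup>k\<close>, rewritten as the series \<open>\<Sum> c\<^sub>k \<i>\<^sup>k \<hbar>\<^sup>k\<close>, has real coefficients and is positive for the
  lexicographic order.\<close>

definition fps_pos :: "complex fps \<Rightarrow> bool" where
  "fps_pos c \<longleftrightarrow> (\<forall>k. \<i> ^ k * c $ k \<in> \<real>) \<and>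
     (\<exists>n. Re (\<i> ^ n * c $ n) > 0 \<and> (\<forall>k<n. c $ k = 0))"

definition form_ext :: "('m::ab_group_add \<Rightarrow> 'm \<Rightarrow> complex) \<Rightarrow> 'm fps \<Rightarrow> 'm fps \<Rightarrow> complex fps" where
  "form_ext ip u v = Abs_fps (\<lambda>n. \<Sum>l\<le>n. (-1) ^ l * ip (u $ (n - l)) (v $ l))"

definition hermitian_form ::
    "(complex \<Rightarrow> 'm::ab_group_add \<Rightarrow> 'm) \<Rightarrow> ('m fps \<Rightarrow> 'm fps \<Rightarrow> complex fps) \<Rightarrow> bool" where
  "hermitian_form smul B \<longleftrightarrow>
     (\<forall>u v w. B (u + v) w = B u w + B v w) \<and>
     (\<forall>c u v. B (series_scale smul c u) v = c * B u v) \<and>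
     (\<forall>u v. B v u = fps_cnj (B u v))"

definition unitary_module ::
    "(complex \<Rightarrow> 'm::ab_group_add \<Rightarrow> 'm) \<Rightarrow>
     ('g::real_vector sym fps \<Rightarrow> 'm fps \<Rightarrow> 'm fps) \<Rightarrow> ('m fps \<Rightarrow> 'm fps \<Rightarrow> complex fps) \<Rightarrow> bool" where
  "unitary_module smul \<pi> B \<longleftrightarrow>
     hermitian_form smul B \<and>
     (\<forall>u. (\<forall>v. B u v = 0) \<longrightarrow> u = 0) \<and>
     (\<forall>F u v. B (\<pi> F u) v = B u (\<pi> (sym_series_star F) v)) \<and>
     (\<forall>u. u \<noteq> 0 \<longrightarrow> fps_pos (B u u))"

text \<open>The form induced on \<open>\<M> / \<nu>\<M>\<close> has the values \<open>B u v $ 0\<close>.\<close>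

definition strongly_unitary_module ::
    "(complex \<Rightarrow> 'm::ab_group_add \<Rightarrow> 'm) \<Rightarrow>
     ('g::real_vector sym fps \<Rightarrow> 'm fps \<Rightarrow> 'm fps) \<Rightarrow> ('m fps \<Rightarrow> 'm fps \<Rightarrow> complex fps) \<Rightarrow> bool" where
  "strongly_unitary_module smul \<pi> B \<longleftrightarrow>
     unitary_module smul \<pi> B \<and>
     (\<forall>u. (\<forall>v. B u v $ 0 = 0) \<longrightarrow> u \<in> range (series_scale smul fps_X))"

end

theory Submission
  imports Defs
    "HOL-Combinatorics.Multiset_Permutations"
    "HOL-Computational_Algebra.Polynomial_FPS"
    "HOL-Complex_Analysis.Cauchy_Integral_Formula"
begin

unbundle no vec_syntax

text \<open>The Duflo map is injective because the Poincare-Birkhoff-Witt theorem holds for the completed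
  algebra: a diamond-lemma argument gives a linear map from the tensor algebra to \<open>A[[\<nu>]]\<close> that
  kills the relations and inverts symmetrization modulo \<open>\<nu>\<close>. Hence star products can be
  computed in the tensor algebra. In particular \<open>X * Y - Y * X = \<nu> [X, Y]\<close>, and \<open>X * Y\<close> is
  polynomial in \<open>\<nu>\<close>, which gives the representations \<open>\<rho>\<^sub>\<hbar>\<close>.

  For the equivalence, unitarity of all \<open>\<rho>\<^sub>\<hbar>\<close> with \<open>\<hbar>\<close> real is an identity of power series in
  \<open>\<hbar>\<close>, whose coefficients say that the real elements \<open>X\<close> of \<open>\<gg>\<close> act symmetrically. So do their
  star powers; and since \<open>J\<^bsup>1/2\<^esup>\<close> is real and even in \<open>\<nu>\<close>, the ordinary power \<open>X\<^sup>n\<close> is a real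
  combination of \<open>\<nu>\<^bsup>2j\<^esup> X\<^bsup>* (n - 2j)\<^esup>\<close>. By polarization the powers \<open>X\<^sup>n\<close> span \<open>A\<close>.\<close>

section \<open>Polynomial functions on the complexified dual\<close>

text \<open>Symmetrization, \<open>diff_op\<close> and \<open>rep_at\<close> are definite
  descriptions and \<open>star_prod\<close> is an inverse function, so nothing can be computed
  before existence and uniqueness are settled. For the first two, uniqueness rests on powers:
  symmetrization sends X^n to the tensor power, and an operator with symbol p multiplies exp(t X) by
  p(t X). A star product is found by exhibiting an element with the right class modulo the closed
  ideal, which injectivity of the Duflo map then identifies.

  The quotient has no visible basis, so injectivity needs a map out of it that detects leading
  coefficients. Normal forms of words provide it: each exchange of letters costs a bracket with a
  factor \<nu>, so corrections never disturb the leading order.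

  Powers of one element also suit adjoints: taking the adjoint reverses products, which is harmless
  among powers of the same X.

  When u and v are paired, moving the operator to the second argument replaces \<nu> by -cnj \<nu>.
  Both sides are then power series in \<nu>, and this reflection fixes the imaginary axis, where
  \<nu> = \<i> h with h real. Multiplicativity of the specialization at \<nu> enters through the
  hypothesis \<open>algebra_rep\<close>.\<close>

lemma linear_ev: "linear (ev \<xi>)"
  using ev[of \<xi>] by simp

lemma ev_cx_add: "ev_cx \<xi> (z + w) = ev_cx \<xi> z + ev_cx \<xi> w"
  by (simp add: ev_cx_def linear_add[OF linear_ev] algebra_simps)

lemma ev_cx_scale: "ev_cx \<xi> (cx_scale c z) = c * ev_cx \<xi> z"
proof -
  have "complex_of_real (Re c) + \<i> * complex_of_real (Im c) = c"
    by (simp add: complex_eq_iff)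
  then have "c * ev_cx \<xi> z = (complex_of_real (Re c) + \<i> * complex_of_real (Im c)) * ev_cx \<xi> z"
    by simp
  then show ?thesis
    by (simp add: ev_cx_def cx_scale_def linear_add[OF linear_ev] linear_diff[OF linear_ev]
        linear_scale[OF linear_ev] scaleR_conv_of_real algebra_simps)
qed

lemma sym_const_add: "sym_const (a + b) = sym_const a + sym_const b"
  by transfer simp

lemma sym_const_mult: "sym_const (a * b) = sym_const a * sym_const b"
  by transfer simp

lemma sym_const_0 [simp]: "sym_const 0 = 0"
  by transfer simp

lemma sym_const_1 [simp]: "sym_const 1 = 1"
  by transfer simp

lemma sym_const_uminus: "sym_const (- a) = - sym_const a"
  by transfer simp

lemma sym_const_diff: "sym_const (a - b) = sym_const a - sym_const b"
  by transfer simp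

lemma sym_const_power: "sym_const (a ^ n) = sym_const a ^ n"
  by (induction n) (simp_all add: sym_const_mult)

lemma sym_const_of_nat: "sym_const (of_nat n) = of_nat n"
  by (induction n) (simp_all add: sym_const_add)

lemma sym_const_inverse_cancel: "c \<noteq> 0 \<Longrightarrow> sym_const (inverse c) * (sym_const c * f) = f"
  by (simp add: mult.assoc[symmetric] flip: sym_const_mult)

lemma sym_lin_add: "sym_lin (z + w) = sym_lin z + sym_lin w"
  by transfer (simp add: ev_cx_add)

lemma sym_lin_scale: "sym_lin (cx_scale c z) = sym_const c * sym_lin z"
  by transfer (simp add: ev_cx_scale)

lemma sym_lin_complex: "sym_lin (x, y) = sym_lin (x, 0) + sym_const \<i> * sym_lin (y, 0)"
proof -
  have "(x, y) = (x, 0) + cx_scale \<i> (y, 0)" by (simp add: cx_scale_def)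
  then show ?thesis by (simp only: sym_lin_add sym_lin_scale)
qed

lemma sym_induct [case_names const lin add mult]:
  assumes "\<And>c. P (sym_const c)" "\<And>z. P (sym_lin z)"
    and "\<And>f g. P f \<Longrightarrow> P g \<Longrightarrow> P (f + g)" "\<And>f g. P f \<Longrightarrow> P g \<Longrightarrow> P (f * g)"
  shows "P (f :: 'g::real_vector sym)"
proof -
  have "P (Abs_sym p)" if "p \<in> poly_fun" for p :: "'g cdual \<Rightarrow> complex"
    using that
  proof (induction rule: poly_fun.induct)
    case (poly_fun_const c)
    then show ?case using assms(1)[of c] by (simp add: sym_const_def)
  next
    case (poly_fun_lin z)
    then show ?case using assms(2)[of z] by (simp add: sym_lin_def)
  next
    case (poly_fun_add f g)
    then show ?case using assms(3)[of "Abs_sym f" "Abs_sym g"]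
      by (simp add: plus_sym_def Abs_sym_inverse)
  next
    case (poly_fun_mult f g)
    then show ?case using assms(4)[of "Abs_sym f" "Abs_sym g"]
      by (simp add: times_sym_def Abs_sym_inverse)
  qed
  from this[OF sym_eval[of f]] show ?thesis by (simp add: sym_eval_inverse)
qed

section \<open>Spanning by powers of real elements\<close>

inductive_set power_span :: "'g::real_vector sym set" where
  power_span_power: "sym_lin (X, 0) ^ n \<in> power_span"
| power_span_add: "f \<in> power_span \<Longrightarrow> g \<in> power_span \<Longrightarrow> f + g \<in> power_span"
| power_span_scale: "f \<in> power_span \<Longrightarrow> sym_const c * f \<in> power_span"

lemma power_span_0: "0 \<in> power_span"
  using power_span_scale[OF power_span_power, of 0] by simp

lemma power_span_diff: "f \<in> power_span \<Longrightarrow> g \<in> power_span \<Longrightarrow> f - g \<in> power_span"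
  using power_span_add[OF _ power_span_scale[of g "- 1"]] by (simp add: sym_const_uminus)

lemma power_span_sum: "(\<And>i. i \<in> I \<Longrightarrow> f i \<in> power_span) \<Longrightarrow> (\<Sum>i\<in>I. f i) \<in> power_span"
  by (induction I rule: infinite_finite_induct) (auto intro: power_span_0 power_span_add)

text \<open>The combination \<open>p(2t) - 2\<^sup>n p(t)\<close> lowers the degree.\<close>

lemma power_span_coeff:
  fixes v :: "nat \<Rightarrow> 'g::real_vector sym"
  assumes "\<And>t::real. (\<Sum>k\<le>n. sym_const (of_real t ^ k) * v k) \<in> power_span" "k \<le> n"
  shows "v k \<in> power_span"
  using assms
proof (induction n arbitrary: v k)
  case 0
  from "0.prems"(1)[of 1] "0.prems"(2) show ?case by simp
next
  case (Suc n)
  let ?p = "\<lambda>t::real. (\<Sum>k\<le>Suc n. sym_const (of_real t ^ k) * v k)"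
  let ?c = "\<lambda>k. 2 ^ k - 2 ^ Suc n :: complex"
  have low: "v k \<in> power_span" if "k \<le> n" for k
  proof -
    have "(\<Sum>k\<le>n. sym_const (of_real t ^ k) * (sym_const (?c k) * v k)) \<in> power_span" for t :: real
    proof -
      have "?p (2 * t) - sym_const (2 ^ Suc n) * ?p t
          = (\<Sum>k\<le>Suc n. sym_const (of_real t ^ k) * (sym_const (?c k) * v k))"
        unfolding sum_distrib_left sum_subtractf[symmetric]
        by (intro sum.cong refl)
          (simp add: power_mult_distrib sym_const_mult sym_const_diff algebra_simps)
      also have "\<dots> = (\<Sum>k\<le>n. sym_const (of_real t ^ k) * (sym_const (?c k) * v k))"
        by simp
      finally show ?thesis
        using power_span_diff[OF Suc.prems(1)[of "2 * t"]
            power_span_scale[OF Suc.prems(1)[of t], of "2 ^ Suc n"]] by metis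
    qed
    from Suc.IH[OF this that] have "sym_const (?c k) * v k \<in> power_span" .
    moreover have "?c k \<noteq> 0"
    proof -
      have "(2::nat) ^ k \<noteq> 2 ^ Suc n" using that by (subst power_inject_exp) auto
      then have "of_nat (2 ^ k) \<noteq> (of_nat (2 ^ Suc n) :: complex)"
        by (simp only: of_nat_eq_iff not_False_eq_True)
      then show ?thesis by (simp only: of_nat_power of_nat_numeral right_minus_eq not_False_eq_True)
    qed
    ultimately show ?thesis
      using power_span_scale[of "sym_const (?c k) * v k" "inverse (?c k)"]
      by (simp add: sym_const_inverse_cancel)
  qed
  show ?case
  proof (cases "k \<le> n")
    case False
    then have "k = Suc n" using Suc.prems by simp
    have "?p 1 - (\<Sum>k\<le>n. v k) \<in> power_span"
      by (intro power_span_diff Suc.prems power_span_sum low) simp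
    then show ?thesis using \<open>k = Suc n\<close> by simp
  qed (rule low)
qed

text \<open>Up to a binomial coefficient, the product is the coefficient of t^n in (t Y + X)^(m+n),
  which is a power of a real element for every real t.\<close>

lemma power_span_power_mult: "sym_lin (X, 0) ^ m * sym_lin (Y, 0) ^ n \<in> power_span"
proof -
  let ?v = "\<lambda>k. of_nat ((m + n) choose k) * sym_lin (Y, 0) ^ k * sym_lin (X, 0) ^ (m + n - k)"
  have "(\<Sum>k\<le>m + n. sym_const (of_real t ^ k) * ?v k) \<in> power_span" for t :: real
  proof -
    have "sym_lin (t *\<^sub>R Y + X, 0) = sym_const (of_real t) * sym_lin (Y, 0) + sym_lin (X, 0)"
      by (simp add: cx_scale_def flip: sym_lin_scale sym_lin_add)
    then have "sym_lin (t *\<^sub>R Y + X, 0) ^ (m + n) = (\<Sum>k\<le>m + n. sym_const (of_real t ^ k) * ?v k)"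
      by (simp add: binomial_ring power_mult_distrib sym_const_power mult.assoc mult.left_commute)
    then show ?thesis by (metis power_span_power)
  qed
  from power_span_coeff[OF this, of n]
  have "sym_const (of_nat ((m + n) choose n)) * (sym_lin (Y, 0) ^ n * sym_lin (X, 0) ^ m) \<in> power_span"
    by (simp add: sym_const_of_nat mult.assoc)
  from power_span_scale[OF this, of "inverse (of_nat ((m + n) choose n))"] show ?thesis
    by (simp add: sym_const_inverse_cancel mult.commute)
qed

lemma power_span_mult: "f \<in> power_span \<Longrightarrow> g \<in> power_span \<Longrightarrow> f * g \<in> power_span"
proof (induction rule: power_span.induct)
  case (power_span_power X n)
  then show ?case
  proof (induction rule: power_span.induct)
    case (power_span_power Y m)
    show ?case by (rule power_span_power_mult)
  next
    case (power_span_scale f c)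
    then show ?case
      using power_span.power_span_scale[of "sym_lin (X, 0) ^ n * f" c] by (simp add: mult.left_commute)
  qed (auto simp: distrib_left intro: power_span_add)
qed (auto simp: distrib_right mult.assoc intro: power_span_add power_span_scale)

lemma power_span_UNIV: "f \<in> power_span"
proof (induction f rule: sym_induct)
  case (const c)
  show ?case using power_span_scale[OF power_span_power[of 0 0], of c] by simp
next
  case (lin z)
  have "sym_lin (x, 0) \<in> power_span" for x :: 'a
    using power_span_power[of x 1] by simp
  then have "sym_lin (fst z, snd z) \<in> power_span"
    unfolding sym_lin_complex[of "fst z" "snd z"] by (intro power_span_add power_span_scale)
  then show ?case by simp
qed (auto intro: power_span_add power_span_mult)

text \<open>Additive and complex-homogeneous statements need checking only on powers of real
  elements, where symmetrization, differential operators and the Duflo operator have closed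
  formulas.\<close>

lemma sym_power_induct [case_names power add scale]:
  assumes "\<And>X n. P (sym_lin (X, 0) ^ n)"
    and "\<And>f g. P f \<Longrightarrow> P g \<Longrightarrow> P (f + g)" "\<And>c f. P f \<Longrightarrow> P (sym_const c * f)"
  shows "P f"
  using power_span_UNIV[of f] by (induction rule: power_span.induct) (auto intro: assms)

section \<open>Symmetrization\<close>

lemma tens_const_add: "tens_const (a + b) = tens_const a + tens_const b"
  by transfer auto

lemma Rep_tens_const_mult: "Rep_tens (tens_const c * t) = (\<lambda>\<xi>s. c * Rep_tens t \<xi>s)"
  by transfer (simp add: conc_mult_const_left)

lemma tens_const_mult: "tens_const (a * b) = tens_const a * tens_const b"
  by (rule Rep_tens_inject[THEN iffD1]) (simp add: Rep_tens_const_mult tens_const.rep_eq fun_eq_iff)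

lemma tens_const_commute: "t * tens_const c = tens_const c * t"
  by transfer (simp add: conc_mult_const_left conc_mult_const_right mult.commute)

lemma tens_const_left_commute: "s * (tens_const c * t) = tens_const c * (s * t)"
  by (metis mult.assoc tens_const_commute)

lemma tens_const_0 [simp]: "tens_const 0 = 0"
  by transfer auto

lemma tens_const_1 [simp]: "tens_const 1 = 1"
  by transfer auto

lemma tens_const_uminus: "tens_const (- a) = - tens_const a"
  by transfer auto

lemma tens_lin_add: "tens_lin (z + w) = tens_lin z + tens_lin w"
  by transfer (auto simp: ev_cx_add fun_eq_iff split: list.splits)

lemma tens_lin_scale: "tens_lin (cx_scale c z) = tens_const c * tens_lin z"
  by (rule Rep_tens_inject[THEN iffD1])
    (auto simp: Rep_tens_const_mult tens_lin.rep_eq ev_cx_scale fun_eq_iff split: list.splits)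

lemma Rep_tens_lin: "Rep_tens (tens_lin z) \<xi>s = (if length \<xi>s = 1 then ev_cx (hd \<xi>s) z else 0)"
  by (auto simp: tens_lin.rep_eq split: list.splits)

lemma Rep_tens_prod_lin:
  "Rep_tens (prod_list (map tens_lin zs)) \<xi>s =
    (if length \<xi>s = length zs then \<Prod>i<length zs. ev_cx (\<xi>s ! i) (zs ! i) else 0)"
proof (induction zs arbitrary: \<xi>s)
  case Nil
  show ?case by (simp add: one_tens.rep_eq)
next
  case (Cons z zs)
  show ?case
  proof (cases \<xi>s)
    case Nil
    then show ?thesis by (simp add: times_tens.rep_eq conc_mult_def tens_lin.rep_eq)
  next
    case [simp]: (Cons \<xi> \<eta>s)
    let ?q = "Rep_tens (prod_list (map tens_lin zs))"
    have "Rep_tens (prod_list (map tens_lin (z # zs))) \<xi>s =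
        (\<Sum>k\<le>Suc (length \<eta>s). Rep_tens (tens_lin z) (take k \<xi>s) * ?q (drop k \<xi>s))"
      by (simp add: times_tens.rep_eq conc_mult_def)
    \<comment> \<open>Only the cut after the first letter contributes, since
      \<open>tens_lin z\<close> vanishes on lists of any length other than one.\<close>
    also have "\<dots> = (\<Sum>k\<le>Suc (length \<eta>s). if k = 1 then ev_cx \<xi> z * ?q \<eta>s else 0)"
    proof (rule sum.cong[OF refl])
      fix k assume k: "k \<in> {..Suc (length \<eta>s)}"
      show "Rep_tens (tens_lin z) (take k \<xi>s) * ?q (drop k \<xi>s)
          = (if k = 1 then ev_cx \<xi> z * ?q \<eta>s else 0)"
      proof (cases "k = 1")
        case False
        then have "length (take k \<xi>s) \<noteq> 1" using k by simp
        then show ?thesis using False unfolding Rep_tens_lin by simp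
      qed (simp add: Rep_tens_lin)
    qed
    also have "\<dots> = ev_cx \<xi> z * ?q \<eta>s" by (simp del: sum.atMost_Suc)
    finally show ?thesis
      by (simp add: Cons.IH prod.lessThan_Suc_shift del: prod.lessThan_Suc)
  qed
qed

text \<open>Evaluation at \<open>0\<close> of iterated directional derivatives; divided by \<open>n!\<close>, this is the
  symmetric tensor of \<open>f\<close>.\<close>

fun sym_coeff :: "'g::real_vector cdual list \<Rightarrow> 'g sym \<Rightarrow> complex" where
  "sym_coeff [] f = sym_eval f (Abs_cdual (\<lambda>_. 0))"
| "sym_coeff (\<xi> # \<xi>s) f = sym_coeff \<xi>s (sym_deriv \<xi> f)"

lemma sym_has_deriv:
  "((\<lambda>t. sym_eval f (cdual_line \<xi> \<eta> t)) has_field_derivative sym_eval (sym_deriv \<eta> f) \<xi>) (at 0)"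
proof -
  obtain g where g: "\<forall>\<xi>. ((\<lambda>t. sym_eval f (cdual_line \<xi> \<eta> t)) has_field_derivative g \<xi>) (at 0)"
    using poly_fun_deriv[OF sym_eval[of f], of \<eta>] by blast
  have "deriv (\<lambda>t. sym_eval f (cdual_line \<xi> \<eta> t)) 0 = g \<xi>"
    by (rule DERIV_imp_deriv) (rule g[rule_format])
  then show ?thesis using g by (simp add: sym_deriv.rep_eq)
qed

lemma sym_eqI: "(\<And>\<xi>. sym_eval f \<xi> = sym_eval g \<xi>) \<Longrightarrow> f = g"
  by (simp add: sym_eval_inject[symmetric] fun_eq_iff)

lemma cdual_line_0 [simp]: "cdual_line \<xi> \<eta> 0 = \<xi>"
  by transfer simp

lemma sym_deriv_eqI:
  assumes "\<And>\<xi>. ((\<lambda>t. sym_eval f (cdual_line \<xi> \<eta> t)) has_field_derivative sym_eval g \<xi>) (at 0)"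
  shows "sym_deriv \<eta> f = g"
  using DERIV_unique[OF sym_has_deriv assms] by (intro sym_eqI) auto

lemma sym_deriv_add: "sym_deriv \<eta> (f + g) = sym_deriv \<eta> f + sym_deriv \<eta> g"
  by (rule sym_deriv_eqI) (auto simp: plus_sym.rep_eq intro!: derivative_intros sym_has_deriv)

lemma sym_deriv_mult: "sym_deriv \<eta> (f * g) = sym_deriv \<eta> f * g + f * sym_deriv \<eta> g"
  by (rule sym_deriv_eqI)
    (use DERIV_mult[OF sym_has_deriv sym_has_deriv] in
      \<open>auto simp: plus_sym.rep_eq times_sym.rep_eq algebra_simps\<close>)

lemma sym_deriv_const: "sym_deriv \<eta> (sym_const c) = 0"
  by (rule sym_deriv_eqI) (auto simp: sym_const.rep_eq zero_sym.rep_eq)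

lemma sym_deriv_scale: "sym_deriv \<eta> (sym_const c * f) = sym_const c * sym_deriv \<eta> f"
  by (simp add: sym_deriv_mult sym_deriv_const)

lemma sym_deriv_lin: "sym_deriv \<eta> (sym_lin z) = sym_const (ev_cx \<eta> z)"
  by (rule sym_deriv_eqI)
    (auto simp: sym_const.rep_eq sym_lin.rep_eq cdual_line_ev_cx intro!: derivative_eq_intros)

lemma sym_deriv_power_lin:
  "sym_deriv \<eta> (sym_lin z ^ n) = sym_const (of_nat n * ev_cx \<eta> z) * sym_lin z ^ (n - 1)"
proof (induction n)
  case 0
  show ?case using sym_deriv_const[of \<eta> 1] by simp
next
  case (Suc n)
  then show ?case
    by (cases n)
      (simp_all add: sym_deriv_mult sym_deriv_lin sym_const_mult sym_const_add sym_const_of_nat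
        algebra_simps sym_const_of_nat[of 2, simplified])
qed

lemma sym_deriv_prod_lin:
  assumes "finite J"
  shows "sym_deriv \<eta> (\<Prod>j\<in>J. sym_lin (z j)) =
    (\<Sum>j\<in>J. sym_const (ev_cx \<eta> (z j)) * (\<Prod>i\<in>J - {j}. sym_lin (z i)))"
  using assms
proof (induction J rule: finite_induct)
  case empty
  show ?case using sym_deriv_const[of \<eta> 1] by simp
next
  case (insert x J)
  have "(\<Prod>i\<in>insert x J - {j}. sym_lin (z i)) = sym_lin (z x) * (\<Prod>i\<in>J - {j}. sym_lin (z i))"
    if "j \<in> J" for j
  proof -
    have "insert x J - {j} = insert x (J - {j})" using insert that by auto
    then show ?thesis using insert by simp
  qed
  then have "(\<Sum>j\<in>insert x J. sym_const (ev_cx \<eta> (z j)) * (\<Prod>i\<in>insert x J - {j}. sym_lin (z i)))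
    = sym_const (ev_cx \<eta> (z x)) * (\<Prod>j\<in>J. sym_lin (z j)) +
      sym_lin (z x) * (\<Sum>j\<in>J. sym_const (ev_cx \<eta> (z j)) * (\<Prod>i\<in>J - {j}. sym_lin (z i)))"
    using insert by (simp add: sum_distrib_left mult.left_commute)
  then show ?case using insert by (simp add: sym_deriv_mult sym_deriv_lin)
qed

lemma sym_coeff_add: "sym_coeff \<xi>s (f + g) = sym_coeff \<xi>s f + sym_coeff \<xi>s g"
  by (induction \<xi>s arbitrary: f g) (simp_all add: plus_sym.rep_eq sym_deriv_add)

lemma sym_coeff_scale: "sym_coeff \<xi>s (sym_const c * f) = c * sym_coeff \<xi>s f"
  by (induction \<xi>s arbitrary: f) (simp_all add: times_sym.rep_eq sym_const.rep_eq sym_deriv_scale)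

lemma sym_coeff_sum: "sym_coeff \<xi>s (\<Sum>i\<in>I. f i) = (\<Sum>i\<in>I. sym_coeff \<xi>s (f i))"
proof -
  have "sym_coeff \<xi>s 0 = 0" using sym_coeff_scale[of \<xi>s 0 0] by simp
  then show ?thesis
    by (induction I rule: infinite_finite_induct) (simp_all add: sym_coeff_add)
qed

text \<open>By the Leibniz rule each derivative removes one factor, so the surviving terms are
  indexed by the orders in which all factors are removed. Evaluation at \<open>0\<close> kills every
  term with a factor left over, and surplus derivatives give \<open>0\<close>.\<close>

lemma sym_coeff_prod_lin:
  assumes "finite J"
  shows "sym_coeff \<xi>s (\<Prod>j\<in>J. sym_lin (z j)) = (if length \<xi>s = card J then
    \<Sum>js\<in>permutations_of_set J. \<Prod>i<length \<xi>s. ev_cx (\<xi>s ! i) (z (js ! i)) else 0)"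
  using assms
proof (induction \<xi>s arbitrary: J)
  case Nil
  have [simp]: "ev_cx (Abs_cdual (\<lambda>_. 0)) w = 0" for w
    by (simp add: ev_cx_def Abs_cdual_inverse linear_iff)
  have "sym_eval (\<Prod>j\<in>J. sym_lin (z j)) \<xi> = (\<Prod>j\<in>J. ev_cx \<xi> (z j))" for \<xi>
    using Nil by (induction J rule: finite_induct)
      (simp_all add: one_sym.rep_eq times_sym.rep_eq sym_lin.rep_eq)
  then show ?case using Nil by (auto simp: prod_zero_iff)
next
  case (Cons \<xi> \<xi>s)
  have "sym_coeff (\<xi> # \<xi>s) (\<Prod>j\<in>J. sym_lin (z j)) =
     (\<Sum>j\<in>J. ev_cx \<xi> (z j) * sym_coeff \<xi>s (\<Prod>i\<in>J - {j}. sym_lin (z i)))"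
    using Cons.prems by (simp add: sym_deriv_prod_lin sym_coeff_sum sym_coeff_scale)
  also have "\<dots> = (\<Sum>j\<in>J. ev_cx \<xi> (z j) * (if length (\<xi> # \<xi>s) = card J then
    \<Sum>js\<in>permutations_of_set (J - {j}). \<Prod>i<length \<xi>s. ev_cx (\<xi>s ! i) (z (js ! i)) else 0))"
  proof (rule sum.cong[OF refl])
    fix j assume j: "j \<in> J"
    then have "length \<xi>s = card (J - {j}) \<longleftrightarrow> length (\<xi> # \<xi>s) = card J"
      using Cons.prems card_gt_0_iff[of J] by (auto simp: card_Diff_singleton)
    then show "ev_cx \<xi> (z j) * sym_coeff \<xi>s (\<Prod>i\<in>J - {j}. sym_lin (z i)) =
      ev_cx \<xi> (z j) * (if length (\<xi> # \<xi>s) = card J then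
      \<Sum>js\<in>permutations_of_set (J - {j}). \<Prod>i<length \<xi>s. ev_cx (\<xi>s ! i) (z (js ! i)) else 0)"
      using Cons.IH[of "J - {j}"] Cons.prems by simp
  qed
  also have "\<dots> = (if length (\<xi> # \<xi>s) = card J then
    \<Sum>js\<in>permutations_of_set J. \<Prod>i<length (\<xi> # \<xi>s). ev_cx ((\<xi> # \<xi>s) ! i) (z (js ! i)) else 0)"
  proof (cases "length (\<xi> # \<xi>s) = card J")
    case True
    then have "J \<noteq> {}" by auto
    then have "(\<Sum>js\<in>permutations_of_set J. \<Prod>i<length (\<xi> # \<xi>s). ev_cx ((\<xi> # \<xi>s) ! i) (z (js ! i)))
      = (\<Sum>js\<in>(\<Union>j\<in>J. (#) j ` permutations_of_set (J - {j})).
          \<Prod>i<length (\<xi> # \<xi>s). ev_cx ((\<xi> # \<xi>s) ! i) (z (js ! i)))"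
      by (subst permutations_of_set_nonempty) auto
    also have "\<dots> = (\<Sum>j\<in>J. \<Sum>js\<in>(#) j ` permutations_of_set (J - {j}).
          \<Prod>i<length (\<xi> # \<xi>s). ev_cx ((\<xi> # \<xi>s) ! i) (z (js ! i)))"
      using Cons.prems by (intro sum.UNION_disjoint) auto
    also have "\<dots> = (\<Sum>j\<in>J. \<Sum>js\<in>permutations_of_set (J - {j}).
          \<Prod>i<length (\<xi> # \<xi>s). ev_cx ((\<xi> # \<xi>s) ! i) (z ((j # js) ! i)))"
      by (intro sum.cong[OF refl]) (subst sum.reindex, auto simp: inj_on_def)
    also have "\<dots> = (\<Sum>j\<in>J. ev_cx \<xi> (z j) *
        (\<Sum>js\<in>permutations_of_set (J - {j}). \<Prod>i<length \<xi>s. ev_cx (\<xi>s ! i) (z (js ! i))))"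
      by (simp add: prod.lessThan_Suc_shift sum_distrib_left del: prod.lessThan_Suc)
    finally show ?thesis by (simp only: if_P[OF True])
  qed simp
  finally show ?case .
qed

text \<open>Iterated derivatives produce orderings of an index set, whereas \<open>sym_tens\<close>
  is written with permutations. The correspondence is injective into a set of the same cardinality
  n!.\<close>

lemma sum_permutations_of_set_lessThan:
  "(\<Sum>js\<in>permutations_of_set {..<n}. F js) = (\<Sum>p | p permutes {..<n}. F (map p [0..<n]))"
proof (rule sum.reindex_bij_betw[symmetric])
  have inj: "inj_on (\<lambda>p. map p [0..<n]) {p. p permutes {..<n}}"
  proof (rule inj_onI)
    fix p q :: "nat \<Rightarrow> nat"
    assume pq: "p \<in> {p. p permutes {..<n}}" "q \<in> {p. p permutes {..<n}}"
      "map p [0..<n] = map q [0..<n]"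
    show "p = q"
    proof
      fix i show "p i = q i"
        using pq permutes_not_in[of p "{..<n}" i] permutes_not_in[of q "{..<n}" i]
        by (cases "i < n") auto
    qed
  qed
  have sub: "(\<lambda>p. map p [0..<n]) ` {p. p permutes {..<n}} \<subseteq> permutations_of_set {..<n}"
    by (auto simp: permutations_of_set_def distinct_map permutes_inj_on atLeast0LessThan
        dest: permutes_image)
  have "card ((\<lambda>p. map p [0..<n]) ` {p. p permutes {..<n}}) = card (permutations_of_set {..<n})"
    using card_permutations[of "{..<n}" n] by (simp add: card_image[OF inj])
  with card_subset_eq[OF _ sub] inj
  show "bij_betw (\<lambda>p. map p [0..<n]) {p. p permutes {..<n}} (permutations_of_set {..<n})"
    by (simp add: bij_betw_def)
qed

lemma Rep_tens_sum: "Rep_tens (\<Sum>i\<in>I. t i) \<xi>s = (\<Sum>i\<in>I. Rep_tens (t i) \<xi>s)"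
  by (induction I rule: infinite_finite_induct) (simp_all add: zero_tens.rep_eq plus_tens.rep_eq)

section \<open>Existence and uniqueness of symmetrization\<close>

definition symmetric_product :: "('g::real_vector \<times> 'g) list \<Rightarrow> 'g tens" where
  "symmetric_product zs = tens_const (1 / fact (length zs)) *
     (\<Sum>p | p permutes {..<length zs}. prod_list (map tens_lin (permute_list p zs)))"

text \<open>The orders in which n derivatives remove n factors are exactly the permutations in the
  symmetric tensor. The left side depends on the polynomial only, not on its factorization.\<close>

lemma sym_coeff_prod_list:
  "sym_coeff \<xi>s (prod_list (map sym_lin zs)) / fact (length \<xi>s) =
    Rep_tens (symmetric_product zs) \<xi>s"
proof -
  have "prod_list (map sym_lin zs) = (\<Prod>j<length zs. sym_lin (zs ! j))"
    by (simp add: prod.list_conv_set_nth atLeast0LessThan)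
  moreover have "(\<Prod>i<length zs. ev_cx (\<xi>s ! i) (permute_list p zs ! i))
      = (\<Prod>i<length zs. ev_cx (\<xi>s ! i) (zs ! (map p [0..<length zs] ! i)))"
    if "p permutes {..<length zs}" for p
    using that by (intro prod.cong refl) (simp add: permute_list_nth)
  ultimately show ?thesis
    by (auto simp: sym_coeff_prod_lin sum_permutations_of_set_lessThan symmetric_product_def
        Rep_tens_const_mult Rep_tens_sum Rep_tens_prod_lin intro!: sum.cong)
qed

text \<open>On a power the function is a symmetric tensor, and a general polynomial is a combination
  of powers.\<close>

lemma tens_fun_sym_coeff: "(\<lambda>\<xi>s. sym_coeff \<xi>s f / fact (length \<xi>s)) \<in> tens_fun"
proof (induction f rule: sym_power_induct)
  case (power X n)
  have "(\<lambda>\<xi>s. sym_coeff \<xi>s (prod_list (map sym_lin (replicate n (X, 0)))) / fact (length \<xi>s)) \<in> tens_fun"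
    unfolding sym_coeff_prod_list using Rep_tens by blast
  then show ?case by simp
next
  case (add f g)
  then show ?case by (simp add: sym_coeff_add add_divide_distrib tens_fun_add)
next
  case (scale c f)
  then show ?case
    using tens_fun_mult[OF tens_fun_const[of c] scale] by (simp add: conc_mult_const_left sym_coeff_scale)
qed

lemma permute_list_replicate: "p permutes {..<n} \<Longrightarrow> permute_list p (replicate n x) = replicate n x"
proof (rule nth_equalityI)
  fix i assume "p permutes {..<n}" "i < length (permute_list p (replicate n x))"
  then show "permute_list p (replicate n x) ! i = replicate n x ! i"
    using permutes_in_image[of p "{..<n}" i] by (simp add: permute_list_nth)
qed simp

lemma symmetric_product_replicate: "symmetric_product (replicate n z) = tens_lin z ^ n"
proof -
  have "(\<Sum>p | p permutes {..<n}. prod_list (map tens_lin (permute_list p (replicate n z)))) =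
      (\<Sum>p | p permutes {..<n}. tens_lin z ^ n)"
    by (intro sum.cong refl) (simp add: permute_list_replicate)
  also have "\<dots> = of_nat (fact n) * tens_lin z ^ n"
    using card_permutations[of "{..<n}" n] by simp
  also have "(of_nat (fact n) :: 'a tens) = tens_const (of_nat (fact n))"
  proof -
    have "tens_const (of_nat m) = (of_nat m :: 'a tens)" for m
      by (induction m) (simp_all add: tens_const_add)
    then show ?thesis by metis
  qed
  finally show ?thesis
    by (simp add: symmetric_product_def mult.assoc[symmetric] flip: tens_const_mult)
qed

definition symmetrizes :: "('g::real_vector sym \<Rightarrow> 'g tens) \<Rightarrow> bool" where
  "symmetrizes s \<longleftrightarrow> (\<forall>f g. s (f + g) = s f + s g) \<and>
     (\<forall>c f. s (sym_const c * f) = tens_const c * s f) \<and>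
     (\<forall>zs. s (prod_list (map sym_lin zs)) = symmetric_product zs)"

lemma symmetrizesD:
  assumes "symmetrizes s"
  shows "s (f + g) = s f + s g" "s (sym_const c * f) = tens_const c * s f"
    "s (sym_lin z ^ n) = tens_lin z ^ n"
proof -
  show "s (f + g) = s f + s g" "s (sym_const c * f) = tens_const c * s f"
    using assms by (simp_all add: symmetrizes_def)
  have "s (prod_list (map sym_lin (replicate n z))) = symmetric_product (replicate n z)"
    using assms unfolding symmetrizes_def by blast
  then show "s (sym_lin z ^ n) = tens_lin z ^ n"
    by (simp add: symmetric_product_replicate)
qed

lemma symmetrizes_unique:
  assumes "symmetrizes s" "symmetrizes t"
  shows "s = t"
proof
  fix f show "s f = t f"
    by (induction f rule: sym_power_induct)
      (simp_all add: symmetrizesD[OF assms(1)] symmetrizesD[OF assms(2)])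
qed

text \<open>Consistency of the description is the point, because one polynomial has many
  factorizations into linear elements. The formula by derivatives refers to no factorization and so
  provides existence.\<close>

lemma symmetrizes_sym_tens: "symmetrizes sym_tens"
proof -
  define s where "s f = Abs_tens (\<lambda>\<xi>s. sym_coeff \<xi>s f / fact (length \<xi>s))" for f :: "'a sym"
  have Rep: "Rep_tens (s f) = (\<lambda>\<xi>s. sym_coeff \<xi>s f / fact (length \<xi>s))" for f
    by (simp add: s_def Abs_tens_inverse tens_fun_sym_coeff)
  have "symmetrizes s"
    unfolding symmetrizes_def
    by (intro conjI allI Rep_tens_inject[THEN iffD1])
      (simp_all add: Rep plus_tens.rep_eq Rep_tens_const_mult fun_eq_iff
        sym_coeff_add add_divide_distrib sym_coeff_scale sym_coeff_prod_list)
  then have "symmetrizes (THE s :: 'a sym \<Rightarrow> 'a tens. symmetrizes s)"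
    by (rule theI[where P = symmetrizes]) (rule symmetrizes_unique[OF _ \<open>symmetrizes s\<close>])
  then show ?thesis
    unfolding sym_tens_def symmetrizes_def symmetric_product_def .
qed

lemmas sym_tens_add = symmetrizesD(1)[OF symmetrizes_sym_tens]
  and sym_tens_scale = symmetrizesD(2)[OF symmetrizes_sym_tens]
  and sym_tens_power = symmetrizesD(3)[OF symmetrizes_sym_tens]

section \<open>Differential operators with polynomial symbols\<close>

definition sym_of_series :: "complex fps \<Rightarrow> 'g::real_vector sym fps" where
  "sym_of_series c = Abs_fps (\<lambda>n. sym_const (c $ n))"

lemma sym_const_sum: "sym_const (\<Sum>i\<in>I. f i) = (\<Sum>i\<in>I. sym_const (f i))"
  by (induction I rule: infinite_finite_induct) (simp_all add: sym_const_add)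

lemma sym_of_series_add: "sym_of_series (a + b) = sym_of_series a + sym_of_series b"
  by (rule fps_ext) (simp add: sym_of_series_def sym_const_add)

lemma sym_of_series_mult: "sym_of_series (a * b) = sym_of_series a * sym_of_series b"
  by (rule fps_ext) (simp add: sym_of_series_def fps_mult_nth sym_const_sum sym_const_mult)

lemma sym_of_series_const: "sym_of_series (fps_const c) = fps_const (sym_const c)"
  by (rule fps_ext) (simp add: sym_of_series_def)

lemma sym_of_series_X: "sym_of_series fps_X = fps_X"
  by (rule fps_ext) (simp add: sym_of_series_def fps_X_def)

definition exp_series :: "'g::real_vector \<Rightarrow> 'g sym fps" where
  "exp_series X = Abs_fps (\<lambda>n. sym_const (1 / fact n) * sym_lin (X, 0) ^ n)"

text \<open>A differential operator with symbol \<open>p\<close> multiplies \<open>exp (t X)\<close> with \<open>p (t X)\<close>. The series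
  below is in the variable \<open>t\<close>, not in \<open>\<nu>\<close>.\<close>

definition acts_by_symbol ::
    "('g::real_vector \<Rightarrow> complex) \<Rightarrow> ('g sym \<Rightarrow> 'g sym) \<Rightarrow> 'g \<Rightarrow> complex poly \<Rightarrow> bool" where
  "acts_by_symbol p P X q \<longleftrightarrow> (\<forall>t::real. p (t *\<^sub>R X) = poly q (of_real t)) \<and>
     Abs_fps (\<lambda>n. P (exp_series X $ n)) = sym_of_series (fps_of_poly q) * exp_series X"

lemma diff_op_symbol_add: "diff_op_symbol p P \<Longrightarrow> P (f + g) = P f + P g"
  by (induction arbitrary: f g rule: diff_op_symbol.induct)
    (simp_all add: distrib_left sym_deriv_add)

lemma diff_op_symbol_scale: "diff_op_symbol p P \<Longrightarrow> P (sym_const c * f) = sym_const c * P f"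
  by (induction arbitrary: f rule: diff_op_symbol.induct)
    (simp_all add: mult.left_commute sym_deriv_scale distrib_left)

lemma diff_op_symbol_0: "diff_op_symbol p P \<Longrightarrow> P 0 = 0"
  using diff_op_symbol_scale[of p P 0 0] by simp

lemma diff_op_symbol_sum: "diff_op_symbol p P \<Longrightarrow> P (\<Sum>i\<in>I. f i) = (\<Sum>i\<in>I. P (f i))"
  by (induction I rule: infinite_finite_induct) (simp_all add: diff_op_symbol_0 diff_op_symbol_add)

text \<open>This is the formal identity that differentiation of exp(t X) in direction \<eta>
  multiplies it by t \<eta>(X), read coefficient by coefficient in t.\<close>

lemma sym_deriv_exp_series:
  "Abs_fps (\<lambda>n. sym_deriv \<eta> (exp_series X $ n)) = fps_X * fps_const (sym_const (ev \<eta> X)) * exp_series X"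
proof (rule fps_ext)
  fix n
  have "ev \<eta> 0 = 0" by (rule linear_0[OF linear_ev])
  then have D: "sym_deriv \<eta> (sym_lin (X, 0) ^ n) =
      sym_const (of_nat n * ev \<eta> X) * sym_lin (X, 0) ^ (n - 1)"
    by (simp add: sym_deriv_power_lin ev_cx_def)
  show "Abs_fps (\<lambda>n. sym_deriv \<eta> (exp_series X $ n)) $ n =
      (fps_X * fps_const (sym_const (ev \<eta> X)) * exp_series X) $ n"
  proof (cases n)
    case (Suc m)
    have "1 / fact (Suc m) * (of_nat (Suc m) * ev \<eta> X) = ev \<eta> X * (1 / fact m)"
      by (simp add: divide_simps del: of_nat_Suc)
    then show ?thesis
      unfolding Suc
      by (simp add: exp_series_def sym_deriv_scale D[unfolded Suc] mult.assoc[of fps_X]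
          mult.assoc[symmetric, of "sym_const _"] del: of_nat_Suc fact_Suc power_Suc flip: sym_const_mult)
  qed (use D in \<open>simp add: exp_series_def sym_deriv_scale\<close>)
qed

text \<open>Composition of operators corresponds to multiplication of symbols, because the factor
  produced by the inner operator has scalar coefficients, through which the outer one
  passes.\<close>

lemma diff_op_symbol_acts:
  "diff_op_symbol p P \<Longrightarrow> \<exists>q. acts_by_symbol p P X q"
proof (induction rule: diff_op_symbol.induct)
  case (1 c)
  have "acts_by_symbol (\<lambda>_. c) (\<lambda>f. sym_const c * f) X [:c:]"
    by (auto simp: acts_by_symbol_def fps_of_poly_const sym_of_series_const intro!: fps_ext)
  then show ?case ..
next
  case (2 \<eta>)
  have "fps_of_poly [:0, ev \<eta> X:] = fps_X * fps_const (ev \<eta> X)"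
    by (simp add: fps_of_poly_pCons fps_of_poly_const mult.commute)
  then have "sym_of_series (fps_of_poly [:0, ev \<eta> X:]) =
      (fps_X * fps_const (sym_const (ev \<eta> X)) :: 'a sym fps)"
    by (simp only: sym_of_series_mult sym_of_series_const sym_of_series_X)
  then have "acts_by_symbol (ev \<eta>) (sym_deriv \<eta>) X [:0, ev \<eta> X:]"
    by (simp add: acts_by_symbol_def sym_deriv_exp_series linear_scale[OF linear_ev] scaleR_conv_of_real)
  then show ?case ..
next
  case (3 p P q Q)
  then obtain r s where rs: "acts_by_symbol p P X r" "acts_by_symbol q Q X s" by blast
  have "Abs_fps (\<lambda>n. P (exp_series X $ n) + Q (exp_series X $ n)) =
      Abs_fps (\<lambda>n. P (exp_series X $ n)) + Abs_fps (\<lambda>n. Q (exp_series X $ n))"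
    by (rule fps_ext) simp
  with rs have "acts_by_symbol (\<lambda>x. p x + q x) (\<lambda>f. P f + Q f) X (r + s)"
    by (simp add: acts_by_symbol_def fps_of_poly_add sym_of_series_add distrib_right)
  then show ?case ..
next
  case (4 p P q Q)
  then obtain r s where rs: "acts_by_symbol p P X r" "acts_by_symbol q Q X s" by blast
  have "Abs_fps (\<lambda>n. P (Q (exp_series X $ n))) =
      sym_of_series (fps_of_poly s) * Abs_fps (\<lambda>n. P (exp_series X $ n))"
  proof (rule fps_ext)
    fix n
    have "Q (exp_series X $ n) = (sym_of_series (fps_of_poly s) * exp_series X) $ n"
      using rs(2) unfolding acts_by_symbol_def by (metis fps_nth_Abs_fps)
    then show "Abs_fps (\<lambda>n. P (Q (exp_series X $ n))) $ n =
        (sym_of_series (fps_of_poly s) * Abs_fps (\<lambda>n. P (exp_series X $ n))) $ n"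
      using 4 by (simp add: fps_mult_nth diff_op_symbol_sum[OF 4(1)] sym_of_series_def
          diff_op_symbol_scale[OF 4(1)])
  qed
  with rs have "acts_by_symbol (\<lambda>x. p x * q x) (\<lambda>f. P (Q f)) X (r * s)"
    by (simp add: acts_by_symbol_def fps_of_poly_mult sym_of_series_mult mult_ac)
  then show ?case ..
qed

lemma poly_eqI_real:
  fixes p q :: "complex poly"
  assumes "\<And>t::real. poly p (of_real t) = poly q (of_real t)"
  shows "p = q"
proof (rule ccontr)
  assume "p \<noteq> q"
  then have "finite {x. poly (p - q) x = 0}" by (intro poly_roots_finite) simp
  moreover have "range complex_of_real \<subseteq> {x. poly (p - q) x = 0}" using assms by auto
  ultimately have "finite (range complex_of_real)" by (rule finite_subset[rotated])
  then have "finite (UNIV :: real set)" by (rule finite_imageD) (simp add: inj_of_real)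
  then show False by (simp add: infinite_UNIV_char_0)
qed

lemma acts_by_symbol_power:
  assumes "diff_op_symbol p P" "acts_by_symbol p P X q"
  shows "P (sym_lin (X, 0) ^ n) =
    sym_const (fact n) * (sym_of_series (fps_of_poly q) * exp_series X) $ n"
proof -
  have "sym_lin (X, 0) ^ n = sym_const (fact n) * exp_series X $ n"
    by (simp add: exp_series_def mult.assoc[symmetric] flip: sym_const_mult)
  moreover have "P (exp_series X $ n) = (sym_of_series (fps_of_poly q) * exp_series X) $ n"
    using assms(2) unfolding acts_by_symbol_def by (metis fps_nth_Abs_fps)
  ultimately show ?thesis by (simp add: diff_op_symbol_scale[OF assms(1)])
qed

text \<open>The polynomial t -> p(t X) is determined by the symbol and fixes the value on every X^n,
  and these powers span. Hence the description in \<open>diff_op\<close> is meaningful.\<close>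

lemma diff_op_symbol_unique:
  assumes "diff_op_symbol p P" "diff_op_symbol p Q"
  shows "P = Q"
proof
  fix f show "P f = Q f"
  proof (induction f rule: sym_power_induct)
    case (power X n)
    obtain r s where rs: "acts_by_symbol p P X r" "acts_by_symbol p Q X s"
      using assms[THEN diff_op_symbol_acts] by blast
    then have "r = s" by (intro poly_eqI_real) (auto simp: acts_by_symbol_def)
    with rs show ?case
      by (simp only: acts_by_symbol_power[OF assms(1) rs(1)] acts_by_symbol_power[OF assms(2) rs(2)])
  qed (simp_all add: diff_op_symbol_add[OF assms(1)] diff_op_symbol_add[OF assms(2)]
      diff_op_symbol_scale[OF assms(1)] diff_op_symbol_scale[OF assms(2)])
qed

lemma diff_op_eq: "diff_op_symbol p P \<Longrightarrow> diff_op p = P"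
  unfolding diff_op_def by (blast intro: diff_op_symbol_unique)

text \<open>Along the ray through X the symbol is p(X) t^k, so the coefficient of t^n in p(t X)
  exp(t X) is p(X) X^(n-k) / (n-k)!; the factor n! turns X^n / n! into X^n.\<close>

lemma diff_op_symbol_homogeneous:
  assumes P: "diff_op_symbol p P" and hom: "\<And>t. p (t *\<^sub>R X) = of_real t ^ k * p X"
  shows "P (sym_lin (X, 0) ^ n) =
    (if k \<le> n then sym_const (p X * fact n / fact (n - k)) * sym_lin (X, 0) ^ (n - k) else 0)"
proof -
  obtain q where q: "acts_by_symbol p P X q" using diff_op_symbol_acts[OF P] by blast
  have "q = monom (p X) k"
    by (rule poly_eqI_real) (use q hom in \<open>simp add: acts_by_symbol_def poly_monom mult.commute\<close>)
  then have "sym_of_series (fps_of_poly q) = (fps_const (sym_const (p X)) * fps_X ^ k :: 'a sym fps)"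
    by (intro fps_ext) (simp add: sym_of_series_def fps_X_power_nth)
  then have "(sym_of_series (fps_of_poly q) * exp_series X) $ n =
      (if k \<le> n then sym_const (p X) * (sym_const (1 / fact (n - k)) * sym_lin (X, 0) ^ (n - k)) else 0)"
    by (simp add: mult.assoc fps_X_power_mult_nth exp_series_def)
  then show ?thesis
    by (simp add: acts_by_symbol_power[OF P q] mult.assoc[symmetric] mult.commute[of "p X"]
        flip: sym_const_mult)
qed

section \<open>The coefficients of the Duflo symbol\<close>

text \<open>\<open>diff_op\<close> has content only for symbols built from constants and linear
  forms. For the coefficients of J^(1/2) this requires proof, since the root is taken separately for
  each x.\<close>

definition polynomial_symbol :: "('g::real_vector \<Rightarrow> real) \<Rightarrow> bool" where
  "polynomial_symbol p \<longleftrightarrow> (\<exists>P. diff_op_symbol (\<lambda>x. complex_of_real (p x)) P)"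

lemma polynomial_symbol_const: "polynomial_symbol (\<lambda>_. c)"
  unfolding polynomial_symbol_def using diff_op_symbol.intros(1) by blast

lemma polynomial_symbol_linear:
  assumes "linear l"
  shows "polynomial_symbol l"
proof -
  have "linear (\<lambda>x. complex_of_real (l x))"
    using assms by (simp add: linear_iff scaleR_conv_of_real)
  then have "ev (Abs_cdual (\<lambda>x. complex_of_real (l x))) = (\<lambda>x. complex_of_real (l x))"
    by (simp add: Abs_cdual_inverse)
  then show ?thesis unfolding polynomial_symbol_def by (metis diff_op_symbol.intros(2))
qed

lemma polynomial_symbol_add:
  "polynomial_symbol p \<Longrightarrow> polynomial_symbol q \<Longrightarrow> polynomial_symbol (\<lambda>x. p x + q x)"
  unfolding polynomial_symbol_def of_real_add using diff_op_symbol.intros(3) by blast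

lemma polynomial_symbol_mult:
  "polynomial_symbol p \<Longrightarrow> polynomial_symbol q \<Longrightarrow> polynomial_symbol (\<lambda>x. p x * q x)"
  unfolding polynomial_symbol_def of_real_mult using diff_op_symbol.intros(4) by blast

lemma polynomial_symbol_sum:
  "(\<And>i. i \<in> I \<Longrightarrow> polynomial_symbol (p i)) \<Longrightarrow> polynomial_symbol (\<lambda>x. \<Sum>i\<in>I. p i x)"
  by (induction I rule: infinite_finite_induct)
    (auto intro: polynomial_symbol_const polynomial_symbol_add)

lemma polynomial_symbol_diff:
  "polynomial_symbol p \<Longrightarrow> polynomial_symbol q \<Longrightarrow> polynomial_symbol (\<lambda>x. p x - q x)"
  using polynomial_symbol_add[OF _ polynomial_symbol_mult[OF polynomial_symbol_const, of q "- 1"], of p]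
  by simp

lemma polynomial_symbol_divide: "polynomial_symbol p \<Longrightarrow> polynomial_symbol (\<lambda>x. p x / c)"
  using polynomial_symbol_mult[OF polynomial_symbol_const, of p "inverse c"]
  by (simp add: divide_inverse mult.commute)

abbreviation polynomial_series :: "('g::real_vector \<Rightarrow> real fps) \<Rightarrow> bool" where
  "polynomial_series F \<equiv> (\<forall>n. polynomial_symbol (\<lambda>x. F x $ n))"

lemma polynomial_series_mult:
  "polynomial_series F \<Longrightarrow> polynomial_series G \<Longrightarrow> polynomial_series (\<lambda>x. F x * G x)"
  unfolding fps_mult_nth by (intro allI polynomial_symbol_sum polynomial_symbol_mult) auto

lemma polynomial_series_const: "polynomial_series (\<lambda>_. F)"
  by (blast intro: polynomial_symbol_const)

lemma polynomial_series_prod: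
  "(\<And>i. i \<in> I \<Longrightarrow> polynomial_series (F i)) \<Longrightarrow> polynomial_series (\<lambda>x. \<Prod>i\<in>I. F i x)"
proof (induction I rule: infinite_finite_induct)
  case (insert i I)
  then show ?case using polynomial_series_mult[of "F i" "\<lambda>x. \<Prod>i\<in>I. F i x"] by simp
qed (auto intro: polynomial_symbol_const)

lemma polynomial_series_sum:
  "(\<And>i. i \<in> I \<Longrightarrow> polynomial_series (F i)) \<Longrightarrow> polynomial_series (\<lambda>x. \<Sum>i\<in>I. F i x)"
  unfolding fps_sum_nth by (intro allI polynomial_symbol_sum) auto

text \<open>In order n of s^2 the coefficient s_n occurs only in the two extreme terms. The
  resulting recursion makes the coefficients of the root polynomial in those of J.\<close>

lemma sqrt_series_nth:
  fixes s :: "real fps"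
  assumes "s $ 0 = 1" "s ^ 2 = J" "n > 0"
  shows "s $ n = (J $ n - (\<Sum>i\<in>{0<..<n}. s $ i * s $ (n - i))) / 2"
proof -
  have "{0..n} = insert 0 (insert n {0<..<n})" using assms(3) by auto
  then have "J $ n = 2 * s $ n + (\<Sum>i\<in>{0<..<n}. s $ i * s $ (n - i))"
    using assms by (auto simp: power2_eq_square fps_mult_nth)
  then show ?thesis by simp
qed

lemma polynomial_series_sqrt:
  assumes "polynomial_series J" "\<And>x. s x $ 0 = 1" "\<And>x. s x ^ 2 = J x"
  shows "polynomial_series s"
proof
  fix n
  show "polynomial_symbol (\<lambda>x. s x $ n)"
  proof (induction n rule: less_induct)
    case (less n)
    show ?case
    proof (cases "n = 0")
      case True
      then show ?thesis by (simp add: assms(2) polynomial_symbol_const)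
    next
      case False
      then have "(\<lambda>x. s x $ n) = (\<lambda>x. (J x $ n - (\<Sum>i\<in>{0<..<n}. s x $ i * s x $ (n - i))) / 2)"
        using sqrt_series_nth[OF assms(2,3)] by auto
      then show ?thesis
        using assms(1) less
        by (auto intro!: polynomial_symbol_divide polynomial_symbol_diff polynomial_symbol_sum
            polynomial_symbol_mult)
    qed
  qed
qed

text \<open>Real power series form an integral domain, and s + t has constant term 2. Comparing
  squares is how homogeneity and evenness pass from J to its root.\<close>

lemma sqrt_series_unique:
  fixes s t :: "real fps"
  assumes "s ^ 2 = t ^ 2" "s $ 0 = 1" "t $ 0 = 1"
  shows "s = t"
proof -
  have "(s + t) $ 0 \<noteq> 0" using assms by simp
  then have "s + t \<noteq> 0" by (metis fps_zero_nth)
  moreover have "(s - t) * (s + t) = 0" using assms(1) by (simp add: power2_eq_square algebra_simps)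
  ultimately show ?thesis by simp
qed

lemma fps_nth_0_prod: "(\<Prod>i\<in>I. F i) $ 0 = (\<Prod>i\<in>I. F i $ 0)"
  for F :: "'a \<Rightarrow> real fps"
  by (induction I rule: infinite_finite_induct) simp_all

text \<open>This is the substitution of t \<nu> for \<nu>. Equating it with scaling of x by t states
  the homogeneity of all coefficients at once.\<close>

definition series_dilate :: "real \<Rightarrow> real fps \<Rightarrow> real fps" where
  "series_dilate t F = Abs_fps (\<lambda>n. t ^ n * F $ n)"

lemma series_dilate_mult: "series_dilate t (F * G) = series_dilate t F * series_dilate t G"
proof (rule fps_ext)
  fix n
  have "t ^ n * (F $ i * G $ (n - i)) = t ^ i * F $ i * (t ^ (n - i) * G $ (n - i))" if "i \<le> n" for i
    using that power_add[of t i "n - i"] by simp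
  then show "series_dilate t (F * G) $ n = (series_dilate t F * series_dilate t G) $ n"
    unfolding series_dilate_def fps_mult_nth fps_nth_Abs_fps sum_distrib_left
    by (intro sum.cong refl) simp
qed

lemma series_dilate_add: "series_dilate t (F + G) = series_dilate t F + series_dilate t G"
  by (rule fps_ext) (simp add: series_dilate_def distrib_left)

lemma series_dilate_const [simp]: "series_dilate t (fps_const c) = fps_const c"
  by (rule fps_ext) (simp add: series_dilate_def)

lemma series_dilate_of_int [simp]: "series_dilate t (of_int c) = of_int c"
  by (simp flip: fps_of_int)

lemma series_dilate_prod: "series_dilate t (\<Prod>i\<in>I. F i) = (\<Prod>i\<in>I. series_dilate t (F i))"
  using series_dilate_const[of t 1]
  by (induction I rule: infinite_finite_induct) (simp_all add: series_dilate_mult)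

lemma series_dilate_sum: "series_dilate t (\<Sum>i\<in>I. F i) = (\<Sum>i\<in>I. series_dilate t (F i))"
  using series_dilate_const[of t 0]
  by (induction I rule: infinite_finite_induct) (simp_all add: series_dilate_add)

section \<open>The determinant J and its square root\<close>

locale finite_lie_algebra =
  fixes br :: "'g::real_vector \<Rightarrow> 'g \<Rightarrow> 'g"
  assumes lie: "lie_algebra br" and fin: "finite_dimensional TYPE('g)"
begin

abbreviation basis :: "'g set" where
  "basis \<equiv> extend_basis {}"

lemma bilinear_br: "bilinear br"
  using lie by (simp add: lie_algebra_def)

lemma independent_basis: "independent basis"
  by (rule real_vector.independent_extend_basis) (simp add: dependent_def)

lemma span_basis: "span basis = UNIV"
  by (rule real_vector.span_extend_basis) (simp add: dependent_def)

lemma finite_basis: "finite basis"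
proof -
  obtain B :: "'g set" where "finite B" "span B = UNIV" using fin by (auto simp: finite_dimensional_def)
  then show ?thesis using real_vector.independent_span_bound[OF _ independent_basis] by blast
qed

abbreviation coord :: "'g \<Rightarrow> 'g \<Rightarrow> real" where
  "coord b x \<equiv> representation basis x b"

lemma linear_coord: "linear (coord b)"
  by (intro linearI) (simp_all add: real_vector.representation_add[OF independent_basis]
      real_vector.representation_scale[OF independent_basis] span_basis)

lemma coord_basis: "b \<in> basis \<Longrightarrow> coord i b = (if b = i then 1 else 0)"
  using real_vector.representation_basis[OF independent_basis, of b] by auto

lemma coord_sum: "(\<Sum>b\<in>basis. coord b x *\<^sub>R b) = x"
  using real_vector.sum_representation_eq[OF independent_basis, of x basis] finite_basis
  by (simp add: span_basis)

text \<open>An entry of (ad x)^(n+1) is a sum of products of an entry of (ad x)^n with a coordinate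
  of [x, b], and the latter is linear in x.\<close>

lemma polynomial_symbol_iterate: "polynomial_symbol (\<lambda>x. coord i ((br x ^^ n) j))"
proof (induction n arbitrary: i)
  case 0
  show ?case by (simp add: polynomial_symbol_const)
next
  case (Suc n)
  have "coord i ((br x ^^ Suc n) j) = (\<Sum>b\<in>basis. coord b ((br x ^^ n) j) * coord i (br x b))" for x
  proof -
    have l: "linear (\<lambda>v. coord i (br x v))"
      using linear_compose[OF _ linear_coord] bilinear_br by (auto simp: bilinear_def o_def)
    have "coord i (br x ((br x ^^ n) j)) =
        coord i (br x (\<Sum>b\<in>basis. coord b ((br x ^^ n) j) *\<^sub>R b))"
      by (simp add: coord_sum)
    then show ?thesis by (simp add: linear_sum[OF l] linear_scale[OF l])
  qed
  moreover have "linear (\<lambda>x. coord i (br x b))" for b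
    using linear_compose[OF _ linear_coord] bilinear_br by (auto simp: bilinear_def o_def)
  ultimately show ?case
    by (simp only:) (intro polynomial_symbol_sum polynomial_symbol_mult Suc polynomial_symbol_linear)
qed

lemma polynomial_series_duflo_J: "polynomial_series (duflo_J br)"
proof -
  have "polynomial_series (\<lambda>x. duflo_matrix br x i j)" for i j
  proof
    fix n show "polynomial_symbol (\<lambda>x. duflo_matrix br x i j $ n)"
      by (cases "even n")
        (simp_all add: duflo_matrix_def polynomial_symbol_divide polynomial_symbol_iterate
          polynomial_symbol_const)
  qed
  then show ?thesis
    unfolding duflo_J_def
    by (intro polynomial_series_sum polynomial_series_mult polynomial_series_const polynomial_series_prod)
      blast
qed

lemma iterate_br_scaleR: "(br (t *\<^sub>R x) ^^ n) j = t ^ n *\<^sub>R (br x ^^ n) j"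
  by (induction n) (simp_all add: bilinear_lmul[OF bilinear_br] bilinear_rmul[OF bilinear_br])

lemma duflo_J_scaleR: "duflo_J br (t *\<^sub>R x) = series_dilate t (duflo_J br x)"
proof -
  have "duflo_matrix br (t *\<^sub>R x) i j = series_dilate t (duflo_matrix br x i j)" for i j
    by (rule fps_ext) (simp add: duflo_matrix_def series_dilate_def iterate_br_scaleR
        linear_scale[OF linear_coord])
  then show ?thesis
    by (simp add: duflo_J_def series_dilate_sum series_dilate_mult series_dilate_prod)
qed

text \<open>Only even powers of ad x enter \<open>duflo_matrix\<close>, and these do not see the
  sign.\<close>

lemma duflo_J_uminus: "duflo_J br (- x) = duflo_J br x"
proof -
  have "duflo_matrix br ((- 1) *\<^sub>R x) i j = duflo_matrix br x i j" for i j
    unfolding duflo_matrix_def iterate_br_scaleR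
    by (rule fps_ext) (simp add: linear_scale[OF linear_coord])
  then show ?thesis by (simp add: duflo_J_def)
qed

text \<open>At order \<open>0\<close> the matrix is the identity, so only the identity permutation
  contributes to the determinant.\<close>

lemma duflo_J_nth_0: "duflo_J br x $ 0 = 1"
proof -
  have "(\<Prod>i\<in>basis. duflo_matrix br x i (p i)) $ 0 = (if p = id then 1 else 0)"
    if p: "p permutes basis" for p
  proof -
    have "(\<Prod>i\<in>basis. duflo_matrix br x i (p i)) $ 0 = (\<Prod>i\<in>basis. if p i = i then 1 else 0)"
      unfolding fps_nth_0_prod
      by (intro prod.cong refl) (auto simp: duflo_matrix_def coord_basis permutes_in_image[OF p])
    also have "\<dots> = (if p = id then 1 else 0)"
    proof (cases "p = id")
      case False
      then obtain i where "p i \<noteq> i" by (auto simp: fun_eq_iff)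
      moreover from this p have "i \<in> basis" by (auto simp: permutes_def)
      ultimately show ?thesis using False finite_basis by (auto intro!: prod_zero)
    qed simp
    finally show ?thesis .
  qed
  then have "duflo_J br x $ 0 =
      (\<Sum>p | p permutes basis. if p = id then of_int (sign p) else 0)"
    unfolding duflo_J_def fps_sum_nth by (intro sum.cong refl) (simp add: id_def flip: fps_of_int)
  also have "\<dots> = 1"
    using finite_permutations[OF finite_basis] by (simp add: permutes_id)
  finally show ?thesis .
qed

lemma duflo_J_sqrt_nth_0: "duflo_J_sqrt br x $ 0 = 1"
  by (simp add: duflo_J_sqrt_def duflo_J_nth_0)

lemma duflo_J_sqrt_square: "duflo_J_sqrt br x ^ 2 = duflo_J br x"
  using power_radical[of "duflo_J br x" root 1] by (simp add: duflo_J_sqrt_def duflo_J_nth_0 numeral_2_eq_2)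

lemma polynomial_series_duflo_J_sqrt: "polynomial_series (duflo_J_sqrt br)"
  using polynomial_series_sqrt[OF polynomial_series_duflo_J duflo_J_sqrt_nth_0 duflo_J_sqrt_square] .

lemma duflo_J_sqrt_scaleR: "duflo_J_sqrt br (t *\<^sub>R x) = series_dilate t (duflo_J_sqrt br x)"
proof (rule sqrt_series_unique)
  have "series_dilate t (duflo_J_sqrt br x) ^ 2 = series_dilate t (duflo_J_sqrt br x ^ 2)"
    by (simp only: power2_eq_square series_dilate_mult)
  then show "duflo_J_sqrt br (t *\<^sub>R x) ^ 2 = series_dilate t (duflo_J_sqrt br x) ^ 2"
    by (simp only: duflo_J_sqrt_square duflo_J_scaleR)
qed (simp_all add: series_dilate_def duflo_J_sqrt_nth_0)

text \<open>The coefficient of order k is homogeneous of degree k, while the root, like J, is even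
  in x.\<close>

lemma duflo_J_sqrt_odd: "odd k \<Longrightarrow> duflo_J_sqrt br x $ k = 0"
proof -
  assume "odd k"
  have "duflo_J_sqrt br (- x) = duflo_J_sqrt br x"
    by (rule sqrt_series_unique)
      (simp_all add: duflo_J_sqrt_square duflo_J_sqrt_nth_0 duflo_J_uminus)
  then have "duflo_J_sqrt br x $ k = (- 1) ^ k * duflo_J_sqrt br x $ k"
    using duflo_J_sqrt_scaleR[of "- 1" x] by (simp add: series_dilate_def fps_eq_iff)
  then show ?thesis using \<open>odd k\<close> by simp
qed

definition duflo_diff :: "nat \<Rightarrow> 'g sym \<Rightarrow> 'g sym" where
  "duflo_diff k = diff_op (\<lambda>x. complex_of_real (duflo_J_sqrt br x $ k))"

lemma diff_op_symbol_duflo: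
  "diff_op_symbol (\<lambda>x. complex_of_real (duflo_J_sqrt br x $ k)) (duflo_diff k)"
  using polynomial_series_duflo_J_sqrt unfolding polynomial_symbol_def duflo_diff_def
  by (metis diff_op_eq)

lemmas duflo_diff_add = diff_op_symbol_add[OF diff_op_symbol_duflo]
  and duflo_diff_scale = diff_op_symbol_scale[OF diff_op_symbol_duflo]
  and duflo_diff_0 [simp] = diff_op_symbol_0[OF diff_op_symbol_duflo]

lemma duflo_diff_power:
  "duflo_diff k (sym_lin (X, 0) ^ n) = (if k \<le> n then
     sym_const (complex_of_real (duflo_J_sqrt br X $ k * fact n / fact (n - k))) * sym_lin (X, 0) ^ (n - k)
     else 0)"
  using diff_op_symbol_homogeneous[OF diff_op_symbol_duflo, of X k k n]
  by (simp add: duflo_J_sqrt_scaleR series_dilate_def)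

lemma duflo_diff_zero: "duflo_diff 0 f = f"
  by (induction f rule: sym_power_induct)
    (simp_all add: duflo_diff_power duflo_J_sqrt_nth_0 duflo_diff_add duflo_diff_scale)

lemma duflo_op_nth: "duflo_op br F $ n = (\<Sum>k\<le>n. duflo_diff k (F $ (n - k)))"
  by (simp add: duflo_op_def duflo_diff_def)

end

section \<open>Straightening of words\<close>

text \<open>The diamond-lemma proof of the Poincare-Birkhoff-Witt theorem. The numbers \<open>c i j l\<close> are the
  structure constants of a Lie algebra and \<open>g w\<close> is the value of the ordered word \<open>w\<close>.\<close>

fun inversions :: "nat list \<Rightarrow> nat" where
  "inversions [] = 0"
| "inversions (x # xs) = length (filter (\<lambda>y. y < x) xs) + inversions xs"

lemma inversions_swap: "x > y \<Longrightarrow> inversions (u @ x # y # v) = Suc (inversions (u @ y # x # v))"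
  by (induction u) auto

text \<open>Length is compared before inversions, because rewriting a descent yields the swapped
  word, of equal length with one inversion less, and shorter words whose inversions are not
  controlled.\<close>

definition word_less :: "(nat list \<times> nat list) set" where
  "word_less = inv_image (less_than <*lex*> less_than) (\<lambda>w. (length w, inversions w))"

lemma wf_word_less: "wf word_less"
  by (simp add: word_less_def wf_lex_prod)

lemma swap_word_less: "x > y \<Longrightarrow> (u @ y # x # v, u @ x # y # v) \<in> word_less"
  by (simp add: word_less_def inversions_swap)

lemma shorter_word_less: "length w < length w' \<Longrightarrow> (w, w') \<in> word_less"
  by (simp add: word_less_def)

lemma descent_exists: "\<not> sorted w \<Longrightarrow> \<exists>u x y v. w = u @ x # y # v \<and> x > (y::nat)"
proof (induction w)
  case (Cons a w)
  show ?case
  proof (cases "sorted w")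
    case True
    then obtain b v where "w = b # v" "a > b"
      using Cons.prems by (cases w) auto
    then have "a # w = [] @ a # b # v \<and> a > b" by simp
    then show ?thesis by blast
  next
    case False
    then obtain u x y v where "w = u @ x # y # v" "x > y" using Cons.IH by blast
    then have "a # w = (a # u) @ x # y # v \<and> x > y" by simp
    then show ?thesis by blast
  qed
qed simp

text \<open>Which descent is rewritten is left arbitrary; confluence shows later that the choice
  does not affect \<open>straighten\<close>.\<close>

definition descent :: "nat list \<Rightarrow> nat list \<times> nat \<times> nat \<times> nat list" where
  "descent w = (SOME (u, x, y, v). w = u @ x # y # v \<and> x > y)"

lemma descent:
  assumes "\<not> sorted w" "descent w = (u, x, y, v)"
  shows "w = u @ x # y # v" "x > y"
proof -
  have "\<exists>d. case d of (u, x, y, v) \<Rightarrow> w = u @ x # y # v \<and> x > y"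
    using descent_exists[OF assms(1)] by auto
  then have "case descent w of (u, x, y, v) \<Rightarrow> w = u @ x # y # v \<and> x > y"
    unfolding descent_def by (rule someI_ex)
  then show "w = u @ x # y # v" "x > y" by (simp_all add: assms(2))
qed

lemma descent_word_less:
  assumes "\<not> sorted w" "(u, x, y, v) = descent w"
  shows "(u @ y # x # v, w) \<in> word_less" "(u @ l # v, w) \<in> word_less"
  using descent[OF assms(1) assms(2)[symmetric]] swap_word_less[of y x u v]
  by (auto intro: shorter_word_less)

text \<open>The rule x y -> y x + [x, y] is applied until the word is sorted, where g gives the
  value. Values in a commutative ring are tracked instead of combinations of words.\<close>

function straighten ::
    "(nat \<Rightarrow> nat \<Rightarrow> nat \<Rightarrow> 'r) \<Rightarrow> nat \<Rightarrow> (nat list \<Rightarrow> 'r) \<Rightarrow> nat list \<Rightarrow> 'r::comm_ring_1" where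
  "straighten c d g w = (if sorted w then g w else
     (case descent w of (u, x, y, v) \<Rightarrow>
        straighten c d g (u @ y # x # v) + (\<Sum>l<d. c x y l * straighten c d g (u @ l # v))))"
  by pat_completeness auto
termination
proof (relation "inv_image word_less (\<lambda>(c, d, g, w). w)")
  show "wf (inv_image word_less (\<lambda>(c :: nat \<Rightarrow> nat \<Rightarrow> nat \<Rightarrow> 'r, d :: nat, g :: nat list \<Rightarrow> 'r, w). w))"
    by (simp add: wf_word_less)
qed (auto intro: descent_word_less)

declare straighten.simps [simp del]

section \<open>Confluence of the rewriting\<close>

locale structure_constants =
  fixes c :: "nat \<Rightarrow> nat \<Rightarrow> nat \<Rightarrow> 'r::comm_ring_1" and d :: nat and g :: "nat list \<Rightarrow> 'r"
  assumes skew: "c i j l = - c j i l" and diag: "c i i l = 0"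
    and jacobi: "(\<Sum>l<d. c x y l * c l z m) + (\<Sum>l<d. c y z l * c l x m) + (\<Sum>l<d. c z x l * c l y m) = 0"
begin

abbreviation N :: "nat list \<Rightarrow> 'r" where
  "N \<equiv> straighten c d g"

lemma N_sorted: "sorted w \<Longrightarrow> N w = g w"
  by (simp add: straighten.simps[of c d g w])

abbreviation reduct :: "nat list \<Rightarrow> nat \<Rightarrow> nat \<Rightarrow> nat list \<Rightarrow> 'r" where
  "reduct u x y v \<equiv> N (u @ y # x # v) + (\<Sum>l<d. c x y l * N (u @ l # v))"

text \<open>This is confluence at w: every descent, not only the chosen one, may be used for
  rewriting.\<close>

definition relation_at :: "nat list \<Rightarrow> bool" where
  "relation_at w \<longleftrightarrow> (\<forall>u x y v. w = u @ x # y # v \<longrightarrow> x > y \<longrightarrow> N w = reduct u x y v)"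

text \<open>Exchanging an ascending pair is the same relation for the swapped word, by skew
  symmetry; for equal letters the bracket term vanishes.\<close>

lemma relation_atD:
  assumes "relation_at (u @ x # y # v)" "relation_at (u @ y # x # v)"
  shows "N (u @ x # y # v) = reduct u x y v"
proof (cases x y rule: linorder_cases)
  case less
  then have "N (u @ y # x # v) = reduct u y x v" using assms(2) by (auto simp: relation_at_def)
  moreover have "(\<Sum>l<d. c y x l * N (u @ l # v)) = - (\<Sum>l<d. c x y l * N (u @ l # v))"
    by (simp add: skew[of y x] sum_negf)
  ultimately show ?thesis by simp
next
  case greater
  then show ?thesis using assms(1) by (auto simp: relation_at_def)
qed (simp add: diag)

text \<open>Rewriting either descent leaves only smaller words, in which the induction hypothesis
  allows the other descent to be rewritten. Both orders give the same four groups of terms.\<close>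

lemma disjoint_descents:
  assumes IH: "\<And>w. (w, u @ x # y # m @ x' # y' # v) \<in> word_less \<Longrightarrow> relation_at w"
    and xy: "x > y" "x' > y'"
  shows "reduct u x y (m @ x' # y' # v) = reduct (u @ x # y # m) x' y' v"
proof -
  have IH': "N (p @ a # b # q) = reduct p a b q"
    if "(p @ a # b # q, u @ x # y # m @ x' # y' # v) \<in> word_less" "a > b" for p a b q
    using IH[OF that(1)] that(2) by (auto simp: relation_at_def)
  have s1: "(u @ y # x # m @ x' # y' # v, u @ x # y # m @ x' # y' # v) \<in> word_less"
    using swap_word_less[OF xy(1)] .
  have s2: "(u @ x # y # m @ y' # x' # v, u @ x # y # m @ x' # y' # v) \<in> word_less"
    using swap_word_less[OF xy(2), of "u @ x # y # m" v] by simp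
  have a1: "N (u @ y # x # m @ x' # y' # v) = reduct (u @ y # x # m) x' y' v"
    using IH'[of "u @ y # x # m" x' y' v] s1 xy by simp
  have a2: "N (u @ l # m @ x' # y' # v) = reduct (u @ l # m) x' y' v" for l
    using IH'[of "u @ l # m" x' y' v] xy by (simp add: shorter_word_less)
  have b1: "N (u @ x # y # m @ y' # x' # v) = reduct u x y (m @ y' # x' # v)"
    using IH'[of u x y "m @ y' # x' # v"] s2 xy by simp
  have b2: "N (u @ x # y # m @ l # v) = reduct u x y (m @ l # v)" for l
    using IH'[of u x y "m @ l # v"] xy by (simp add: shorter_word_less)
  have "(\<Sum>l<d. c x y l * (\<Sum>k<d. c x' y' k * N (u @ l # m @ k # v))) =
      (\<Sum>k<d. c x' y' k * (\<Sum>l<d. c x y l * N (u @ l # m @ k # v)))"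
    unfolding sum_distrib_left by (subst sum.swap) (simp add: mult.left_commute)
  then show ?thesis
    by (simp add: a1 a2 b1 b2 distrib_left sum.distrib algebra_simps)
qed

text \<open>In the critical case x y z, both ways of rewriting end in z y x plus bracket
  corrections, and the two corrections agree by the Jacobi identity.\<close>

lemma overlapping_descents:
  assumes IH: "\<And>w. (w, u @ x # y # z # v) \<in> word_less \<Longrightarrow> relation_at w"
    and xy: "x > y" "y > z"
  shows "reduct u x y (z # v) = reduct (u @ [x]) y z v"
proof -
  let ?W = "u @ x # y # z # v"
  have IH': "N (p @ a # b # q) = reduct p a b q" if "(p @ a # b # q, ?W) \<in> word_less" "a > b" for p a b q
    using IH[OF that(1)] that(2) by (auto simp: relation_at_def)
  have short: "N (u @ a # b # v) = reduct u a b v" for a b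
    by (intro relation_atD IH shorter_word_less) simp_all
  have tr: "(p, r) \<in> word_less" if "(p, q) \<in> word_less" "(q, r) \<in> word_less" for p q r
    using that by (auto simp: word_less_def)
  have w1: "(u @ y # x # z # v, ?W) \<in> word_less" using swap_word_less[OF xy(1), of u "z # v"] by simp
  have w2: "(u @ x # z # y # v, ?W) \<in> word_less" using swap_word_less[OF xy(2), of "u @ [x]" v] by simp
  have w3: "(u @ y # z # x # v, ?W) \<in> word_less"
    using swap_word_less[of z x "u @ [y]" v] xy tr[OF _ w1] by simp
  have w4: "(u @ z # x # y # v, ?W) \<in> word_less"
    using swap_word_less[of z x u "y # v"] xy tr[OF _ w2] by simp
  \<comment> \<open>\<open>A i j p\<close> stands for [i, j] p and \<open>B p i j\<close> for p
    [i, j], between the outer words \<open>u\<close> and \<open>v\<close>.\<close>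
  define A where "A i j p = (\<Sum>l<d. c i j l * N (u @ l # p # v))" for i j p
  define B where "B p i j = (\<Sum>l<d. c i j l * N (u @ p # l # v))" for p i j
  have e1: "N (u @ y # x # z # v) = N (u @ y # z # x # v) + B y x z"
    using IH'[of "u @ [y]" x z v] w1 xy by (simp add: B_def)
  have e2: "N (u @ y # z # x # v) = N (u @ z # y # x # v) + A y z x"
    using IH'[of u y z "x # v"] w3 xy by (simp add: A_def)
  have e3: "N (u @ x # z # y # v) = N (u @ z # x # y # v) + A x z y"
    using IH'[of u x z "y # v"] w2 xy by (simp add: A_def)
  have e4: "N (u @ z # x # y # v) = N (u @ z # y # x # v) + B z x y"
    using IH'[of "u @ [z]" x y v] w4 xy by (simp add: B_def)
  \<comment> \<open>Words containing a bracket are shorter, so their letters may be exchanged in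
    either direction; the difference is the double bracket [[i, j], p].\<close>
  have comm: "A i j p - B p i j = (\<Sum>m<d. (\<Sum>l<d. c i j l * c l p m) * N (u @ m # v))" for i j p
  proof -
    have "N (u @ l # p # v) - N (u @ p # l # v) = (\<Sum>m<d. c l p m * N (u @ m # v))" for l
      using short[of l p] by simp
    then have "A i j p - B p i j = (\<Sum>l<d. c i j l * (\<Sum>m<d. c l p m * N (u @ m # v)))"
      unfolding A_def B_def sum_subtractf[symmetric] right_diff_distrib[symmetric] by simp
    also have "\<dots> = (\<Sum>m<d. (\<Sum>l<d. c i j l * c l p m) * N (u @ m # v))"
      unfolding sum_distrib_left sum_distrib_right by (subst sum.swap) (simp add: mult.assoc)
    finally show ?thesis .
  qed
  have "A x z y = - A z x y" "B y x z = - B y z x"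
    by (simp_all add: A_def B_def skew[of x z] sum_negf)
  moreover have "(A x y z - B z x y) + (A y z x - B x y z) + (A z x y - B y z x) = 0"
  proof -
    have "(A x y z - B z x y) + (A y z x - B x y z) + (A z x y - B y z x) =
        (\<Sum>m<d. ((\<Sum>l<d. c x y l * c l z m) + (\<Sum>l<d. c y z l * c l x m) +
          (\<Sum>l<d. c z x l * c l y m)) * N (u @ m # v))"
      by (simp only: comm distrib_right sum.distrib)
    then show ?thesis by (simp only: jacobi mult_zero_left sum.neutral_const)
  qed
  ultimately have "B y x z + A y z x + A x y z = A x z y + B z x y + B x y z"
    by (simp add: algebra_simps)
  then have "N (u @ y # x # z # v) + A x y z = N (u @ x # z # y # v) + B x y z"
    by (simp add: e1 e2 e3 e4 add_ac)
  then show ?thesis by (simp add: A_def B_def)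
qed

lemma relation_at: "relation_at w"
proof (induction w rule: wf_induct_rule[OF wf_word_less])
  case IH: (1 w)
  show ?case
    unfolding relation_at_def
  proof (intro allI impI)
    fix u x y v
    assume w: "w = u @ x # y # v" and xy: "x > y"
    then have "\<not> sorted w" by (auto simp: sorted_append)
    obtain u' x' y' v' where d: "descent w = (u', x', y', v')" by (cases "descent w") auto
    note w' = descent[OF \<open>\<not> sorted w\<close> d]
    have N: "N w = reduct u' x' y' v'"
      using \<open>\<not> sorted w\<close> d by (simp add: straighten.simps[of c d g w])
    have eq: "u @ x # y # v = u' @ x' # y' # v'" using w w' by simp
    \<comment> \<open>Two descents of one word coincide, overlap in one letter on either side, or
      are disjoint on either side.\<close>
    consider "u = u'" | "u' = u @ [x]" "x' = y" | "u = u' @ [x']" "x = y'"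
      | m where "u' = u @ x # y # m" "v = m @ x' # y' # v'"
      | m where "u = u' @ x' # y' # m" "v' = m @ x # y # v"
    proof -
      from eq consider t where "u = u' @ t" "t @ x # y # v = x' # y' # v'"
        | t where "u' = u @ t" "x # y # v = t @ x' # y' # v'"
        by (auto simp: append_eq_append_conv2)
      then show thesis
      proof cases
        case 1
        then show thesis using that(1,3,5) by (cases t; cases "tl t") auto
      next
        case 2
        then show thesis using that(1,2,4) by (cases t; cases "tl t") auto
      qed
    qed
    then show "N w = reduct u x y v"
    proof cases
      case 1
      then show ?thesis using N eq by simp
    next
      case 2
      then have v: "v = y' # v'" using eq by simp
      have "reduct u x y (y' # v') = reduct (u @ [x]) y y' v'"
        by (rule overlapping_descents) (use IH w w' xy 2 v in auto)
      then show ?thesis using N 2 v by simp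
    next
      case 3
      then have v: "v' = y # v" using eq by simp
      have "reduct u' x' x (y # v) = reduct (u' @ [x']) x y v"
        by (rule overlapping_descents) (use IH w w' xy 3 v in auto)
      then show ?thesis using N 3 v by simp
    next
      case (4 m)
      have "reduct u x y (m @ x' # y' # v') = reduct (u @ x # y # m) x' y' v'"
        by (rule disjoint_descents) (use IH w w' xy 4 in auto)
      then show ?thesis using N 4 by simp
    next
      case (5 m)
      have "reduct u' x' y' (m @ x # y # v) = reduct (u' @ x' # y' # m) x y v"
        by (rule disjoint_descents) (use IH w w' xy 5 in auto)
      then show ?thesis using N 5 by simp
    qed
  qed
qed

text \<open>Freed of the condition x > y, the relation says that N respects the commutation rule
  inside every word.\<close>

lemma N_swap: "N (u @ x # y # v) = N (u @ y # x # v) + (\<Sum>l<d. c x y l * N (u @ l # v))"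
  by (rule relation_atD[OF relation_at relation_at])

end

section \<open>The quantized enveloping algebra\<close>

text \<open>The distance of two different series is 2^(-d), where d is the first order at which they
  differ, so approximation means agreement to every finite order.\<close>

lemma mem_closure_fps_iff:
  fixes S :: "'a::group_add fps set"
  shows "F \<in> closure S \<longleftrightarrow> (\<forall>n. \<exists>G\<in>S. \<forall>k\<le>n. G $ k = F $ k)"
proof
  assume F: "F \<in> closure S"
  show "\<forall>n. \<exists>G\<in>S. \<forall>k\<le>n. G $ k = F $ k"
  proof
    fix n
    obtain G where G: "G \<in> S" "dist G F < inverse (2 ^ n)"
      using F unfolding closure_approachable by (metis inverse_positive_iff_positive zero_less_numeral zero_less_power)
    have "G $ k = F $ k" if "k \<le> n" for k
    proof (cases "G = F")
      case False
      then have "n < subdegree (G - F)" using G by (simp add: dist_fps_def)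
      then have "(G - F) $ k = 0" using that by (intro nth_less_subdegree_zero) simp
      then show ?thesis by simp
    qed simp
    then show "\<exists>G\<in>S. \<forall>k\<le>n. G $ k = F $ k" using G by blast
  qed
next
  assume F: "\<forall>n. \<exists>G\<in>S. \<forall>k\<le>n. G $ k = F $ k"
  show "F \<in> closure S"
    unfolding closure_approachable
  proof (intro allI impI)
    fix e :: real assume "e > 0"
    then obtain n where n: "inverse (2 ^ n) < e"
      using real_arch_pow_inv[of e "1/2"] by (auto simp: power_one_over inverse_eq_divide)
    obtain G where G: "G \<in> S" "\<forall>k\<le>n. G $ k = F $ k" using F by blast
    have "dist G F < e"
    proof (cases "G = F")
      case False
      then have "n \<le> subdegree (G - F)" using G by (intro subdegree_geI) auto
      then have "inverse (2 ^ subdegree (G - F)) \<le> (inverse (2 ^ n) :: real)"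
        by (simp add: power_increasing le_imp_inverse_le)
      moreover have "dist G F = inverse (2 ^ subdegree (G - F))"
        by (simp only: dist_fps_def False if_False)
      ultimately show ?thesis using n by linarith
    qed (use \<open>e > 0\<close> in simp)
    then show "\<exists>y\<in>S. dist y F < e" using G by blast
  qed
qed

lemma ring_tens_series_ring: "ring tens_series_ring"
proof (rule ringI)
  show "abelian_group tens_series_ring"
    by (rule abelian_groupI)
      (auto simp: tens_series_ring_def add_ac intro: exI[of _ "- x" for x] left_minus)
  show "Group.monoid tens_series_ring"
    by (rule monoidI) (auto simp: tens_series_ring_def mult.assoc)
qed (simp_all add: tens_series_ring_def algebra_simps)

lemma ideal_tens_series_ring_iff:
  "ideal I tens_series_ring \<longleftrightarrow> 0 \<in> I \<and> (\<forall>a\<in>I. \<forall>b\<in>I. a + b \<in> I) \<and>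
     (\<forall>a\<in>I. \<forall>x. x * a \<in> I \<and> a * x \<in> I)"
proof
  assume "ideal I tens_series_ring"
  then interpret ideal I tens_series_ring .
  show "0 \<in> I \<and> (\<forall>a\<in>I. \<forall>b\<in>I. a + b \<in> I) \<and> (\<forall>a\<in>I. \<forall>x. x * a \<in> I \<and> a * x \<in> I)"
    using additive_subgroup.zero_closed[OF is_additive_subgroup]
      additive_subgroup.a_closed[OF is_additive_subgroup] I_l_closed I_r_closed
    by (simp add: tens_series_ring_def)
next
  assume I: "0 \<in> I \<and> (\<forall>a\<in>I. \<forall>b\<in>I. a + b \<in> I) \<and> (\<forall>a\<in>I. \<forall>x. x * a \<in> I \<and> a * x \<in> I)"
  interpret R: ring tens_series_ring by (rule ring_tens_series_ring)
  have inv: "\<ominus>\<^bsub>tens_series_ring\<^esub> a = (- 1) * a" for a :: "'a tens fps"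
    by (rule R.minus_equality) (simp_all add: tens_series_ring_def)
  show "ideal I tens_series_ring"
  proof (rule idealI[OF ring_tens_series_ring])
    show "subgroup I (add_monoid tens_series_ring)"
    proof (rule group.subgroupI[OF R.a_group])
      fix a assume "a \<in> I"
      then have "(- 1) * a \<in> I" using I by blast
      then show "inv\<^bsub>add_monoid tens_series_ring\<^esub> a \<in> I"
        using inv[of a] by (simp add: a_inv_def)
    qed (use I in \<open>auto simp: tens_series_ring_def\<close>)
  qed (use I in \<open>auto simp: tens_series_ring_def\<close>)
qed

text \<open>Coefficients of sums and products up to order n depend only on coefficients up to order
  n, so approximants taken from I can be combined.\<close>

lemma ideal_closure:
  assumes "ideal I tens_series_ring"
  shows "ideal (closure I) tens_series_ring"
  using assms unfolding ideal_tens_series_ring_iff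
proof (intro conjI ballI allI)
  assume I: "0 \<in> I \<and> (\<forall>a\<in>I. \<forall>b\<in>I. a + b \<in> I) \<and> (\<forall>a\<in>I. \<forall>x. x * a \<in> I \<and> a * x \<in> I)"
  then show "0 \<in> closure I" using closure_subset by blast
  fix a assume a: "a \<in> closure I"
  show "a + b \<in> closure I" if "b \<in> closure I" for b
    unfolding mem_closure_fps_iff
  proof
    fix n
    obtain G H where "G \<in> I" "H \<in> I" "\<forall>k\<le>n. G $ k = a $ k" "\<forall>k\<le>n. H $ k = b $ k"
      using a \<open>b \<in> closure I\<close> unfolding mem_closure_fps_iff by meson
    then show "\<exists>G\<in>I. \<forall>k\<le>n. G $ k = (a + b) $ k" using I by (intro bexI[of _ "G + H"]) auto
  qed
  fix x
  show "x * a \<in> closure I"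
    unfolding mem_closure_fps_iff
  proof
    fix n
    obtain G where "G \<in> I" "\<forall>k\<le>n. G $ k = a $ k" using a unfolding mem_closure_fps_iff by meson
    then show "\<exists>G\<in>I. \<forall>k\<le>n. G $ k = (x * a) $ k"
      using I by (intro bexI[of _ "x * G"]) (auto simp: fps_mult_nth intro!: sum.cong)
  qed
  show "a * x \<in> closure I"
    unfolding mem_closure_fps_iff
  proof
    fix n
    obtain G where "G \<in> I" "\<forall>k\<le>n. G $ k = a $ k" using a unfolding mem_closure_fps_iff by meson
    then show "\<exists>G\<in>I. \<forall>k\<le>n. G $ k = (a * x) $ k"
      using I by (intro bexI[of _ "G * x"]) (auto simp: fps_mult_nth intro!: sum.cong)
  qed
qed

lemma ideal_env_ideal: "ideal (env_ideal br) tens_series_ring"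
  unfolding env_ideal_def
  by (rule ideal_closure, rule ring.genideal_ideal[OF ring_tens_series_ring])
    (simp add: tens_series_ring_def)

lemma env_ideal_closed:
  shows env_ideal_0: "0 \<in> env_ideal br"
    and env_ideal_add: "a \<in> env_ideal br \<Longrightarrow> b \<in> env_ideal br \<Longrightarrow> a + b \<in> env_ideal br"
    and env_ideal_mult_left: "a \<in> env_ideal br \<Longrightarrow> x * a \<in> env_ideal br"
  using ideal_env_ideal[of br] unfolding ideal_tens_series_ring_iff by blast+

lemma env_ideal_uminus: "a \<in> env_ideal br \<Longrightarrow> - a \<in> env_ideal br"
  using env_ideal_mult_left[of a br "- 1"] by simp

lemma env_ideal_diff: "a \<in> env_ideal br \<Longrightarrow> b \<in> env_ideal br \<Longrightarrow> a - b \<in> env_ideal br"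
  using env_ideal_add[OF _ env_ideal_uminus] by fastforce

lemma env_relation_mem:
  "fps_const (tens_lin x * tens_lin y - tens_lin y * tens_lin x)
     - fps_X * fps_const (tens_lin (cx_bracket br x y)) \<in> env_ideal br"
proof -
  have "env_relations br \<subseteq> genideal tens_series_ring (env_relations br)"
    by (rule ring.genideal_self[OF ring_tens_series_ring]) (simp add: tens_series_ring_def)
  moreover have "genideal tens_series_ring (env_relations br) \<subseteq> env_ideal br"
    unfolding env_ideal_def by (rule closure_subset)
  ultimately show ?thesis unfolding env_relations_def by blast
qed

abbreviation env_class :: "('g::real_vector \<Rightarrow> 'g \<Rightarrow> 'g) \<Rightarrow> 'g tens fps \<Rightarrow> 'g tens fps set" where
  "env_class br F \<equiv> a_r_coset tens_series_ring (env_ideal br) F"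

lemma env_class_eq_iff: "env_class br F = env_class br G \<longleftrightarrow> F - G \<in> env_ideal br"
proof
  have coset: "env_class br F = {h + F | h. h \<in> env_ideal br}" for F
    by (auto simp: a_r_coset_def r_coset_def tens_series_ring_def)
  show "F - G \<in> env_ideal br" if "env_class br F = env_class br G"
  proof -
    have "F \<in> env_class br F" unfolding coset using env_ideal_0 by force
    then have "F \<in> env_class br G" using that by simp
    then show ?thesis unfolding coset by auto
  qed
  assume FG: "F - G \<in> env_ideal br"
  show "env_class br F = env_class br G"
    unfolding coset
  proof safe
    fix h assume "h \<in> env_ideal br"
    then show "\<exists>h'. h + F = h' + G \<and> h' \<in> env_ideal br"
      using env_ideal_add[OF _ FG] by (intro exI[of _ "h + (F - G)"]) auto
  next
    fix h assume "h \<in> env_ideal br"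
    then show "\<exists>h'. h + G = h' + F \<and> h' \<in> env_ideal br"
      using env_ideal_diff[OF _ FG] by (intro exI[of _ "h - (F - G)"]) auto
  qed
qed

lemma env_class_mult: "env_class br F \<otimes>\<^bsub>env_alg br\<^esub> env_class br G = env_class br (F * G)"
  using ideal.rcoset_mult_add[OF ideal_env_ideal[of br], of F G]
  by (simp add: env_alg_def FactRing_def tens_series_ring_def)

section \<open>The Poincare-Birkhoff-Witt theorem\<close>

lemma tens_induct [case_names const lin add mult]:
  assumes "\<And>c. P (tens_const c)" "\<And>z. P (tens_lin z)"
    and "\<And>f g. P f \<Longrightarrow> P g \<Longrightarrow> P (f + g)" "\<And>f g. P f \<Longrightarrow> P g \<Longrightarrow> P (f * g)"
  shows "P (t :: 'g::real_vector tens)"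
proof -
  have "P (Abs_tens s)" if "s \<in> tens_fun" for s :: "'g cdual list \<Rightarrow> complex"
    using that
  proof (induction rule: tens_fun.induct)
    case (tens_fun_const c)
    then show ?case using assms(1)[of c] by (simp add: tens_const_def id_def)
  next
    case (tens_fun_lin z)
    then show ?case using assms(2)[of z] by (simp add: tens_lin_def)
  next
    case (tens_fun_add f g)
    then show ?case using assms(3)[of "Abs_tens f" "Abs_tens g"]
      by (simp add: plus_tens_def Abs_tens_inverse)
  next
    case (tens_fun_mult f g)
    then show ?case using assms(4)[of "Abs_tens f" "Abs_tens g"]
      by (simp add: times_tens_def Abs_tens_inverse)
  qed
  from this[OF Rep_tens[of t]] show ?thesis by (simp add: Rep_tens_inverse)
qed

text \<open>Generators have degree at most one and degrees add under products. The bound makes the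
  expansion of a tensor in words finite.\<close>

lemma Rep_tens_bounded: "\<exists>m. \<forall>\<xi>s. length \<xi>s > m \<longrightarrow> Rep_tens t \<xi>s = 0"
proof (induction t rule: tens_induct)
  case (const c)
  show ?case by (intro exI[of _ 0]) (simp add: tens_const.rep_eq)
next
  case (lin z)
  show ?case by (intro exI[of _ 1]) (simp add: Rep_tens_lin)
next
  case (add f g)
  then obtain m n where mn: "\<forall>\<xi>s. length \<xi>s > m \<longrightarrow> Rep_tens f \<xi>s = 0"
    "\<forall>\<xi>s. length \<xi>s > n \<longrightarrow> Rep_tens g \<xi>s = 0" by blast
  then show ?case by (intro exI[of _ "max m n"]) (simp add: plus_tens.rep_eq)
next
  case (mult f g)
  then obtain m n where mn: "\<forall>\<xi>s. length \<xi>s > m \<longrightarrow> Rep_tens f \<xi>s = 0"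
    "\<forall>\<xi>s. length \<xi>s > n \<longrightarrow> Rep_tens g \<xi>s = 0" by blast
  show ?case
  proof (intro exI[of _ "m + n"] allI impI)
    fix \<xi>s :: "'a cdual list" assume len: "length \<xi>s > m + n"
    have "Rep_tens f (take k \<xi>s) * Rep_tens g (drop k \<xi>s) = 0" if "k \<le> length \<xi>s" for k
    proof (cases "k > m")
      case True
      then show ?thesis using mn(1) that by simp
    next
      case False
      then show ?thesis using mn(2) len by simp
    qed
    then show "Rep_tens (f * g) \<xi>s = 0"
      unfolding times_tens.rep_eq conc_mult_def by (intro sum.neutral ballI) simp
  qed
qed

lemma fps_X_left_commute: "a * (fps_X * b) = fps_X * (a * b)" for a b :: "'a::ring_1 fps"
  by (metis mult.assoc fps_mult_fps_X_commute)

text \<open>Splitting off the constant term leaves \<open>fps_X\<close> times the value at the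
  shifted series, so each coefficient reduces to the preceding one. Commutation with
  \<open>fps_X\<close> takes the place of continuity.\<close>

lemma fps_linear_eq_0:
  fixes T :: "'a::ring_1 fps \<Rightarrow> 'b::ring_1 fps"
  assumes add: "\<And>F G. T (F + G) = T F + T G" and X: "\<And>F. T (fps_X * F) = fps_X * T F"
    and const: "\<And>a. T (fps_const a) = 0"
  shows "T F = 0"
proof (rule fps_ext)
  fix n show "T F $ n = 0 $ n"
  proof (induction n arbitrary: F)
    case 0
    have "F = fps_const (F $ 0) + fps_X * fps_shift 1 F"
      by (rule fps_ext) simp
    then have "T F = fps_X * T (fps_shift 1 F)" by (metis add X const add_0)
    then show ?case by simp
  next
    case (Suc n)
    have "F = fps_const (F $ 0) + fps_X * fps_shift 1 F"
      by (rule fps_ext) simp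
    then have "T F = fps_X * T (fps_shift 1 F)" by (metis add X const add_0)
    then show ?case using Suc[of "fps_shift 1 F"] by simp
  qed
qed

context finite_lie_algebra
begin

section \<open>Basis, dual basis and structure constants\<close>

definition rank :: nat where
  "rank = card basis"

text \<open>Numbering the basis provides the linear order on letters that straightening
  requires.\<close>

definition e :: "nat \<Rightarrow> 'g" where
  "e i = (if i < rank then (SOME h. bij_betw h {..<rank} basis) i else 0)"

lemma bij_e: "bij_betw e {..<rank} basis"
proof -
  have "\<exists>h. bij_betw h {..<rank} basis"
    using ex_bij_betw_nat_finite[OF finite_basis] by (simp add: rank_def atLeast0LessThan)
  then have "bij_betw (SOME h. bij_betw h {..<rank} basis) {..<rank} basis" by (rule someI_ex)
  then show ?thesis by (rule bij_betw_cong[THEN iffD1, rotated]) (simp add: e_def)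
qed

lemma e_mem: "i < rank \<Longrightarrow> e i \<in> basis"
  using bij_e by (auto simp: bij_betw_def)

lemma e_eq_iff: "i < rank \<Longrightarrow> j < rank \<Longrightarrow> e i = e j \<longleftrightarrow> i = j"
  using bij_e by (auto simp: bij_betw_def inj_on_def)

lemma e_expansion: "x = (\<Sum>i<rank. coord (e i) x *\<^sub>R e i)"
  using coord_sum[of x] sum.reindex_bij_betw[OF bij_e, of "\<lambda>b. coord b x *\<^sub>R b"] by simp

text \<open>This is the dual basis; the values of a tensor on lists of its members are the
  coefficients of that tensor in words.\<close>

definition eps :: "nat \<Rightarrow> 'g cdual" where
  "eps i = Abs_cdual (\<lambda>x. complex_of_real (coord (e i) x))"

lemma ev_eps: "ev (eps i) x = complex_of_real (coord (e i) x)"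
proof -
  have "linear (\<lambda>x. complex_of_real (coord (e i) x))"
    by (intro linearI) (simp_all add: linear_add[OF linear_coord] linear_scale[OF linear_coord]
        scaleR_conv_of_real)
  then show ?thesis by (simp add: eps_def Abs_cdual_inverse)
qed

lemma ev_cx_eps: "i < rank \<Longrightarrow> j < rank \<Longrightarrow> ev_cx (eps i) (e j, 0) = (if i = j then 1 else 0)"
  by (simp add: ev_cx_def ev_eps coord_basis[OF e_mem] e_eq_iff linear_0[OF linear_coord])

text \<open>The factor \<nu> comes from the relation x y - y x = \<nu> [x, y]; it makes all
  corrections of straightening vanish modulo \<nu>.\<close>

definition struct :: "nat \<Rightarrow> nat \<Rightarrow> nat \<Rightarrow> 'g sym fps" where
  "struct i j l = fps_X * fps_const (sym_const (of_real (coord (e l) (br (e i) (e j)))))"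

definition monomial :: "nat list \<Rightarrow> 'g sym fps" where
  "monomial w = fps_const (prod_list (map (\<lambda>i. sym_lin (e i, 0)) w))"

lemma br_self: "br x x = 0"
  using lie by (simp add: lie_algebra_def)

lemma br_skew: "br x y = - br y x"
proof -
  have "br (x + y) (x + y) = br x x + br y x + (br x y + br y y)"
    by (simp only: bilinear_ladd[OF bilinear_br] bilinear_radd[OF bilinear_br])
  then have "br x y + br y x = 0" by (simp add: br_self add.commute)
  then show ?thesis by (rule eq_neg_iff_add_eq_0[THEN iffD2])
qed

lemma br_jacobi: "br (br x y) z + br (br y z) x + br (br z x) y = 0"
proof -
  have "br x (br y z) + br y (br z x) + br z (br x y) = 0"
    using lie by (simp add: lie_algebra_def)
  moreover have "br (br x y) z = - br z (br x y)" "br (br y z) x = - br x (br y z)"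
    "br (br z x) y = - br y (br z x)" by (rule br_skew)+
  ultimately show ?thesis by (simp add: add_eq_0_iff algebra_simps)
qed

lemma fps_const_sum: "fps_const (\<Sum>i\<in>I. f i) = (\<Sum>i\<in>I. fps_const (f i))"
  by (induction I rule: infinite_finite_induct) (simp_all flip: fps_const_add)

text \<open>Expanding the inner bracket in the basis turns the sum into a coordinate of a double
  bracket, so that the axiom of \<open>structure_constants\<close> becomes the Jacobi identity of
  \<open>br\<close>.\<close>

lemma struct_compose:
  "(\<Sum>l<rank. struct x y l * struct l z m) =
    fps_X ^ 2 * fps_const (sym_const (of_real (coord (e m) (br (br (e x) (e y)) (e z)))))"
proof -
  have l: "linear (\<lambda>v. coord (e m) (br v (e z)))"
    using linear_compose[OF _ linear_coord] bilinear_br by (auto simp: bilinear_def o_def)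
  have "coord (e m) (br (br (e x) (e y)) (e z)) =
      coord (e m) (br (\<Sum>l<rank. coord (e l) (br (e x) (e y)) *\<^sub>R e l) (e z))"
    using e_expansion[of "br (e x) (e y)"] by simp
  also have "\<dots> = (\<Sum>l<rank. coord (e l) (br (e x) (e y)) * coord (e m) (br (e l) (e z)))"
    by (simp add: linear_sum[OF l] linear_scale[OF l])
  finally have *: "fps_const (sym_const (of_real (coord (e m) (br (br (e x) (e y)) (e z))))) =
      (\<Sum>l<rank. fps_const (sym_const (of_real (coord (e l) (br (e x) (e y))))) *
        fps_const (sym_const (of_real (coord (e m) (br (e l) (e z))))) :: 'g sym fps)"
    by (simp add: sym_const_sum fps_const_sum flip: sym_const_mult)
  show ?thesis
    unfolding * sum_distrib_left by (intro sum.cong refl) (simp add: struct_def power2_eq_square mult_ac)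
qed

sublocale structure_constants struct rank monomial
proof
  show "struct i j l = - struct j i l" for i j l
    by (simp add: struct_def br_skew[of "e i" "e j"] linear_neg[OF linear_coord] sym_const_uminus
        flip: fps_const_neg)
  show "struct i i l = 0" for i l
    by (simp add: struct_def br_self linear_0[OF linear_coord])
  show "(\<Sum>l<rank. struct x y l * struct l z m) + (\<Sum>l<rank. struct y z l * struct l x m) +
      (\<Sum>l<rank. struct z x l * struct l y m) = 0" for x y z m
  proof -
    have "coord (e m) (br (br (e x) (e y)) (e z)) + coord (e m) (br (br (e y) (e z)) (e x)) +
        coord (e m) (br (br (e z) (e x)) (e y)) = 0"
      by (simp add: br_jacobi linear_0[OF linear_coord] flip: linear_add[OF linear_coord])
    then show ?thesis
      unfolding struct_compose distrib_left[symmetric] fps_const_add sym_const_add[symmetric]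
        of_real_add[symmetric]
      by simp
  qed
qed

text \<open>The bracket terms carry a factor \<nu>, so letters commute modulo \<nu>.\<close>

lemma N_nth_0: "N w $ 0 = prod_list (map (\<lambda>i. sym_lin (e i, 0)) w)"
proof (induction w rule: wf_induct_rule[OF wf_word_less])
  case IH: (1 w)
  show ?case
  proof (cases "sorted w")
    case True
    have "N w $ 0 = monomial w $ 0" by (simp only: N_sorted[OF True])
    also have "monomial w $ 0 = prod_list (map (\<lambda>i. sym_lin (e i, 0)) w)" by (simp add: monomial_def)
    finally show ?thesis .
  next
    case False
    then obtain u x y v where w: "w = u @ x # y # v" and "x > y" using descent_exists by blast
    have "N w $ 0 = N (u @ y # x # v) $ 0"
      by (simp add: w N_swap[of u x y v] fps_sum_nth struct_def)
    also have "\<dots> = prod_list (map (\<lambda>i. sym_lin (e i, 0)) (u @ y # x # v))"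
      using IH swap_word_less[OF \<open>x > y\<close>, of u v] by (simp add: w)
    finally show ?thesis by (simp add: w mult_ac)
  qed
qed

section \<open>The normal form of a tensor\<close>

definition word :: "nat list \<Rightarrow> 'g tens" where
  "word w = prod_list (map (\<lambda>i. tens_lin (e i, 0)) w)"

lemma word_append: "word (u @ v) = word u * word v"
  by (simp add: word_def)

lemma Rep_word:
  assumes "w \<in> lists {..<rank}" "v \<in> lists {..<rank}"
  shows "Rep_tens (word w) (map eps v) = (if v = w then 1 else 0)"
proof (cases "length v = length w")
  case True
  have "(\<Prod>i<length w. ev_cx (eps (v ! i)) (e (w ! i), 0)) =
      (\<Prod>i<length w. if v ! i = w ! i then 1 else 0)"
    using assms True by (intro prod.cong refl ev_cx_eps) (auto simp: in_lists_conv_set)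
  also have "\<dots> = (if v = w then 1 else 0)"
    using True by (auto simp: list_eq_iff_nth_eq prod_zero_iff)
  finally show ?thesis
    using True Rep_tens_prod_lin[of "map (\<lambda>i. (e i, 0)) w" "map eps v"] by (simp add: word_def o_def)
next
  case False
  then show ?thesis
    using Rep_tens_prod_lin[of "map (\<lambda>i. (e i, 0)) w" "map eps v"] by (auto simp: word_def o_def)
qed

definition supp :: "'g tens \<Rightarrow> nat list set" where
  "supp t = {w \<in> lists {..<rank}. Rep_tens t (map eps w) \<noteq> 0}"

lemma finite_supp: "finite (supp t)"
proof -
  obtain m where m: "\<forall>\<xi>s. length \<xi>s > m \<longrightarrow> Rep_tens t \<xi>s = 0" using Rep_tens_bounded by blast
  have "supp t \<subseteq> {w. set w \<subseteq> {..<rank} \<and> length w \<le> m}"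
    using m by (force simp: supp_def in_lists_conv_set not_le[symmetric])
  then show ?thesis using finite_lists_length_le[of "{..<rank}" m] by (auto intro: finite_subset)
qed

text \<open>This is the linear extension of N from words to tensors. Reading the coefficients off by
  pairing with \<open>eps\<close> makes it well defined without a chosen expansion.\<close>

definition pbw :: "'g tens \<Rightarrow> 'g sym fps" where
  "pbw t = (\<Sum>w\<in>supp t. fps_const (sym_const (Rep_tens t (map eps w))) * N w)"

lemma pbw_superset:
  assumes "finite A" "supp t \<subseteq> A" "A \<subseteq> lists {..<rank}"
  shows "pbw t = (\<Sum>w\<in>A. fps_const (sym_const (Rep_tens t (map eps w))) * N w)"
  unfolding pbw_def using assms by (intro sum.mono_neutral_left) (auto simp: supp_def)

lemma pbw_add: "pbw (s + t) = pbw s + pbw t"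
proof -
  let ?A = "supp s \<union> supp t"
  have A: "finite ?A" "?A \<subseteq> lists {..<rank}" by (auto simp: finite_supp) (auto simp: supp_def)
  have "supp (s + t) \<subseteq> ?A" by (auto simp: supp_def plus_tens.rep_eq)
  then show ?thesis
    using A by (simp add: pbw_superset[of ?A] plus_tens.rep_eq sym_const_add distrib_right sum.distrib
        flip: fps_const_add)
qed

lemma pbw_scale: "pbw (tens_const c * t) = fps_const (sym_const c) * pbw t"
proof -
  have "supp (tens_const c * t) \<subseteq> supp t" by (auto simp: supp_def Rep_tens_const_mult)
  then have "pbw (tens_const c * t) =
      (\<Sum>w\<in>supp t. fps_const (sym_const (Rep_tens (tens_const c * t) (map eps w))) * N w)"
    by (intro pbw_superset finite_supp) (auto simp: supp_def)
  then show ?thesis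
    by (simp add: pbw_def Rep_tens_const_mult sym_const_mult sum_distrib_left mult.assoc[symmetric])
qed

lemma pbw_0 [simp]: "pbw 0 = 0"
  using pbw_scale[of 0 0] by simp

lemma pbw_uminus: "pbw (- t) = - pbw t"
  using pbw_add[of t "- t"] by (simp add: add_eq_0_iff)

lemma pbw_diff: "pbw (s - t) = pbw s - pbw t"
  using pbw_add[of s "- t"] by (simp add: pbw_uminus)

lemma pbw_sum: "pbw (\<Sum>i\<in>I. t i) = (\<Sum>i\<in>I. pbw (t i))"
  by (induction I rule: infinite_finite_induct) (simp_all add: pbw_add)

lemma pbw_word: "w \<in> lists {..<rank} \<Longrightarrow> pbw (word w) = N w"
proof -
  assume w: "w \<in> lists {..<rank}"
  have "supp (word w) \<subseteq> {w}"
  proof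
    fix v assume "v \<in> supp (word w)"
    then have "v \<in> lists {..<rank}" "Rep_tens (word w) (map eps v) \<noteq> 0" by (simp_all add: supp_def)
    then show "v \<in> {w}" using Rep_word[OF w, of v] by (simp split: if_splits)
  qed
  then have "pbw (word w) = (\<Sum>v\<in>{w}. fps_const (sym_const (Rep_tens (word w) (map eps v))) * N v)"
    using w by (intro pbw_superset) auto
  then show ?thesis using Rep_word[OF w w] by simp
qed

lemma cx_induct [case_names basis add scale zero]:
  assumes "\<And>i. i < rank \<Longrightarrow> P (e i, 0)" "\<And>z w. P z \<Longrightarrow> P w \<Longrightarrow> P (z + w)"
    "\<And>c z. P z \<Longrightarrow> P (cx_scale c z)" "P 0"
  shows "P z"
proof -
  have P: "P (x, 0)" for x
  proof -
    have "P (\<Sum>i<m. coord (e i) x *\<^sub>R e i, 0)" if "m \<le> rank" for m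
      using that
    proof (induction m)
      case (Suc m)
      have "(\<Sum>i<Suc m. coord (e i) x *\<^sub>R e i, 0) =
          (\<Sum>i<m. coord (e i) x *\<^sub>R e i, 0) + cx_scale (coord (e m) x) (e m, 0)"
        by (simp add: cx_scale_def)
      moreover have "P \<dots>" using Suc by (intro assms(1-3)) simp_all
      ultimately show ?case by simp
    qed (use assms(4) in \<open>simp add: zero_prod_def\<close>)
    from this[of rank] show ?thesis by (simp flip: e_expansion)
  qed
  have "z = (fst z, 0) + cx_scale \<i> (snd z, 0)" by (simp add: cx_scale_def prod_eq_iff)
  moreover have "P \<dots>" by (intro assms(2,3) P)
  ultimately show ?thesis by simp
qed

inductive_set word_span :: "'g tens set" where
  word_span_word: "w \<in> lists {..<rank} \<Longrightarrow> word w \<in> word_span"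
| word_span_add: "s \<in> word_span \<Longrightarrow> t \<in> word_span \<Longrightarrow> s + t \<in> word_span"
| word_span_scale: "s \<in> word_span \<Longrightarrow> tens_const c * s \<in> word_span"

lemma word_span_mult: "s \<in> word_span \<Longrightarrow> t \<in> word_span \<Longrightarrow> s * t \<in> word_span"
proof (induction rule: word_span.induct)
  case (word_span_word u)
  from word_span_word.prems show ?case
  proof (induction rule: word_span.induct)
    case (word_span_word v)
    then show ?case
      using word_span.word_span_word[of "u @ v"] \<open>u \<in> lists {..<rank}\<close> by (simp add: word_append)
  next
    case (word_span_scale s c)
    then show ?case
      using word_span.word_span_scale[of "word u * s" c] by (simp add: tens_const_left_commute)
  qed (auto simp: distrib_left intro: word_span_add)
qed (auto simp: distrib_right mult.assoc intro: word_span_add word_span_scale)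

lemma tens_lin_0 [simp]: "tens_lin 0 = 0"
  using tens_lin_add[of 0 0] by simp

lemma word_span_UNIV: "t \<in> word_span"
proof (induction t rule: tens_induct)
  case (const c)
  show ?case using word_span_scale[OF word_span_word[of "[]"], of c] by (simp add: word_def)
next
  case (lin z)
  show ?case
  proof (induction z rule: cx_induct)
    case (basis i)
    then show ?case using word_span_word[of "[i]"] by (simp add: word_def)
  next
    case zero
    show ?case using word_span_scale[OF word_span_word[of "[]"], of 0] by simp
  qed (auto simp: tens_lin_add tens_lin_scale intro: word_span_add word_span_scale)
qed (auto intro: word_span_add word_span_mult)

lemma word_induct [case_names word add scale]:
  assumes "\<And>w. w \<in> lists {..<rank} \<Longrightarrow> P (word w)"
    and "\<And>s t. P s \<Longrightarrow> P t \<Longrightarrow> P (s + t)" "\<And>c s. P s \<Longrightarrow> P (tens_const c * s)"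
  shows "P t"
  using word_span_UNIV[of t] by (induction rule: word_span.induct) (auto intro: assms)

text \<open>Modulo \<nu> the normal form is the projection of the tensor algebra onto polynomials,
  which is multiplicative even though \<open>pbw\<close> in general is not.\<close>

lemma pbw_mult_nth_0: "pbw (s * t) $ 0 = pbw s $ 0 * pbw t $ 0"
proof (induction s rule: word_induct)
  case (word u)
  show ?case
  proof (induction t rule: word_induct)
    case (word v)
    then show ?case
      using \<open>u \<in> lists {..<rank}\<close>
      by (simp add: pbw_word N_nth_0 flip: word_append)
  qed (simp_all add: distrib_left pbw_add tens_const_left_commute pbw_scale mult.left_commute)
qed (simp_all add: distrib_right pbw_add mult.assoc pbw_scale)

lemma pbw_lin_nth_0: "pbw (tens_lin z) $ 0 = sym_lin z"
proof (induction z rule: cx_induct)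
  case (basis i)
  then show ?case using pbw_word[of "[i]"] N_nth_0[of "[i]"] by (simp add: word_def)
next
  case zero
  show ?case using sym_lin_add[of 0 0] by simp
qed (simp_all add: tens_lin_add tens_lin_scale pbw_add pbw_scale sym_lin_add sym_lin_scale)

text \<open>Symmetrization is a section of the projection of tensors onto polynomials; on powers
  both maps are explicit.\<close>

lemma pbw_sym_tens_nth_0: "pbw (sym_tens f) $ 0 = f"
proof (induction f rule: sym_power_induct)
  case (power X n)
  have "pbw (tens_lin (X, 0) ^ n) $ 0 = sym_lin (X, 0) ^ n"
  proof (induction n)
    case 0
    show ?case using pbw_word[of "[]"] N_nth_0[of "[]"] by (simp add: word_def)
  qed (simp add: pbw_mult_nth_0 pbw_lin_nth_0)
  then show ?case by (simp add: sym_tens_power)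
qed (simp_all add: sym_tens_add sym_tens_scale pbw_add pbw_scale)

lemma cx_bracket_add_left: "cx_bracket br (z + z') w = cx_bracket br z w + cx_bracket br z' w"
  by (simp add: cx_bracket_def bilinear_ladd[OF bilinear_br] prod_eq_iff)

lemma cx_bracket_scale_left: "cx_bracket br (cx_scale c z) w = cx_scale c (cx_bracket br z w)"
  by (simp add: cx_bracket_def cx_scale_def bilinear_ladd[OF bilinear_br] bilinear_lsub[OF bilinear_br]
      bilinear_lmul[OF bilinear_br] prod_eq_iff algebra_simps)

lemma cx_bracket_skew: "cx_bracket br z w = cx_scale (- 1) (cx_bracket br w z)"
  by (simp add: cx_bracket_def cx_scale_def br_skew[of "fst z"] br_skew[of "snd z"] prod_eq_iff)

lemma cx_scale_add: "cx_scale c (z + w) = cx_scale c z + cx_scale c w"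
  by (simp add: cx_scale_def prod_eq_iff algebra_simps)

lemma cx_scale_scale: "cx_scale c (cx_scale d z) = cx_scale (c * d) z"
  by (simp add: cx_scale_def prod_eq_iff algebra_simps)

lemma cx_bracket_add_right: "cx_bracket br z (w + w') = cx_bracket br z w + cx_bracket br z w'"
  by (simp add: cx_bracket_skew[of z] cx_bracket_add_left cx_scale_add)

lemma cx_bracket_scale_right: "cx_bracket br z (cx_scale c w) = cx_scale c (cx_bracket br z w)"
  by (simp add: cx_bracket_skew[of z] cx_bracket_scale_left cx_scale_scale mult.commute)

lemma cx_bracket_0 [simp]: "cx_bracket br 0 w = 0" "cx_bracket br z 0 = 0"
  by (simp_all add: cx_bracket_def bilinear_lzero[OF bilinear_br] bilinear_rzero[OF bilinear_br]
      zero_prod_def)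

text \<open>For basis letters this is \<open>N_swap\<close>, whose sum is the expansion of the
  bracket in the basis; bilinearity in \<open>z\<close> and \<open>w\<close> does the rest.\<close>

lemma pbw_relation_word:
  assumes "u \<in> lists {..<rank}" "v \<in> lists {..<rank}"
  shows "pbw (word u * (tens_lin z * tens_lin w - tens_lin w * tens_lin z) * word v) =
    fps_X * pbw (word u * tens_lin (cx_bracket br z w) * word v)"
proof (induction z rule: cx_induct)
  case (basis i)
  show ?case
  proof (induction w rule: cx_induct)
    case (basis j)
    have "pbw (word u * (tens_lin (e i, 0) * tens_lin (e j, 0) - tens_lin (e j, 0) * tens_lin (e i, 0)) * word v)
      = pbw (word (u @ i # j # v)) - pbw (word (u @ j # i # v))"
      by (simp add: word_def algebra_simps flip: pbw_diff)
    also have "\<dots> = (\<Sum>l<rank. struct i j l * N (u @ l # v))"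
      using assms \<open>i < rank\<close> \<open>j < rank\<close> by (simp add: pbw_word N_swap[of u i j v])
    also have "\<dots> = fps_X * (\<Sum>l<rank. fps_const (sym_const (of_real (coord (e l) (br (e i) (e j))))) * N (u @ l # v))"
      by (simp add: struct_def sum_distrib_left mult.assoc)
    also have "(\<Sum>l<rank. fps_const (sym_const (of_real (coord (e l) (br (e i) (e j))))) * N (u @ l # v)) =
        pbw (\<Sum>l<rank. tens_const (of_real (coord (e l) (br (e i) (e j)))) * word (u @ l # v))"
      using assms by (simp add: pbw_sum pbw_scale pbw_word)
    also have "(\<Sum>l<rank. tens_const (of_real (coord (e l) (br (e i) (e j)))) * word (u @ l # v)) =
        word u * (\<Sum>l<rank. tens_const (of_real (coord (e l) (br (e i) (e j)))) * tens_lin (e l, 0)) * word v"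
      by (simp add: word_def sum_distrib_left sum_distrib_right mult.assoc tens_const_left_commute)
    also have "(\<Sum>l<rank. tens_const (of_real (coord (e l) (br (e i) (e j)))) * tens_lin (e l, 0)) =
        tens_lin (br (e i) (e j), 0)"
    proof -
      have "(\<Sum>l<m. tens_const (of_real (coord (e l) x)) * tens_lin (e l, 0)) =
          tens_lin (\<Sum>l<m. coord (e l) x *\<^sub>R e l, 0)" for m x
        by (induction m)
          (simp_all add: cx_scale_def flip: zero_prod_def tens_lin_scale tens_lin_add)
      from this[of "br (e i) (e j)" rank] show ?thesis by (simp flip: e_expansion)
    qed
    finally show ?case
      by (simp add: cx_bracket_def bilinear_lzero[OF bilinear_br] bilinear_rzero[OF bilinear_br])
  qed (simp_all add: tens_lin_add tens_lin_scale cx_bracket_add_right cx_bracket_scale_right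
      algebra_simps pbw_add pbw_diff pbw_scale tens_const_left_commute tens_const_commute[of "tens_lin (e i, 0)"])
qed (simp_all add: tens_lin_add tens_lin_scale cx_bracket_add_left cx_bracket_scale_left
      algebra_simps pbw_add pbw_diff pbw_scale tens_const_left_commute)

lemma pbw_relation:
  "pbw (s * (tens_lin z * tens_lin w - tens_lin w * tens_lin z) * t) =
    fps_X * pbw (s * tens_lin (cx_bracket br z w) * t)"
proof (induction s rule: word_induct)
  case (word u)
  show ?case
  proof (induction t rule: word_induct)
    case (word v)
    show ?case by (rule pbw_relation_word) fact+
  qed (simp_all add: distrib_left pbw_add tens_const_left_commute pbw_scale mult.left_commute[of fps_X])
qed (simp_all add: distrib_right distrib_left pbw_add mult.assoc pbw_scale mult.left_commute[of fps_X])

text \<open>This is the \<nu>-adically continuous, \<nu>-linear extension of \<open>pbw\<close>: the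
  sum of \<nu>^k times \<open>pbw (F $ k)\<close>, collected order by order.\<close>

definition pbw_series :: "'g tens fps \<Rightarrow> 'g sym fps" where
  "pbw_series F = Abs_fps (\<lambda>n. \<Sum>k\<le>n. pbw (F $ k) $ (n - k))"

lemma pbw_series_add: "pbw_series (F + G) = pbw_series F + pbw_series G"
  by (rule fps_ext) (simp add: pbw_series_def pbw_add sum.distrib)

lemma pbw_series_0 [simp]: "pbw_series 0 = 0"
  by (rule fps_ext) (simp add: pbw_series_def)

lemma pbw_series_X: "pbw_series (fps_X * F) = fps_X * pbw_series F"
proof (rule fps_ext)
  fix n show "pbw_series (fps_X * F) $ n = (fps_X * pbw_series F) $ n"
    by (cases n) (simp_all add: pbw_series_def sum.atMost_Suc_shift del: sum.atMost_Suc)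
qed

lemma pbw_series_const: "pbw_series (fps_const t) = pbw t"
proof (rule fps_ext)
  fix n
  have "(\<Sum>k\<le>n. pbw (fps_const t $ k) $ (n - k)) = (\<Sum>k\<le>n. if k = 0 then pbw t $ n else 0)"
    by (intro sum.cong refl) auto
  then show "pbw_series (fps_const t) $ n = pbw t $ n" by (simp add: pbw_series_def)
qed

lemma pbw_series_diff: "pbw_series (F - G) = pbw_series F - pbw_series G"
  using pbw_series_add[of "F - G" G] by (simp add: algebra_simps)

text \<open>For constant a and b this is \<open>pbw_relation\<close>; additivity and \<nu>-linearity
  extend it to series, in b and then in a.\<close>

lemma pbw_series_relation:
  "pbw_series (a * (fps_const (tens_lin x * tens_lin y - tens_lin y * tens_lin x)
     - fps_X * fps_const (tens_lin (cx_bracket br x y))) * b) = 0"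
proof -
  let ?r = "fps_const (tens_lin x * tens_lin y - tens_lin y * tens_lin x)
     - fps_X * fps_const (tens_lin (cx_bracket br x y))"
  have const: "pbw_series (fps_const s * ?r * fps_const t) = 0" for s t
  proof -
    have "fps_const s * ?r * fps_const t =
        fps_const (s * (tens_lin x * tens_lin y - tens_lin y * tens_lin x) * t)
        - fps_X * fps_const (s * tens_lin (cx_bracket br x y) * t)"
    proof -
      have "fps_const s * (fps_X * F) * fps_const t = fps_X * (fps_const s * F * fps_const t)" for F
        by (simp only: mult.assoc fps_X_left_commute)
      then show ?thesis
        by (simp only: right_diff_distrib[of "fps_const s"] left_diff_distrib[of _ _ "fps_const t"]
            fps_const_mult)
    qed
    then show ?thesis
      by (simp only: pbw_series_diff pbw_series_X pbw_series_const pbw_relation) simp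
  qed
  have left: "pbw_series (fps_const s * ?r * b) = 0" for s
  proof (rule fps_linear_eq_0[of "\<lambda>b. pbw_series (fps_const s * ?r * b)"])
    show "pbw_series (fps_const s * ?r * (fps_X * F)) = fps_X * pbw_series (fps_const s * ?r * F)" for F
      by (simp only: fps_X_left_commute pbw_series_X)
  qed (simp_all only: distrib_left pbw_series_add const)
  show ?thesis
  proof (rule fps_linear_eq_0[of "\<lambda>a. pbw_series (a * ?r * b)"])
    show "pbw_series ((F + G) * ?r * b) = pbw_series (F * ?r * b) + pbw_series (G * ?r * b)" for F G
      by (simp only: distrib_right[of F] distrib_right[of "F * _"] pbw_series_add)
    show "pbw_series (fps_X * F * ?r * b) = fps_X * pbw_series (F * ?r * b)" for F
      by (simp only: mult.assoc pbw_series_X)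
  qed (rule left)
qed

lemma pbw_series_env_ideal:
  assumes "F \<in> env_ideal br"
  shows "pbw_series F = 0"
proof -
  \<comment> \<open>The kernel of \<open>pbw_series\<close> is not visibly an ideal; demanding that
    all two-sided multiples vanish yields one inside it.\<close>
  define J where "J = {F. \<forall>a b. pbw_series (a * F * b) = 0}"
  have "ideal J tens_series_ring"
    unfolding ideal_tens_series_ring_iff
  proof (intro conjI ballI allI)
    fix F x assume F: "F \<in> J"
    have "a * (x * F) * b = (a * x) * F * b" "a * (F * x) * b = a * F * (x * b)" for a b
      by (simp_all only: mult.assoc)
    then show "x * F \<in> J" "F * x \<in> J" using F by (simp_all add: J_def)
  qed (simp_all add: J_def distrib_left distrib_right pbw_series_add)
  moreover have "env_relations br \<subseteq> J"
    by (auto simp: env_relations_def J_def pbw_series_relation simp del: fps_const_sub)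
  ultimately have sub: "genideal tens_series_ring (env_relations br) \<subseteq> J"
    by (rule ring.genideal_minimal[OF ring_tens_series_ring])
  show ?thesis
  proof (rule fps_ext)
    fix n
    \<comment> \<open>Order n of \<open>pbw_series\<close> depends only on orders up to n, so
      vanishing passes from the generated ideal to its closure.\<close>
    obtain G where G: "G \<in> J" "\<forall>k\<le>n. G $ k = F $ k"
      using assms sub unfolding env_ideal_def mem_closure_fps_iff by blast
    have "pbw_series (1 * G * 1) = 0" using G(1) unfolding J_def by blast
    moreover have "pbw_series F $ n = pbw_series G $ n"
      unfolding pbw_series_def using G(2) by (auto intro!: sum.cong)
    ultimately show "pbw_series F $ n = 0 $ n" by simp
  qed
qed

end

section \<open>The star product\<close>

lemma sym_tens_0 [simp]: "sym_tens 0 = 0"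
  using sym_tens_scale[of 0 0] by simp

lemma sym_series_scale_eq: "sym_series_scale c F = sym_of_series c * F"
  by (simp add: sym_series_scale_def sym_of_series_def)

lemma sym_of_series_1 [simp]: "sym_of_series 1 = 1"
  using sym_of_series_const[of 1] by simp

lemma sym_of_series_power: "sym_of_series (c ^ k) = sym_of_series c ^ k"
  by (induction k) (simp_all add: sym_of_series_mult)

section \<open>The involution on series\<close>

lemma sym_cnj_props:
  shows sym_cnj_add: "sym_cnj (f + g) = sym_cnj f + sym_cnj g"
    and sym_cnj_mult: "sym_cnj (f * g) = sym_cnj f * sym_cnj g"
    and sym_cnj_const: "sym_cnj (sym_const c) = sym_const (cnj c)"
  by (transfer; simp)+

lemma sym_cnj_lin_real: "sym_cnj (sym_lin (X, 0)) = sym_lin (X, 0)"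
  by (rule sym_eqI)
    (simp add: sym_cnj.rep_eq sym_lin.rep_eq ev_cx_def cdual_cnj.rep_eq linear_0[OF linear_ev])

lemma sym_cnj_1 [simp]: "sym_cnj 1 = 1"
  using sym_cnj_const[of 1] by simp

lemma sym_cnj_power: "sym_cnj (f ^ n) = sym_cnj f ^ n"
  by (induction n) (simp_all add: sym_cnj_mult)

lemma sym_cnj_0 [simp]: "sym_cnj 0 = 0"
  using sym_cnj_const[of 0] by simp

lemma sym_cnj_sum: "sym_cnj (\<Sum>i\<in>I. f i) = (\<Sum>i\<in>I. sym_cnj (f i))"
  by (induction I rule: infinite_finite_induct) (simp_all add: sym_cnj_add)

lemma sym_series_star_add: "sym_series_star (F + G) = sym_series_star F + sym_series_star G"
  by (rule fps_ext) (simp add: sym_series_star_def sym_cnj_add distrib_left)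

lemma sym_series_star_0 [simp]: "sym_series_star 0 = 0"
  by (rule fps_ext) (simp add: sym_series_star_def)

lemma sym_series_star_sum: "sym_series_star (\<Sum>i\<in>I. F i) = (\<Sum>i\<in>I. sym_series_star (F i))"
  by (induction I rule: infinite_finite_induct) (simp_all add: sym_series_star_add)

lemma sym_series_star_diff: "sym_series_star (F - G) = sym_series_star F - sym_series_star G"
  using sym_series_star_add[of "F - G" G] by (simp add: algebra_simps)

lemma sym_series_star_scale:
  "sym_series_star (sym_series_scale c F) = sym_series_scale (fps_cnj c) (sym_series_star F)"
proof (rule fps_ext)
  fix n
  have "sym_const ((- 1) ^ n) * (sym_const (cnj (c $ i)) * sym_cnj (F $ (n - i))) =
      sym_const ((- 1) ^ i * cnj (c $ i)) * (sym_const ((- 1) ^ (n - i)) * sym_cnj (F $ (n - i)))"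
    if "i \<le> n" for i
  proof -
    have "(- 1 :: complex) ^ n = (- 1) ^ i * (- 1) ^ (n - i)"
      using that by (simp flip: power_add)
    then show ?thesis by (simp add: sym_const_mult mult_ac)
  qed
  then show "sym_series_star (sym_series_scale c F) $ n =
      sym_series_scale (fps_cnj c) (sym_series_star F) $ n"
    by (simp add: sym_series_star_def sym_series_scale_def fps_cnj_def fps_mult_nth sym_cnj_sum
        sym_cnj_mult sym_cnj_const sum_distrib_left)
qed

lemma sym_series_star_const: "sym_series_star (fps_const f) = fps_const (sym_cnj f)"
  by (rule fps_ext) (simp add: sym_series_star_def)

section \<open>Polynomials in \<nu> and their values\<close>

lemma sym_polys_const: "fps_const f \<in> sym_polys"
proof -
  have "{n. fps_const f $ n \<noteq> 0} \<subseteq> {0}" by auto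
  then show ?thesis unfolding sym_polys_def by (simp add: finite_subset)
qed

lemma sym_polys_add:
  assumes "F \<in> sym_polys" "G \<in> sym_polys"
  shows "F + G \<in> sym_polys"
proof -
  have "{n. (F + G) $ n \<noteq> 0} \<subseteq> {n. F $ n \<noteq> 0} \<union> {n. G $ n \<noteq> 0}" by auto
  then show ?thesis using assms unfolding sym_polys_def by (auto intro: finite_subset)
qed

lemma sym_polys_scale: "F \<in> sym_polys \<Longrightarrow> fps_const f * F \<in> sym_polys"
  unfolding sym_polys_def by (auto elim!: rev_finite_subset)

lemma sym_polys_X: "F \<in> sym_polys \<Longrightarrow> fps_X * F \<in> sym_polys"
proof -
  assume "F \<in> sym_polys"
  then have "finite (Suc ` {n. F $ n \<noteq> 0})" by (simp add: sym_polys_def)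
  moreover have "{n. (fps_X * F) $ n \<noteq> 0} \<subseteq> Suc ` {n. F $ n \<noteq> 0}"
  proof
    fix n assume "n \<in> {n. (fps_X * F) $ n \<noteq> 0}"
    then show "n \<in> Suc ` {n. F $ n \<noteq> 0}" by (cases n) auto
  qed
  ultimately show ?thesis
    unfolding sym_polys_def mem_Collect_eq by (rule finite_subset[rotated])
qed

lemma sym_polys_diff: "F \<in> sym_polys \<Longrightarrow> G \<in> sym_polys \<Longrightarrow> F - G \<in> sym_polys"
  using sym_polys_add[OF _ sym_polys_scale[of G "- 1"], of F] by (simp flip: fps_const_neg)

lemma sym_polys_sum: "(\<And>i. i \<in> I \<Longrightarrow> F i \<in> sym_polys) \<Longrightarrow> (\<Sum>i\<in>I. F i) \<in> sym_polys"
  using sym_polys_const[of 0]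
  by (induction I rule: infinite_finite_induct) (auto intro: sym_polys_add)

definition sym_at :: "complex \<Rightarrow> 'g::real_vector sym fps \<Rightarrow> 'g sym" where
  "sym_at \<nu> F = (\<Sum>k | F $ k \<noteq> 0. sym_const (\<nu> ^ k) * F $ k)"

lemma star_at_eq: "star_at br \<nu> a b = sym_at \<nu> (star_prod br (fps_const a) (fps_const b))"
  by (simp add: star_at_def sym_at_def Let_def)

lemma sym_at_superset:
  "finite A \<Longrightarrow> {k. F $ k \<noteq> 0} \<subseteq> A \<Longrightarrow> sym_at \<nu> F = (\<Sum>k\<in>A. sym_const (\<nu> ^ k) * F $ k)"
  unfolding sym_at_def by (intro sum.mono_neutral_left) auto

lemma sym_at_add:
  assumes "F \<in> sym_polys" "G \<in> sym_polys"
  shows "sym_at \<nu> (F + G) = sym_at \<nu> F + sym_at \<nu> G"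
proof -
  let ?A = "{k. F $ k \<noteq> 0} \<union> {k. G $ k \<noteq> 0}"
  have "finite ?A" using assms by (simp add: sym_polys_def)
  moreover have "{k. (F + G) $ k \<noteq> 0} \<subseteq> ?A" by auto
  ultimately show ?thesis by (simp add: sym_at_superset[of ?A] distrib_left sum.distrib)
qed

lemma sym_at_X: "sym_at \<nu> (fps_X * fps_const f) = sym_const \<nu> * f"
  by (subst sym_at_superset[of "{1}"]) auto

context finite_lie_algebra
begin

text \<open>This is the Duflo map before passing to the quotient, so that computations become
  equalities of tensor series and congruences appear only where the relations enter.\<close>

definition theta :: "'g sym fps \<Rightarrow> 'g tens fps" where
  "theta F = Abs_fps (\<lambda>n. sym_tens (duflo_op br F $ n))"

lemma duflo_eq_class: "duflo br F = env_class br (theta F)"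
  by (simp add: duflo_def symmetrization_def theta_def)

lemma theta_add: "theta (F + G) = theta F + theta G"
  by (rule fps_ext) (simp add: theta_def duflo_op_nth duflo_diff_add sum.distrib sym_tens_add)

lemma theta_diff: "theta (F - G) = theta F - theta G"
  using theta_add[of "F - G" G] by (simp add: algebra_simps)

lemma theta_0 [simp]: "theta 0 = 0"
  using theta_diff[of 0 0] by simp

lemma theta_sum: "theta (\<Sum>i\<in>I. F i) = (\<Sum>i\<in>I. theta (F i))"
  by (induction I rule: infinite_finite_induct) (simp_all add: theta_add)

lemma theta_const_mult: "theta (fps_const (sym_const c) * F) = fps_const (tens_const c) * theta F"
  by (rule fps_ext)
    (simp add: theta_def duflo_op_nth duflo_diff_scale sym_tens_scale flip: sum_distrib_left)

lemma theta_X: "theta (fps_X * F) = fps_X * theta F"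
proof (rule fps_ext)
  fix n show "theta (fps_X * F) $ n = (fps_X * theta F) $ n"
  proof (cases n)
    case (Suc m)
    have "(\<Sum>k\<le>m. duflo_diff k ((fps_X * F) $ (Suc m - k))) = (\<Sum>k\<le>m. duflo_diff k (F $ (m - k)))"
      by (intro sum.cong refl) (simp add: Suc_diff_le)
    then show ?thesis by (simp add: Suc theta_def duflo_op_nth)
  qed (simp add: theta_def duflo_op_nth)
qed

lemma theta_X_power: "theta (fps_X ^ k * F) = fps_X ^ k * theta F"
  by (induction k) (simp_all add: mult.assoc theta_X)

lemma theta_const_nth: "theta (fps_const f) $ n = sym_tens (duflo_diff n f)"
proof -
  have "(\<Sum>k\<le>n. duflo_diff k (fps_const f $ (n - k))) = (\<Sum>k\<le>n. if k = n then duflo_diff n f else 0)"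
    by (intro sum.cong refl) auto
  then show ?thesis by (simp add: theta_def duflo_op_nth)
qed

text \<open>The lowest coefficient of F cannot hide: \<open>duflo_diff 0\<close> is the identity, so
  \<open>theta F\<close> starts with its symmetrization, from which \<open>pbw_series\<close>
  recovers it.\<close>

lemma theta_mem_env_ideal:
  assumes "theta F \<in> env_ideal br"
  shows "F = 0"
proof (rule fps_ext)
  fix n show "F $ n = 0 $ n"
  proof (induction n rule: less_induct)
    case (less n)
    have low: "theta F $ m = (if m = n then sym_tens (F $ n) else 0)" if "m \<le> n" for m
    proof -
      have "(\<Sum>k\<le>m. duflo_diff k (F $ (m - k))) = (\<Sum>k\<le>m. if k = 0 \<and> m = n then F $ n else 0)"
        using less that by (intro sum.cong refl) (auto simp: duflo_diff_zero)
      then show ?thesis by (auto simp: theta_def duflo_op_nth)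
    qed
    have "pbw_series (theta F) $ n = (\<Sum>k\<le>n. if k = n then F $ n else 0)"
      unfolding pbw_series_def fps_nth_Abs_fps
      by (intro sum.cong refl) (auto simp: low pbw_sym_tens_nth_0)
    then show ?case using pbw_series_env_ideal[OF assms] by simp
  qed
qed

lemma inj_duflo: "inj (duflo br)"
proof (rule injI)
  fix F G assume "duflo br F = duflo br G"
  then have "theta (F - G) \<in> env_ideal br" by (simp add: duflo_eq_class env_class_eq_iff theta_diff)
  then show "F = G" using theta_mem_env_ideal by fastforce
qed

text \<open>By injectivity, a candidate with the right class is the preimage that
  \<open>inv_into\<close> selects.\<close>

lemma star_prod_eqI:
  assumes "theta F * theta G - theta H \<in> env_ideal br"
  shows "star_prod br F G = H"
proof -
  have "duflo br F \<otimes>\<^bsub>env_alg br\<^esub> duflo br G = duflo br H"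
    using assms by (simp add: duflo_eq_class env_class_mult env_class_eq_iff)
  then show ?thesis by (simp add: star_prod_def inj_duflo)
qed

text \<open>This is the scalar with which the part of order k of J^(1/2)(D) sends X^n to
  X^(n-k).\<close>

definition duflo_weight :: "'g \<Rightarrow> nat \<Rightarrow> nat \<Rightarrow> complex" where
  "duflo_weight X n k = complex_of_real (duflo_J_sqrt br X $ k * fact n / fact (n - k))"

lemma theta_lin_power:
  "theta (fps_const (sym_lin (X, 0) ^ n)) =
    (\<Sum>k\<le>n. fps_X ^ k * (fps_const (tens_const (duflo_weight X n k)) * fps_const (tens_lin (X, 0) ^ (n - k))))"
proof (rule fps_ext)
  fix m
  have "(\<Sum>k\<le>n. (fps_X ^ k * (fps_const (tens_const (duflo_weight X n k)) *
      fps_const (tens_lin (X, 0) ^ (n - k)))) $ m) =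
    (\<Sum>k\<le>n. if k = m then tens_const (duflo_weight X n m) * tens_lin (X, 0) ^ (n - m) else 0)"
    by (intro sum.cong refl) (auto simp: fps_X_power_mult_nth)
  then show "theta (fps_const (sym_lin (X, 0) ^ n)) $ m = (\<Sum>k\<le>n. fps_X ^ k *
      (fps_const (tens_const (duflo_weight X n k)) * fps_const (tens_lin (X, 0) ^ (n - k)))) $ m"
    by (auto simp: fps_sum_nth theta_const_nth duflo_diff_power sym_tens_scale sym_tens_power duflo_weight_def)
qed

lemma duflo_weight_0: "duflo_weight X n 0 = 1"
  by (simp add: duflo_weight_def duflo_J_sqrt_nth_0)

lemma duflo_weight_odd: "odd k \<Longrightarrow> duflo_weight X n k = 0"
  by (simp add: duflo_weight_def duflo_J_sqrt_odd)

text \<open>J^(1/2) has constant term \<open>1\<close> and no term of order one, and derivatives of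
  higher order kill linear elements.\<close>

lemma theta_lin: "theta (fps_const (sym_lin z)) = fps_const (tens_lin z)"
proof -
  have real: "theta (fps_const (sym_lin (X, 0))) = fps_const (tens_lin (X, 0))" for X
    using theta_lin_power[of X 1] by (simp add: duflo_weight_0 duflo_weight_odd)
  have z: "z = (fst z, 0) + cx_scale \<i> (snd z, 0)"
    by (simp add: cx_scale_def prod_eq_iff)
  show ?thesis
    by (subst (1 2) z)
      (simp add: sym_lin_add sym_lin_scale tens_lin_add tens_lin_scale theta_add theta_const_mult real
        flip: fps_const_add fps_const_mult)
qed

text \<open>\<open>star_power X n\<close> is the \<open>n\<close>-th power of \<open>X\<close> for the star product; the recursion inverts the
  unitriangular relation \<open>theta_lin_power\<close>.\<close>

fun star_power :: "'g \<Rightarrow> nat \<Rightarrow> 'g sym fps" where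
  "star_power X n = fps_const (sym_lin (X, 0) ^ n) -
     (\<Sum>k\<in>{1..n}. sym_series_scale (fps_X ^ k * fps_const (duflo_weight X n k)) (star_power X (n - k)))"

declare star_power.simps [simp del]

lemma scale_weight:
  "sym_series_scale (fps_X ^ k * fps_const c) F = fps_X ^ k * (fps_const (sym_const c) * F)"
  by (simp add: sym_series_scale_eq sym_of_series_mult sym_of_series_power sym_of_series_X
      sym_of_series_const mult.assoc)

text \<open>The recursion solves \<open>theta_lin_power\<close> for its term k = 0, so equality
  holds among tensor series, before the relations are imposed.\<close>

lemma theta_star_power: "theta (star_power X n) = fps_const (tens_lin (X, 0) ^ n)"
proof (induction n rule: less_induct)
  case (less n)
  let ?t = "\<lambda>k. fps_X ^ k * (fps_const (tens_const (duflo_weight X n k)) * fps_const (tens_lin (X, 0) ^ (n - k)))"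
  have "theta (star_power X n) = theta (fps_const (sym_lin (X, 0) ^ n)) - (\<Sum>k\<in>{1..n}. ?t k)"
    unfolding star_power.simps[of X n] theta_diff theta_sum
    using less by (intro arg_cong2[of _ _ _ _ "(-)"] sum.cong refl)
      (simp add: scale_weight theta_X_power theta_const_mult del: fps_const_mult)
  also have "\<dots> = ?t 0"
  proof -
    have "{..n} = insert 0 {1..n}" by auto
    then show ?thesis unfolding theta_lin_power by simp
  qed
  finally show ?case by (simp add: duflo_weight_0)
qed

lemma star_power_sym_polys: "star_power X n \<in> sym_polys"
proof (induction n rule: less_induct)
  case (less n)
  have X: "fps_X ^ k * F \<in> sym_polys" if "F \<in> sym_polys" for k and F :: "'g sym fps"
    using that by (induction k) (simp_all add: mult.assoc sym_polys_X)
  show ?case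
    unfolding star_power.simps[of X n] scale_weight
    by (intro sym_polys_diff sym_polys_const sym_polys_sum X sym_polys_scale less) auto
qed

text \<open>Only even orders k carry weight and the weights are real, so the coefficients of the
  recursion are fixed by the conjugation that sends \<nu> to -\<nu>.\<close>

lemma star_star_power: "sym_series_star (star_power X n) = star_power X n"
proof (induction n rule: less_induct)
  case (less n)
  have "fps_cnj (fps_X ^ k * fps_const (duflo_weight X n k)) = fps_X ^ k * fps_const (duflo_weight X n k)" for k
  proof (cases "even k")
    case True
    have "cnj (duflo_weight X n k) = duflo_weight X n k" by (simp add: duflo_weight_def)
    then show ?thesis using True
      by (intro fps_ext) (auto simp: fps_cnj_def fps_X_power_mult_nth)
  qed (simp add: duflo_weight_odd fps_cnj_def fps_eq_iff)
  then have "sym_series_star (sym_series_scale (fps_X ^ k * fps_const (duflo_weight X n k)) (star_power X (n - k)))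
      = sym_series_scale (fps_X ^ k * fps_const (duflo_weight X n k)) (star_power X (n - k))"
    if "k \<in> {1..n}" for k
    using less[of "n - k"] that by (simp add: sym_series_star_scale)
  then show ?case
    by (subst (1 2) star_power.simps)
      (simp add: sym_series_star_diff sym_series_star_sum sym_series_star_const sym_cnj_power sym_cnj_lin_real)
qed

lemma star_power_0: "star_power X 0 = 1"
  by (subst star_power.simps) simp

text \<open>The recursion read backwards carries statements about star powers over to ordinary
  powers.\<close>

lemma lin_power_eq_star_powers:
  "fps_const (sym_lin (X, 0) ^ n) =
    (\<Sum>k\<le>n. sym_series_scale (fps_X ^ k * fps_const (duflo_weight X n k)) (star_power X (n - k)))"
proof -
  let ?t = "\<lambda>k. sym_series_scale (fps_X ^ k * fps_const (duflo_weight X n k)) (star_power X (n - k))"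
  have "{..n} = insert 0 {1..n}" by auto
  moreover have "?t 0 = star_power X n"
    by (simp add: duflo_weight_0 sym_series_scale_eq)
  ultimately have "(\<Sum>k\<le>n. ?t k) = star_power X n + (\<Sum>k\<in>{1..n}. ?t k)"
    using sum.insert[of "{1..n}" 0 ?t] by (simp only: finite_atLeastAtMost) simp
  also have "\<dots> = fps_const (sym_lin (X, 0) ^ n)"
    by (subst star_power.simps[of X n]) (simp only: diff_add_cancel)
  finally show ?thesis by (rule sym)
qed

text \<open>A tensor commutes with its own powers, so both orders give the same result; taking
  adjoints exchanges the two orders.\<close>

lemma star_prod_star_power:
  shows star_prod_lin_star_power: "star_prod br (fps_const (sym_lin (X, 0))) (star_power X n) = star_power X (Suc n)"
    and star_prod_star_power_lin: "star_prod br (star_power X n) (fps_const (sym_lin (X, 0))) = star_power X (Suc n)"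
  by (rule star_prod_eqI; simp add: theta_star_power theta_lin env_ideal_0 power_commutes)+

text \<open>The commutator is covered by a relation of the ideal, and the symmetric part by
  polarizing squares, which are star powers. Finiteness in \<nu> matters because
  \<open>star_at\<close> sums over the support, and a sum over an infinite set is \<open>0\<close>
  by convention.\<close>

lemma lin_lin_representable:
  "\<exists>F\<in>sym_polys. theta F - fps_const (tens_lin z * tens_lin w) \<in> env_ideal br"
proof -
  define P where "P t \<longleftrightarrow> (\<exists>F\<in>sym_polys. theta F - fps_const t \<in> env_ideal br)" for t :: "'g tens"
  have add: "P (s + t)" if "P s" "P t" for s t
  proof -
    obtain F where "F \<in> sym_polys" "theta F - fps_const s \<in> env_ideal br"
      using \<open>P s\<close> unfolding P_def by (elim bexE)
    moreover obtain G where "G \<in> sym_polys" "theta G - fps_const t \<in> env_ideal br"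
      using \<open>P t\<close> unfolding P_def by (elim bexE)
    moreover have "theta (F + G) - fps_const (s + t) = (theta F - fps_const s) + (theta G - fps_const t)"
      by (simp add: theta_add flip: fps_const_add)
    ultimately show ?thesis
      unfolding P_def by (intro bexI[of _ "F + G"]) (auto intro: env_ideal_add sym_polys_add)
  qed
  have scale: "P (tens_const c * t)" if "P t" for c t
  proof -
    obtain F where "F \<in> sym_polys" "theta F - fps_const t \<in> env_ideal br"
      using \<open>P t\<close> unfolding P_def by (elim bexE)
    moreover have "theta (fps_const (sym_const c) * F) - fps_const (tens_const c * t) =
        fps_const (tens_const c) * (theta F - fps_const t)"
      by (simp add: theta_const_mult right_diff_distrib)
    ultimately show ?thesis
      unfolding P_def
      by (intro bexI[of _ "fps_const (sym_const c) * F"]) (auto intro: env_ideal_mult_left sym_polys_scale)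
  qed
  have square: "P (tens_lin (X, 0) ^ 2)" for X
    unfolding P_def
    by (intro bexI[of _ "star_power X 2"]) (simp_all add: theta_star_power env_ideal_0 star_power_sym_polys)
  have comm: "P (tens_lin z * tens_lin w - tens_lin w * tens_lin z)" for z w
  proof -
    have "theta (fps_X * fps_const (sym_lin (cx_bracket br z w))) -
        fps_const (tens_lin z * tens_lin w - tens_lin w * tens_lin z) \<in> env_ideal br"
      using env_ideal_uminus[OF env_relation_mem[of z w br]] by (simp add: theta_X theta_lin)
    then show ?thesis unfolding P_def by (rule bexI[OF _ sym_polys_X[OF sym_polys_const]])
  qed
  have real: "P (tens_lin (X, 0) * tens_lin (Y, 0))" for X Y
  proof -
    let ?X = "tens_lin (X, 0)" and ?Y = "tens_lin (Y, 0)"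
    have XY: "tens_lin (X + Y, 0) = ?X + ?Y" by (simp flip: tens_lin_add)
    \<comment> \<open>X Y is half of (X + Y)^2 - X^2 - Y^2 + (X Y - Y X), which holds already in the
      tensor algebra.\<close>
    have "P (tens_const (1/2) * (tens_lin (X + Y, 0) ^ 2 + tens_const (- 1) * ?X ^ 2 + tens_const (- 1) * ?Y ^ 2
        + (?X * ?Y - ?Y * ?X)))"
      by (intro scale add square comm)
    also have "tens_lin (X + Y, 0) ^ 2 + tens_const (- 1) * ?X ^ 2 + tens_const (- 1) * ?Y ^ 2
        + (?X * ?Y - ?Y * ?X) = ?X * ?Y + ?X * ?Y"
      by (simp add: XY power2_eq_square algebra_simps tens_const_uminus)
    also have "tens_const (1/2) * (?X * ?Y + ?X * ?Y) = tens_const (1/2 + 1/2) * (?X * ?Y)"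
      by (simp only: tens_const_add distrib_left distrib_right)
    finally show ?thesis by simp
  qed
  have split: "z = (fst z, 0) + cx_scale \<i> (snd z, 0)" for z :: "'g \<times> 'g"
    by (simp add: cx_scale_def prod_eq_iff)
  have "P (tens_lin (X, 0) * tens_lin w)" for X
    by (subst split) (auto simp: tens_lin_add tens_lin_scale distrib_left tens_const_left_commute
        intro: add scale real)
  then have "P (tens_lin z * tens_lin w)"
    by (subst split) (auto simp: tens_lin_add tens_lin_scale distrib_right mult.assoc intro: add scale)
  then show ?thesis by (simp add: P_def)
qed

lemma star_prod_lin_lin:
  assumes "theta F - fps_const (tens_lin z * tens_lin w) \<in> env_ideal br"
  shows "star_prod br (fps_const (sym_lin z)) (fps_const (sym_lin w)) = F"
  by (rule star_prod_eqI) (use env_ideal_uminus[OF assms] in \<open>simp add: theta_lin\<close>)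

text \<open>Injectivity lifts the defining relation from the quotient to an equality of series, and
  polynomiality in \<nu> permits evaluation term by term.\<close>

lemma star_at_commutator:
  "star_at br \<nu> (sym_lin z) (sym_lin w) =
    star_at br \<nu> (sym_lin w) (sym_lin z) + sym_const \<nu> * sym_lin (cx_bracket br z w)"
proof -
  let ?B = "fps_X * fps_const (sym_lin (cx_bracket br z w))"
  obtain F G where F: "F \<in> sym_polys" "theta F - fps_const (tens_lin z * tens_lin w) \<in> env_ideal br"
    and G: "G \<in> sym_polys" "theta G - fps_const (tens_lin w * tens_lin z) \<in> env_ideal br"
    using lin_lin_representable by meson
  have "theta (F - G - ?B) = (theta F - fps_const (tens_lin z * tens_lin w)) -
      (theta G - fps_const (tens_lin w * tens_lin z)) +
      (fps_const (tens_lin z * tens_lin w - tens_lin w * tens_lin z) -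
        fps_X * fps_const (tens_lin (cx_bracket br z w)))"
    by (simp add: theta_diff theta_X theta_lin flip: fps_const_sub)
  also have "\<dots> \<in> env_ideal br"
    by (intro env_ideal_add env_ideal_diff F G env_relation_mem)
  finally have "F - G - ?B = 0" by (rule theta_mem_env_ideal)
  then have "F = G + ?B" by (simp add: algebra_simps)
  then show ?thesis
    using G(1) by (simp add: star_at_eq star_prod_lin_lin[OF F(2)] star_prod_lin_lin[OF G(2)]
        sym_at_add sym_polys_X sym_polys_const sym_at_X)
qed

end

section \<open>The extended scalar product\<close>

lemma fps_cnj_mult: "fps_cnj (a * b) = fps_cnj a * fps_cnj b"
proof (rule fps_ext)
  fix n
  have "(- 1) ^ n * (cnj (a $ i) * cnj (b $ (n - i))) =
      (- 1) ^ i * cnj (a $ i) * ((- 1) ^ (n - i) * cnj (b $ (n - i)))" if "i \<le> n" for i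
  proof -
    have "(- 1 :: complex) ^ n = (- 1) ^ i * (- 1) ^ (n - i)" using that by (simp flip: power_add)
    then show ?thesis by (simp add: mult_ac)
  qed
  then show "fps_cnj (a * b) $ n = (fps_cnj a * fps_cnj b) $ n"
    unfolding fps_cnj_def fps_mult_nth fps_nth_Abs_fps cnj_sum sum_distrib_left complex_cnj_mult
    by (intro sum.cong refl) simp
qed

lemma fps_cnj_fps_cnj [simp]: "fps_cnj (fps_cnj a) = a"
  by (rule fps_ext) (simp add: fps_cnj_def mult.assoc[symmetric] flip: power_mult_distrib)

lemma fps_cnj_X: "fps_cnj fps_X = - fps_X"
  by (rule fps_ext) (simp add: fps_cnj_def fps_X_def)

locale scalar_product = vector_space smul
  for smul :: "complex \<Rightarrow> 'm::ab_group_add \<Rightarrow> 'm" +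
  fixes ip :: "'m \<Rightarrow> 'm \<Rightarrow> complex"
  assumes ip_add_left: "ip (u + v) w = ip u w + ip v w"
    and ip_scale_left: "ip (smul c u) v = c * ip u v"
    and ip_herm: "ip v u = cnj (ip u v)"
    and ip_pos: "u \<noteq> 0 \<Longrightarrow> Re (ip u u) > 0"
begin

lemma ip_add_right: "ip u (v + w) = ip u v + ip u w"
  by (subst (1 2 3) ip_herm) (simp add: ip_add_left)

lemma ip_scale_right: "ip u (smul c v) = cnj c * ip u v"
  by (subst (1 2) ip_herm) (simp add: ip_scale_left)

lemma ip_0_left [simp]: "ip 0 v = 0"
  using ip_add_left[of 0 0 v] by simp

lemma ip_0_right [simp]: "ip u 0 = 0"
  using ip_add_right[of u 0 0] by simp

lemma ip_diff_left: "ip (u - v) w = ip u w - ip v w"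
  using ip_add_left[of "u - v" v w] by simp

lemma ip_sum_left: "ip (\<Sum>i\<in>I. f i) v = (\<Sum>i\<in>I. ip (f i) v)"
  by (induction I rule: infinite_finite_induct) (simp_all add: ip_add_left)

lemma ip_nondegenerate: "(\<And>v. ip u v = 0) \<Longrightarrow> u = 0"
  using ip_pos[of u] by force

abbreviation B :: "'m fps \<Rightarrow> 'm fps \<Rightarrow> complex fps" where
  "B \<equiv> form_ext ip"

lemma B_nth: "B u v $ n = (\<Sum>l\<le>n. (- 1) ^ l * ip (u $ (n - l)) (v $ l))"
  by (simp add: form_ext_def)

lemma B_add_left: "B (u + v) w = B u w + B v w"
  by (rule fps_ext) (simp add: B_nth ip_add_left distrib_left sum.distrib)

lemma B_add_right: "B u (v + w) = B u v + B u w"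
  by (rule fps_ext) (simp add: B_nth ip_add_right distrib_left sum.distrib)

lemma B_herm: "B v u = fps_cnj (B u v)"
proof (rule fps_ext)
  fix n
  have "B v u $ n = (\<Sum>l\<le>n. (- 1) ^ (n - l) * ip (v $ l) (u $ (n - l)))"
    unfolding B_nth by (rule sum.reindex_bij_witness[of _ "\<lambda>l. n - l" "\<lambda>l. n - l"]) auto
  also have "\<dots> = (\<Sum>l\<le>n. (- 1) ^ n * ((- 1) ^ l * cnj (ip (u $ (n - l)) (v $ l))))"
  proof (rule sum.cong[OF refl])
    fix l assume "l \<in> {..n}"
    then have "(- 1 :: complex) ^ (n - l) = (- 1) ^ n * (- 1) ^ l"
      by (auto simp: uminus_power_if)
    then show "(- 1) ^ (n - l) * ip (v $ l) (u $ (n - l)) =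
        (- 1) ^ n * ((- 1) ^ l * cnj (ip (u $ (n - l)) (v $ l)))"
      using ip_herm[of "v $ l" "u $ (n - l)"] by simp
  qed
  also have "\<dots> = fps_cnj (B u v) $ n"
    by (simp add: fps_cnj_def B_nth sum_distrib_left)
  finally show "B v u $ n = fps_cnj (B u v) $ n" .
qed

lemma B_scale_left: "B (series_scale smul c u) v = c * B u v"
proof (rule fps_ext)
  fix n
  let ?h = "\<lambda>l i. c $ i * ((- 1) ^ l * ip (u $ (n - l - i)) (v $ l))"
  have "B (series_scale smul c u) v $ n = (\<Sum>l\<le>n. \<Sum>i\<le>n - l. ?h l i)"
    by (simp add: B_nth series_scale_def ip_sum_left ip_scale_left sum_distrib_left mult.left_commute)
  also have "\<dots> = (\<Sum>i\<le>n. \<Sum>l\<le>n - i. ?h l i)"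
    unfolding sum.Sigma[OF finite_atMost ballI[OF finite_atMost]]
    by (rule sum.reindex_bij_witness[of _ "\<lambda>(i, k). (k, i)" "\<lambda>(i, k). (k, i)"]) auto
  also have "\<dots> = (c * B u v) $ n"
    by (simp add: fps_mult_nth B_nth sum_distrib_left atLeast0AtMost diff_commute add.commute)
  finally show "B (series_scale smul c u) v $ n = (c * B u v) $ n" .
qed

lemma B_scale_right: "B u (series_scale smul c v) = fps_cnj c * B u v"
  by (subst (1 2) B_herm) (simp add: B_scale_left fps_cnj_mult)

lemma hermitian_form_B: "hermitian_form smul B"
  unfolding hermitian_form_def using B_add_left B_scale_left B_herm by blast

lemma B_const_right: "B u (fps_const v) $ n = ip (u $ n) v"
proof -
  have "B u (fps_const v) $ n = (\<Sum>l\<le>n. if l = 0 then ip (u $ n) v else 0)"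
    unfolding B_nth by (intro sum.cong refl) auto
  then show ?thesis by simp
qed

lemma B_const_left: "B (fps_const u) v $ n = (- 1) ^ n * ip u (v $ n)"
proof -
  have "B (fps_const u) v $ n = (\<Sum>l\<le>n. if l = n then (- 1) ^ n * ip u (v $ n) else 0)"
    unfolding B_nth by (intro sum.cong refl) auto
  then show ?thesis by simp
qed

lemma B_nondegenerate: "(\<And>v. B u v = 0) \<Longrightarrow> u = 0"
  by (intro fps_ext) (metis B_const_right fps_zero_nth ip_nondegenerate)

text \<open>Reality of the coefficients is hermitian symmetry. If u starts with u_n \<nu>^n, the
  form starts at order 2n with (-1)^n <u_n, u_n>, and \<i>^(2n) cancels the sign.\<close>

lemma fps_pos_B:
  assumes "u \<noteq> 0"
  shows "fps_pos (B u u)"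
  unfolding fps_pos_def
proof
  show "\<forall>k. \<i> ^ k * B u u $ k \<in> \<real>"
  proof
    fix k
    have "B u u $ k = (- 1) ^ k * cnj (B u u $ k)"
      using B_herm[of u u] by (metis fps_cnj_def fps_nth_Abs_fps)
    then have "\<i> ^ k * B u u $ k = (\<i> * - 1) ^ k * cnj (B u u $ k)"
      by (metis mult.assoc power_mult_distrib)
    then have "\<i> ^ k * B u u $ k = cnj (\<i> ^ k * B u u $ k)" by simp
    then show "\<i> ^ k * B u u $ k \<in> \<real>" by (simp add: Reals_cnj_iff)
  qed
  define n where "n = (LEAST n. u $ n \<noteq> 0)"
  have "\<exists>n. u $ n \<noteq> 0" using assms by (auto simp: fps_eq_iff)
  then have n: "u $ n \<noteq> 0" unfolding n_def by (rule LeastI_ex)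
  have low: "u $ k = 0" if "k < n" for k
    using not_less_Least[of k "\<lambda>n. u $ n \<noteq> 0"] that unfolding n_def by blast
  \<comment> \<open>Unless l = n, one of the two indices lies below n.\<close>
  have "B u u $ (2 * n) = (\<Sum>l\<le>2 * n. if l = n then (- 1) ^ n * ip (u $ n) (u $ n) else 0)"
    unfolding B_nth
  proof (rule sum.cong[OF refl])
    fix l assume "l \<in> {..2 * n}"
    then consider "l < n" | "2 * n - l < n" | "l = n" by (cases l n rule: linorder_cases) auto
    then show "(- 1) ^ l * ip (u $ (2 * n - l)) (u $ l) =
        (if l = n then (- 1) ^ n * ip (u $ n) (u $ n) else 0)"
      by cases (auto simp: low mult_2)
  qed
  then have "\<i> ^ (2 * n) * B u u $ (2 * n) = ip (u $ n) (u $ n)"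
    by (simp add: power_mult mult.assoc[symmetric] flip: power_mult_distrib)
  moreover have "B u u $ k = 0" if "k < 2 * n" for k
    unfolding B_nth
  proof (rule sum.neutral, rule ballI)
    fix l assume "l \<in> {..k}"
    then have "l < n \<or> k - l < n" using that by auto
    then show "(- 1) ^ l * ip (u $ (k - l)) (u $ l) = 0" by (auto simp: low)
  qed
  ultimately show "\<exists>n. Re (\<i> ^ n * B u u $ n) > 0 \<and> (\<forall>k<n. B u u $ k = 0)"
    using ip_pos[OF n] by (intro exI[of _ "2 * n"]) auto
qed

lemma series_scale_X: "series_scale smul fps_X u $ n = (if n = 0 then 0 else u $ (n - 1))"
proof -
  have "(\<Sum>i\<le>n. smul (fps_X $ i) (u $ (n - i))) = (\<Sum>i\<le>n. if i = 1 then u $ (n - 1) else 0)"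
    by (intro sum.cong refl) (auto simp: fps_X_def)
  then show ?thesis by (cases n) (auto simp: series_scale_def)
qed

lemma series_decompose: "u = fps_const (u $ 0) + series_scale smul fps_X (Abs_fps (\<lambda>n. u $ Suc n))"
  by (rule fps_ext) (simp add: series_scale_X)

lemma B_reduction_nondegenerate:
  assumes "\<And>v. B u v $ 0 = 0"
  shows "u \<in> range (series_scale smul fps_X)"
proof -
  have "ip (u $ 0) v = 0" for v
    using assms[of "fps_const v"] by (simp only: B_const_right)
  then have "u $ 0 = 0" by (rule ip_nondegenerate)
  then show ?thesis using series_decompose[of u] by (metis add_0 fps_const_0_eq_0 rangeI)
qed

text \<open>The scalar \<open>s\<close> is \<open>1\<close> for maps linear over \<nu> and
  \<open>- 1\<close> for antilinear ones, because \<nu> is conjugated to -\<nu>.\<close>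

lemma series_linear_eq_0:
  fixes T :: "'m fps \<Rightarrow> complex fps"
  assumes add: "\<And>u v. T (u + v) = T u + T v"
    and X: "\<And>u. T (series_scale smul fps_X u) = fps_const s * fps_X * T u"
    and const: "\<And>u. T (fps_const u) = 0"
  shows "T u = 0"
proof -
  have step: "T u = fps_const s * (fps_X * T (Abs_fps (\<lambda>n. u $ Suc n)))" for u
    by (subst series_decompose[of u]) (simp only: add X const add_0 mult.assoc)
  have "T u $ n = 0" for n
  proof (induction n arbitrary: u)
    case 0
    then show ?case by (subst step) simp
  next
    case (Suc n)
    then show ?case by (subst step) simp
  qed
  then show ?thesis by (simp add: fps_eq_iff)
qed

end

section \<open>Unitary modules\<close>

locale duflo_module = finite_lie_algebra br + scalar_product smul ip
  for br :: "'g::real_vector \<Rightarrow> 'g \<Rightarrow> 'g"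
    and smul :: "complex \<Rightarrow> 'm::ab_group_add \<Rightarrow> 'm" and ip +
  fixes \<pi> :: "'g sym fps \<Rightarrow> 'm fps \<Rightarrow> 'm fps"
  assumes top_free: "top_free_module br smul \<pi>"
begin

lemma module_add_left: "\<pi> (F + G) u = \<pi> F u + \<pi> G u"
  and module_add_right: "\<pi> F (u + v) = \<pi> F u + \<pi> F v"
  and module_scale_left: "\<pi> (sym_series_scale c F) u = series_scale smul c (\<pi> F u)"
  and module_scale_right: "\<pi> F (series_scale smul c u) = series_scale smul c (\<pi> F u)"
  and module_one: "\<pi> 1 u = u"
  and module_star: "\<pi> (star_prod br F G) u = \<pi> F (\<pi> G u)"
  using top_free unfolding top_free_module_def by blast+

text \<open>This isolates the adjointness clause of \<open>unitary_module\<close> for a single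
  element. For a real X, which the involution fixes, it says that X acts symmetrically.\<close>

definition selfadjoint :: "'g sym fps \<Rightarrow> bool" where
  "selfadjoint F \<longleftrightarrow> (\<forall>u v. B (\<pi> F u) v = B u (\<pi> (sym_series_star F) v))"

lemma selfadjointD: "selfadjoint F \<Longrightarrow> B (\<pi> F u) v = B u (\<pi> (sym_series_star F) v)"
  by (simp add: selfadjoint_def)

text \<open>Both sides are \<nu>-linear in u and \<nu>-antilinear in v, so agreement on constant
  series propagates.\<close>

lemma selfadjointI_const:
  assumes "\<And>u v. B (\<pi> F (fps_const u)) (fps_const v) = B (fps_const u) (\<pi> (sym_series_star F) (fps_const v))"
  shows "selfadjoint F"
proof -
  let ?T = "\<lambda>u v. B (\<pi> F u) v - B u (\<pi> (sym_series_star F) v)"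
  have left: "?T u (fps_const v) = 0" for u v
    by (rule series_linear_eq_0[where T = "\<lambda>u. ?T u (fps_const v)" and s = 1])
      (simp_all add: module_add_right B_add_left module_scale_right B_scale_left assms algebra_simps)
  have "?T u v = 0" for u v
    by (rule series_linear_eq_0[where T = "?T u" and s = "- 1"])
      (simp_all add: left module_add_right B_add_right module_scale_right B_scale_right fps_cnj_X
        algebra_simps flip: fps_const_neg)
  then show ?thesis by (simp add: selfadjoint_def)
qed

lemma selfadjoint_add: "selfadjoint F \<Longrightarrow> selfadjoint G \<Longrightarrow> selfadjoint (F + G)"
  by (simp add: selfadjoint_def module_add_left B_add_left B_add_right sym_series_star_add)

lemma selfadjoint_scale: "selfadjoint F \<Longrightarrow> selfadjoint (sym_series_scale c F)"
  by (simp add: selfadjoint_def module_scale_left sym_series_star_scale B_scale_left B_scale_right)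

lemma selfadjoint_sum: "(\<And>i. i \<in> I \<Longrightarrow> selfadjoint (F i)) \<Longrightarrow> selfadjoint (\<Sum>i\<in>I. F i)"
proof -
  have "selfadjoint 0"
    using module_add_left[of 0 0] B_add_left[of 0 0] B_add_right[of _ 0 0] by (simp add: selfadjoint_def)
  then show "(\<And>i. i \<in> I \<Longrightarrow> selfadjoint (F i)) \<Longrightarrow> selfadjoint (\<Sum>i\<in>I. F i)"
    by (induction I rule: infinite_finite_induct) (auto intro: selfadjoint_add)
qed

text \<open>The adjoint reverses the product of X with its star power, and the reversed product is
  the same next star power.\<close>

lemma selfadjoint_star_power:
  assumes "selfadjoint (fps_const (sym_lin (X, 0)))"
  shows "selfadjoint (star_power X n)"
proof (induction n)
  case 0
  have "sym_series_star (1 :: 'g sym fps) = 1"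
    using sym_series_star_const[of 1] by simp
  then show ?case by (simp add: star_power_0 selfadjoint_def module_one)
next
  case (Suc n)
  let ?X = "fps_const (sym_lin (X, 0))"
  have X: "sym_series_star ?X = ?X" by (simp add: sym_series_star_const sym_cnj_lin_real)
  have "B (\<pi> (star_power X (Suc n)) u) v = B u (\<pi> (star_power X (Suc n)) v)" for u v
  proof -
    have "B (\<pi> (star_power X (Suc n)) u) v = B (\<pi> ?X (\<pi> (star_power X n) u)) v"
      by (simp flip: star_prod_lin_star_power module_star)
    also have "\<dots> = B u (\<pi> (star_power X n) (\<pi> ?X v))"
      by (simp add: selfadjointD[OF assms] selfadjointD[OF Suc] X star_star_power)
    also have "\<dots> = B u (\<pi> (star_power X (Suc n)) v)"
      by (simp flip: star_prod_star_power_lin module_star)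
    finally show ?thesis .
  qed
  then show ?case by (simp add: selfadjoint_def star_star_power)
qed

text \<open>Combinations of star powers give all constant series. Multiplication by \<nu> is
  compatible because the involution and the antilinear argument of the form each contribute a
  sign.\<close>

lemma selfadjoint_all:
  assumes gen: "\<And>X. selfadjoint (fps_const (sym_lin (X, 0)))"
  shows "selfadjoint F"
proof -
  have const: "selfadjoint (fps_const f)" for f
  proof (induction f rule: sym_power_induct)
    case (power X n)
    show ?case
      unfolding lin_power_eq_star_powers
      by (intro selfadjoint_sum selfadjoint_scale selfadjoint_star_power gen)
  next
    case (scale c f)
    then show ?case
      using selfadjoint_scale[of "fps_const f" "fps_const c"]
      by (simp add: sym_series_scale_eq sym_of_series_const)
  qed (auto simp flip: fps_const_add intro: selfadjoint_add)
  have "B (\<pi> F u) v - B u (\<pi> (sym_series_star F) v) = 0" for u v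
  proof (rule fps_linear_eq_0[where T = "\<lambda>F. B (\<pi> F u) v - B u (\<pi> (sym_series_star F) v)"])
    fix F :: "'g sym fps"
    have "fps_X * F = sym_series_scale fps_X F" by (simp add: sym_series_scale_eq sym_of_series_X)
    then show "B (\<pi> (fps_X * F) u) v - B u (\<pi> (sym_series_star (fps_X * F)) v) =
        fps_X * (B (\<pi> F u) v - B u (\<pi> (sym_series_star F) v))"
      by (simp add: module_scale_left sym_series_star_scale B_scale_left B_scale_right right_diff_distrib)
  qed (simp_all add: module_add_left B_add_left sym_series_star_add B_add_right selfadjointD[OF const])
  then show ?thesis by (simp add: selfadjoint_def)
qed

text \<open>The remaining clauses of strong unitarity hold for the extension of any scalar product,
  so adjointness on the real generators carries all the information.\<close>

lemma strongly_unitary_iff: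
  "strongly_unitary_module smul \<pi> B \<longleftrightarrow> (\<forall>X. selfadjoint (fps_const (sym_lin (X, 0))))"
proof
  assume "strongly_unitary_module smul \<pi> B"
  then show "\<forall>X. selfadjoint (fps_const (sym_lin (X, 0)))"
    by (simp add: strongly_unitary_module_def unitary_module_def selfadjoint_def)
next
  assume gen: "\<forall>X. selfadjoint (fps_const (sym_lin (X, 0)))"
  have "B (\<pi> F u) v = B u (\<pi> (sym_series_star F) v)" for F u v
    by (rule selfadjointD[OF selfadjoint_all[OF gen[rule_format]]])
  then show "strongly_unitary_module smul \<pi> B"
    unfolding strongly_unitary_module_def unitary_module_def
    by (intro conjI allI impI hermitian_form_B fps_pos_B)
      (simp_all add: B_nondegenerate B_reduction_nondegenerate)
qed

end

section \<open>Specialization at a value of \<open>\<nu>\<close>\<close>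

text \<open>The given zeros accumulate at the origin, whereas the zeros of a nonzero power series
  are isolated.\<close>

lemma powser_zero_on_imaginary_axis:
  fixes d :: "nat \<Rightarrow> complex"
  assumes "R > 0" and sums: "\<And>\<nu>. norm \<nu> < R \<Longrightarrow> (\<lambda>k. d k * \<nu> ^ k) sums f \<nu>"
    and zero: "\<And>h::real. \<bar>h\<bar> < R \<Longrightarrow> f (\<i> * of_real h) = 0"
  shows "d k = 0"
proof (rule ccontr)
  assume "d k \<noteq> 0"
  have f0: "f 0 = 0" using zero[of 0] \<open>R > 0\<close> by simp
  moreover have "d 0 = f 0"
    using sums_unique2[OF sums[of 0] powser_sums_zero[of d]] \<open>R > 0\<close> by simp
  ultimately have "k > 0" using \<open>d k \<noteq> 0\<close> by (cases k) auto
  obtain s where s: "0 < s" "\<And>z. z \<in> cball 0 s - {0} \<Longrightarrow> f z \<noteq> 0"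
    using powser_0_nonzero[of R 0 d f k] \<open>R > 0\<close> sums f0 \<open>d k \<noteq> 0\<close> \<open>k > 0\<close> by auto
  define h where "h = min s (R / 2)"
  have "h > 0" "h \<le> s" "h < R" using s(1) \<open>R > 0\<close> by (auto simp: h_def)
  then have "f (\<i> * of_real h) \<noteq> 0" by (intro s(2)) (auto simp: norm_mult)
  then show False using zero[of h] \<open>h > 0\<close> \<open>h < R\<close> by simp
qed

locale convergent_duflo_module = duflo_module br smul ip \<pi>
  for br :: "'g::real_vector \<Rightarrow> 'g \<Rightarrow> 'g"
    and smul :: "complex \<Rightarrow> 'm::{topological_ab_group_add, t2_space} \<Rightarrow> 'm" and ip and \<pi> +
  fixes R :: real
  assumes R_pos: "R > 0" and pre_hilbert: "pre_hilbert smul ip"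
    and convergent: "weakly_convergent smul \<pi> R"
    and rep: "\<And>\<nu>. \<nu> \<in> ball 0 R \<Longrightarrow> algebra_rep (star_at br \<nu>) smul (rep_at smul \<pi> \<nu>)"
begin

section \<open>Weak sums paired with the scalar product\<close>

lemma ip_top_dual: "(\<lambda>u. ip u v) \<in> top_dual smul"
proof -
  have "continuous_on UNIV (\<lambda>u. ip u v)"
    using pre_hilbert unfolding pre_hilbert_def by blast
  moreover have "Vector_Spaces.linear smul (*) (\<lambda>u. ip u v)"
    unfolding Vector_Spaces.linear_iff
    by (intro conjI allI vector_space_axioms vector_space_over_itself.vector_space_axioms
        ip_add_left ip_scale_left)
  ultimately show ?thesis by (simp add: top_dual_def)
qed

text \<open>The forms \<open>ip\<close> with fixed second argument belong to the topological dual
  and separate points. Hence the description in \<open>rep_at\<close> is meaningful.\<close>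

lemma weak_sum_unique:
  assumes "has_weak_sum smul f s" "has_weak_sum smul f t"
  shows "s = t"
proof -
  have "ip (s - t) v = 0" for v
    using assms ip_top_dual[of v] sums_unique2
    unfolding has_weak_sum_def ip_diff_left by fastforce
  then have "s - t = 0" by (rule ip_nondegenerate)
  then show ?thesis by simp
qed

lemma rep_at_weak_sum:
  assumes "\<nu> \<in> ball 0 R"
  shows "has_weak_sum smul (\<lambda>k. smul (\<nu> ^ k) (\<pi> (fps_const a) (fps_const m) $ k)) (rep_at smul \<pi> \<nu> a m)"
proof -
  obtain s where s: "has_weak_sum smul (\<lambda>k. smul (\<nu> ^ k) (\<pi> (fps_const a) (fps_const m) $ k)) s"
    using convergent assms sym_polys_const[of a] unfolding weakly_convergent_def by blast
  then show ?thesis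
    unfolding rep_at_def by (rule theI) (rule weak_sum_unique[OF _ s])
qed

lemma ip_rep_sums:
  assumes "\<nu> \<in> ball 0 R"
  shows "(\<lambda>k. ip (\<pi> (fps_const a) (fps_const u) $ k) v * \<nu> ^ k) sums ip (rep_at smul \<pi> \<nu> a u) v"
  using rep_at_weak_sum[OF assms, of a u] ip_top_dual[of v]
  unfolding has_weak_sum_def by (fastforce simp: ip_scale_left mult.commute)

text \<open>Conjugating the expansion at \<open>- cnj \<nu>\<close> gives a power series in \<nu>
  itself, comparable with that of \<open>ip_rep_sums\<close>.\<close>

lemma ip_rep_sums_right:
  assumes "\<nu> \<in> ball 0 R"
  shows "(\<lambda>k. (- 1) ^ k * ip u (\<pi> (fps_const a) (fps_const v) $ k) * \<nu> ^ k) sums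
    ip u (rep_at smul \<pi> (- cnj \<nu>) a v)"
proof -
  have "- cnj \<nu> \<in> ball 0 R" using assms by simp
  from sums_cnj[THEN iffD2, OF ip_rep_sums[OF this, of a v u]]
  have "(\<lambda>k. cnj (ip (\<pi> (fps_const a) (fps_const v) $ k) u) * (- \<nu>) ^ k) sums
      cnj (ip (rep_at smul \<pi> (- cnj \<nu>) a v) u)" by simp
  then show ?thesis
    unfolding ip_herm[symmetric] power_minus[of \<nu>] by (simp add: mult_ac)
qed

text \<open>Both statements equate the series of \<open>ip_rep_sums\<close> and
  \<open>ip_rep_sums_right\<close>: one through their sums on the imaginary axis, the other through
  their coefficients.\<close>

lemma unitary_iff_selfadjoint:
  "(\<forall>h\<in>{- R<..<R}. \<forall>u v. ip (rho smul \<pi> (of_real h) (X, 0) u) v = - ip u (rho smul \<pi> (of_real h) (X, 0) v))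
    \<longleftrightarrow> selfadjoint (fps_const (sym_lin (X, 0)))"
proof -
  let ?X = "sym_lin (X, 0)"
  let ?a = "\<lambda>u v k. ip (\<pi> (fps_const ?X) (fps_const u) $ k) v"
  let ?b = "\<lambda>u v k. (- 1) ^ k * ip u (\<pi> (fps_const ?X) (fps_const v) $ k)"
  let ?r = "\<lambda>\<nu>. rep_at smul \<pi> \<nu> ?X"
  \<comment> \<open>In the second argument -\<i> comes out as \<i>, which absorbs the minus sign:
    \<rho> is antihermitian exactly when \<pi> acts symmetrically.\<close>
  have rho: "ip (rho smul \<pi> (of_real h) (X, 0) u) v = - ip u (rho smul \<pi> (of_real h) (X, 0) v) \<longleftrightarrow>
      ip (?r (\<i> * of_real h) u) v = ip u (?r (\<i> * of_real h) v)" for h :: real and u v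
    by (simp add: rho_def ip_scale_left ip_scale_right del: scale_minus_left)
  have cnj: "- cnj (\<i> * of_real h) = \<i> * of_real h" for h :: real by simp
  have "selfadjoint (fps_const ?X) \<longleftrightarrow> (\<forall>u v k. ?a u v k = ?b u v k)"
  proof
    assume "selfadjoint (fps_const ?X)"
    then have "B (\<pi> (fps_const ?X) (fps_const u)) (fps_const v) $ k =
        B (fps_const u) (\<pi> (fps_const ?X) (fps_const v)) $ k" for u v k
      by (simp add: selfadjoint_def sym_series_star_const sym_cnj_lin_real)
    then show "\<forall>u v k. ?a u v k = ?b u v k" unfolding B_const_left B_const_right by blast
  next
    assume "\<forall>u v k. ?a u v k = ?b u v k"
    then show "selfadjoint (fps_const ?X)"
      by (intro selfadjointI_const fps_ext)
        (simp add: B_const_left B_const_right sym_series_star_const sym_cnj_lin_real)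
  qed
  also have "\<dots> \<longleftrightarrow> (\<forall>h\<in>{- R<..<R}. \<forall>u v. ip (?r (\<i> * of_real h) u) v = ip u (?r (\<i> * of_real h) v))"
  proof (intro iffI ballI allI)
    fix h u v assume ab: "\<forall>u v k. ?a u v k = ?b u v k" and "h \<in> {- R<..<R}"
    then have h: "\<i> * of_real h \<in> ball 0 R" by (simp add: norm_mult abs_less_iff)
    show "ip (?r (\<i> * of_real h) u) v = ip u (?r (\<i> * of_real h) v)"
      using sums_unique2[OF ip_rep_sums[OF h, of ?X u v]] ip_rep_sums_right[OF h, of u ?X v] ab
      unfolding cnj by simp
  next
    fix u v k
    assume eq: "\<forall>h\<in>{- R<..<R}. \<forall>u v. ip (?r (\<i> * of_real h) u) v = ip u (?r (\<i> * of_real h) v)"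
    have "?a u v k - ?b u v k = 0"
    proof (rule powser_zero_on_imaginary_axis[OF R_pos,
          where d = "\<lambda>k. ?a u v k - ?b u v k" and f = "\<lambda>\<nu>. ip (?r \<nu> u) v - ip u (?r (- cnj \<nu>) v)"])
      fix \<nu> :: complex assume "norm \<nu> < R"
      then have "\<nu> \<in> ball 0 R" by simp
      from sums_diff[OF ip_rep_sums[OF this] ip_rep_sums_right[OF this]]
      show "(\<lambda>k. (?a u v k - ?b u v k) * \<nu> ^ k) sums (ip (?r \<nu> u) v - ip u (?r (- cnj \<nu>) v))"
        by (simp add: left_diff_distrib)
    next
      fix h :: real assume "\<bar>h\<bar> < R"
      then have "h \<in> {- R<..<R}" by auto
      then show "ip (?r (\<i> * of_real h) u) v - ip u (?r (- cnj (\<i> * of_real h)) v) = 0"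
        unfolding cnj using eq by simp
    qed
    then show "?a u v k = ?b u v k" by simp
  qed
  finally show ?thesis unfolding rho by blast
qed

section \<open>The representations of the rescaled Lie algebras\<close>

lemma rep_at_props:
  assumes "\<nu> \<in> ball 0 R"
  shows rep_at_linear: "Vector_Spaces.linear smul smul (rep_at smul \<pi> \<nu> a)"
    and rep_at_add: "rep_at smul \<pi> \<nu> (a + b) u = rep_at smul \<pi> \<nu> a u + rep_at smul \<pi> \<nu> b u"
    and rep_at_scale: "rep_at smul \<pi> \<nu> (sym_const c * a) u = smul c (rep_at smul \<pi> \<nu> a u)"
    and rep_at_star: "rep_at smul \<pi> \<nu> (star_at br \<nu> a b) u = rep_at smul \<pi> \<nu> a (rep_at smul \<pi> \<nu> b u)"
  using rep[OF assms] unfolding algebra_rep_def by blast+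

lemma rep_at_smul: "\<nu> \<in> ball 0 R \<Longrightarrow> rep_at smul \<pi> \<nu> a (smul c u) = smul c (rep_at smul \<pi> \<nu> a u)"
  using rep_at_linear by (auto simp: Vector_Spaces.linear_iff)

lemma rep_at_commutator:
  assumes "\<nu> \<in> ball 0 R"
  shows "rep_at smul \<pi> \<nu> (sym_lin z) (rep_at smul \<pi> \<nu> (sym_lin w) u) -
      rep_at smul \<pi> \<nu> (sym_lin w) (rep_at smul \<pi> \<nu> (sym_lin z) u) =
    smul \<nu> (rep_at smul \<pi> \<nu> (sym_lin (cx_bracket br z w)) u)"
  using star_at_commutator[of \<nu> z w]
  by (simp add: rep_at_add[OF assms] rep_at_scale[OF assms] flip: rep_at_star[OF assms])

lemma rho_lie_rep:
  assumes "h \<in> ball 0 R"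
  shows "lie_rep (\<lambda>c. c) cx_scale (\<lambda>X Y. cx_scale h (cx_bracket br X Y)) smul (rho smul \<pi> h)"
proof -
  have h: "\<i> * h \<in> ball 0 R" using assms by (simp add: norm_mult)
  have linear: "Vector_Spaces.linear smul smul (rho smul \<pi> h z)" for z
    using rep_at_linear[OF h, of "sym_lin z"]
    by (auto simp: Vector_Spaces.linear_iff rho_def scale_right_distrib scale_left_commute)
  have bracket: "rho smul \<pi> h (cx_scale h (cx_bracket br z w)) u =
      rho smul \<pi> h z (rho smul \<pi> h w u) - rho smul \<pi> h w (rho smul \<pi> h z u)" for z w u
  proof -
    \<comment> \<open>The scalars multiply to (-\<i>)^2 \<i> h = -\<i> h: one factor -\<i> belongs
      to \<open>rho\<close>, and h rescales the bracket.\<close>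
    have "rho smul \<pi> h z (rho smul \<pi> h w u) - rho smul \<pi> h w (rho smul \<pi> h z u) =
        smul (- \<i> * - \<i>) (smul (\<i> * h) (rep_at smul \<pi> (\<i> * h) (sym_lin (cx_bracket br z w)) u))"
      by (simp only: rho_def rep_at_smul[OF h] scale_scale scale_right_diff_distrib
          rep_at_commutator[OF h, symmetric])
    then show ?thesis
      by (simp add: rho_def sym_lin_scale rep_at_scale[OF h])
  qed
  show ?thesis
    unfolding lie_rep_def
    using linear bracket
    by (auto simp: rho_def sym_lin_add sym_lin_scale rep_at_add[OF h] rep_at_scale[OF h]
        scale_right_distrib scale_left_commute)
qed

text \<open>On real elements \<open>cx_bracket\<close> and scaling by real numbers reduce to
  \<open>br\<close> and \<open>scaleR\<close>, so the complex representation restricts.\<close>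

lemma rho_lie_rep_real:
  assumes "\<bar>h\<bar> < R"
  shows "lie_rep complex_of_real scaleR (\<lambda>X Y. h *\<^sub>R br X Y) smul (\<lambda>X. rho smul \<pi> (complex_of_real h) (X, 0))"
proof -
  have rep: "lie_rep (\<lambda>c. c) cx_scale (\<lambda>X Y. cx_scale h (cx_bracket br X Y)) smul (rho smul \<pi> h)"
    by (rule rho_lie_rep) (use assms in simp)
  have add: "(X + Y, 0) = (X, 0) + (Y, 0 :: 'g)" for X Y :: 'g by simp
  have scale: "(c *\<^sub>R X, 0) = cx_scale (complex_of_real c) (X, 0)" for c and X :: 'g
    by (simp add: cx_scale_def)
  have bracket: "(br X Y, 0) = cx_bracket br (X, 0) (Y, 0)" for X Y
    by (simp add: cx_bracket_def bilinear_lzero[OF bilinear_br] bilinear_rzero[OF bilinear_br])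
  show ?thesis
    using rep unfolding lie_rep_def add scale bracket by blast
qed

end

theorem mainTheorem7:
  fixes br :: "'g::real_vector \<Rightarrow> 'g \<Rightarrow> 'g"
    and smul :: "complex \<Rightarrow> 'm::{topological_ab_group_add, t2_space} \<Rightarrow> 'm"
    and ip :: "'m \<Rightarrow> 'm \<Rightarrow> complex"
    and \<pi> :: "'g sym fps \<Rightarrow> 'm fps \<Rightarrow> 'm fps"
    and R :: real
  assumes "lie_algebra br" and "finite_dimensional TYPE('g)"
    and "R > 0"
    and "locally_convex_space smul" and "pre_hilbert smul ip"
    and "top_free_module br smul \<pi>" and "weakly_convergent smul \<pi> R"
    and "\<And>\<nu>\<^sub>0. \<nu>\<^sub>0 \<in> ball 0 R \<Longrightarrow> algebra_rep (star_at br \<nu>\<^sub>0) smul (rep_at smul \<pi> \<nu>\<^sub>0)"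
  shows "(\<forall>h::real. \<bar>h\<bar> < R \<longrightarrow>
            lie_rep complex_of_real scaleR (\<lambda>X Y. h *\<^sub>R br X Y) smul
              (\<lambda>X. rho smul \<pi> (complex_of_real h) (X, 0)))
       \<and> (\<forall>h\<in>ball 0 R. h \<notin> \<real> \<longrightarrow>
            lie_rep (\<lambda>c. c) cx_scale (\<lambda>X Y. cx_scale h (cx_bracket br X Y)) smul
              (rho smul \<pi> h))
       \<and> ((\<forall>h\<in>{-R<..<R}. unitary_rep ip (\<lambda>X. rho smul \<pi> (complex_of_real h) (X, 0)))
            \<longleftrightarrow> strongly_unitary_module smul \<pi> (form_ext ip))"
proof -
  have "vector_space smul" using assms(4) by (simp add: locally_convex_space_def)
  then interpret vector_space smul .
  interpret scalar_product smul ip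
    using assms(5) unfolding pre_hilbert_def by unfold_locales blast+
  interpret convergent_duflo_module br smul ip \<pi> R
    by unfold_locales (use assms in auto)
  have "(\<forall>h\<in>{-R<..<R}. unitary_rep ip (\<lambda>X. rho smul \<pi> (complex_of_real h) (X, 0)))
      \<longleftrightarrow> strongly_unitary_module smul \<pi> (form_ext ip)"
    unfolding strongly_unitary_iff unitary_iff_selfadjoint[symmetric] unitary_rep_def by blast
  then show ?thesis using rho_lie_rep rho_lie_rep_real by blast
qed

end
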